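(* Let $\mathfrak{u}$ be a compact Lie algebra, let $d$ be the number of elements of the stem $\Gamma$ of $\Delta^+$, suppose $2d=\operatorname{rank}(\mathfrak{g})$, and let $I$ be an admissible $\mathfrak{b}^+$-complex structure on $\mathfrak{u}$. Then there is exactly one (up to choice of $\rho$) complex structure $J$ matching $I$; that is: for every $J$ matching $I$ and every $\gamma\in\Gamma$ one has $JE_{-\gamma}\in\mathfrak{h}$ and the number $\rho_\gamma:=i\gamma(JE_{-\gamma})$ satisfies $|\rho_\gamma|=1$, and for every family $\rho=(\rho_\gamma)_{\gamma\in\Gamma}$ of complex numbers of modulus $1$ there is exactly one $J$ matching $I$ with $i\gamma(JE_{-\gamma})=\rho_\gamma$ for all $\gamma\in\Gamma$. For $\rho_\gamma=1$ for all $\gamma\in\Gamma$, the operator $J$ is given, for $\gamma\in\Gamma$ and $\alpha\in\Phi_\gamma^+$, by $$JW_\gamma=-X_\gamma,\qquad JZ_\gamma=Y_\gamma,\qquad JX_\alpha=-N_{\gamma,-\mu(\alpha)}Y_{\mu(\alpha)} .$$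
   Context: $\mathfrak{u}$ is a compact Lie algebra, $\mathfrak{g}=\mathfrak{u}^{\mathbb C}$, $\tau$ the conjugation of $\mathfrak{g}$ with respect to $\mathfrak{u}$, $\mathfrak{h}$ a $\tau$-stable Cartan subalgebra of $\mathfrak{g}$, $\Delta\subset\mathfrak{h}^*$ the roots, $\Delta^+$ a system of positive roots, $\mathfrak{g}(\alpha)$ the root spaces, $\mathfrak{n}^+=\bigoplus_{\alpha\in\Delta^+}\mathfrak{g}(\alpha)$, $\mathfrak{b}^+=\mathfrak{h}\oplus\mathfrak{n}^+$, $H_\alpha\in\mathfrak{h}$ the coroot of $\alpha$ ($\alpha(H_\alpha)=2$). Fix a Weyl–Chevalley basis: $E_\alpha\in\mathfrak{g}(\alpha)$, $[E_\alpha,E_{-\alpha}]=H_\alpha$, $[E_\alpha,E_\beta]=N_{\alpha,\beta}E_{\alpha+\beta}$ for $\alpha,\beta,\alpha+\beta\in\Delta$, with integers $N_{\alpha,\beta}=-N_{-\alpha,-\beta}$, $|N_{\alpha,\beta}|=1-p_0$ where $\beta+n\alpha$, $p_0\le n\le q_0$, is the $\alpha$-series of $\beta$; and $\tau(E_\alpha)=-E_{-\alpha}$, $\tau(H_\alpha)=-H_\alpha$. Stem: $\Phi_\gamma^+=\{\alpha\in\Delta^+\mid\gamma-\alpha\in\Delta^+\}$; $\Gamma$ is the unique subset of $\Delta^+$ with $\Delta^+=\Gamma\cup\bigcup_{\gamma\in\Gamma}\Phi_\gamma^+$ (disjoint union). For $\alpha\in\Phi_\gamma^+$, $\gamma\in\Gamma$,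 $\mu(\alpha)=\gamma-\alpha$. A complex structure on $\mathfrak{u}$ is a linear $I:\mathfrak{u}\to\mathfrak{u}$ with $I^2=-1$, extended $\mathbb C$-linearly to $\mathfrak{g}$; $\mathfrak{m}_I^{+}=\{X\in\mathfrak{g}\mid IX=iX\}$. $I$ is integrable if $\mathfrak{m}_I^+$ is a subalgebra. $I$ is a $\mathfrak{b}^+$-complex structure if it is integrable and the normalizer of $\mathfrak{m}_I^+$ in $\mathfrak{g}$ is $\mathfrak{b}^+$ (then $\mathfrak m_I^+=(\mathfrak h\cap\mathfrak m_I^+)\oplus\mathfrak n^+$). $J$ matches $I$ if $J$ is an integrable complex structure on $\mathfrak{u}$ with $IJ=-JI$; $I$ is admissible if some $J$ matches $I$. For $\alpha\in\Delta^+$: $X_\alpha=\frac12(E_\alpha-E_{-\alpha})$, $Y_\alpha=\frac i2(E_\alpha+E_{-\alpha})$; for $\gamma\in\Gamma$: $W_\gamma=\frac i2H_\gamma$, $Z_\gamma=IW_\gamma$. *)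

theory Defs
  imports "HOL-Analysis.Analysis" "HOL-Library.Function_Algebras"
begin

section \<open>Compact Lie algebras\<close>

definition lie_bracket :: "('u::real_vector \<Rightarrow> 'u \<Rightarrow> 'u) \<Rightarrow> bool" where
  "lie_bracket br \<longleftrightarrow> bilinear br \<and> (\<forall>x. br x x = 0) \<and>
     (\<forall>x y z. br x (br y z) + br y (br z x) + br z (br x y) = 0)"

text \<open>Compact means: finite-dimensional, with an inner product for which every \<open>ad x\<close> is
  skew-symmetric. The algebra need not be semisimple; it may have a centre.\<close>

definition compact_lie_algebra :: "('u::real_vector \<Rightarrow> 'u \<Rightarrow> 'u) \<Rightarrow> bool" where
  "compact_lie_algebra br \<longleftrightarrow> lie_bracket br \<and>
     (\<exists>B::'u set. finite B \<and> span B = UNIV) \<and>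
     (\<exists>ip::'u \<Rightarrow> 'u \<Rightarrow> real. bilinear ip \<and> (\<forall>x y. ip x y = ip y x) \<and>
        (\<forall>x. x \<noteq> 0 \<longrightarrow> ip x x > 0) \<and> (\<forall>x y z. ip (br x y) z = - ip y (br x z)))"

section \<open>The complexification\<close>

text \<open>The pair \<open>(x, y)\<close> stands for \<open>x + \<i>y\<close>; the real form consists of the pairs \<open>(x, 0)\<close>.\<close>

type_synonym 'u cpx = "'u \<times> 'u"

definition csc :: "complex \<Rightarrow> 'u::real_vector cpx \<Rightarrow> 'u cpx" where
  "csc c X = (Re c *\<^sub>R fst X - Im c *\<^sub>R snd X, Re c *\<^sub>R snd X + Im c *\<^sub>R fst X)"

interpretation cx: vector_space csc
  by unfold_locales
    (auto simp: csc_def algebra_simps prod_eq_iff)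

definition cbr :: "('u::real_vector \<Rightarrow> 'u \<Rightarrow> 'u) \<Rightarrow> 'u cpx \<Rightarrow> 'u cpx \<Rightarrow> 'u cpx" where
  "cbr br X Y = (br (fst X) (fst Y) - br (snd X) (snd Y), br (fst X) (snd Y) + br (snd X) (fst Y))"

definition tau :: "'u::real_vector cpx \<Rightarrow> 'u cpx" where
  "tau X = (fst X, - snd X)"

text \<open>The \<open>\<complex>\<close>-linear extension of a linear map of the real form.\<close>

definition cext :: "('u \<Rightarrow> 'u) \<Rightarrow> 'u cpx \<Rightarrow> 'u cpx" where
  "cext T X = (T (fst X), T (snd X))"

section \<open>Subalgebras\<close>

definition csubalgebra :: "('u::real_vector \<Rightarrow> 'u \<Rightarrow> 'u) \<Rightarrow> 'u cpx set \<Rightarrow> bool" where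
  "csubalgebra br s \<longleftrightarrow> cx.subspace s \<and> (\<forall>X\<in>s. \<forall>Y\<in>s. cbr br X Y \<in> s)"

definition normalizer :: "('u::real_vector \<Rightarrow> 'u \<Rightarrow> 'u) \<Rightarrow> 'u cpx set \<Rightarrow> 'u cpx set" where
  "normalizer br s = {X. \<forall>Y\<in>s. cbr br X Y \<in> s}"

text \<open>\<open>bracket_space br A B\<close> is the complex subspace \<open>[A, B]\<close>.\<close>

definition bracket_space ::
  "('u::real_vector \<Rightarrow> 'u \<Rightarrow> 'u) \<Rightarrow> 'u cpx set \<Rightarrow> 'u cpx set \<Rightarrow> 'u cpx set" where
  "bracket_space br A B = cx.span {cbr br X Y | X Y. X \<in> A \<and> Y \<in> B}"

primrec lower_central :: "('u::real_vector \<Rightarrow> 'u \<Rightarrow> 'u) \<Rightarrow> 'u cpx set \<Rightarrow> nat \<Rightarrow> 'u cpx set" where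
  "lower_central br s 0 = s"
| "lower_central br s (Suc n) = bracket_space br s (lower_central br s n)"

definition cartan_subalgebra :: "('u::real_vector \<Rightarrow> 'u \<Rightarrow> 'u) \<Rightarrow> 'u cpx set \<Rightarrow> bool" where
  "cartan_subalgebra br h \<longleftrightarrow> csubalgebra br h \<and> (\<exists>n. lower_central br h n = {0}) \<and>
     normalizer br h = h"

section \<open>Roots\<close>

text \<open>A functional on \<open>h\<close> is represented by its extension by zero to the whole complexification,
  so that equality of functionals is equality of functions and sums, differences and negatives
  (the pointwise operations of \<open>Function_Algebras\<close>) stay inside the dual.\<close>

definition dual :: "'u::real_vector cpx set \<Rightarrow> ('u cpx \<Rightarrow> complex) set" where
  "dual h = {f. (\<forall>X. X \<notin> h \<longrightarrow> f X = 0) \<and>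
     (\<forall>X\<in>h. \<forall>Y\<in>h. f (X + Y) = f X + f Y) \<and> (\<forall>c. \<forall>X\<in>h. f (csc c X) = c * f X)}"

definition root_space ::
  "('u::real_vector \<Rightarrow> 'u \<Rightarrow> 'u) \<Rightarrow> 'u cpx set \<Rightarrow> ('u cpx \<Rightarrow> complex) \<Rightarrow> 'u cpx set" where
  "root_space br h \<alpha> = {X. \<forall>H\<in>h. cbr br H X = csc (\<alpha> H) X}"

definition roots ::
  "('u::real_vector \<Rightarrow> 'u \<Rightarrow> 'u) \<Rightarrow> 'u cpx set \<Rightarrow> ('u cpx \<Rightarrow> complex) set" where
  "roots br h = {\<alpha> \<in> dual h. \<alpha> \<noteq> 0 \<and> root_space br h \<alpha> \<noteq> {0}}"

definition positive_system ::
  "('u::real_vector \<Rightarrow> 'u \<Rightarrow> 'u) \<Rightarrow> 'u cpx set \<Rightarrow> ('u cpx \<Rightarrow> complex) set \<Rightarrow> bool" where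
  "positive_system br h P \<longleftrightarrow> P \<subseteq> roots br h \<and>
     (\<forall>\<alpha>\<in>roots br h. (\<alpha> \<in> P) \<noteq> (- \<alpha> \<in> P)) \<and>
     (\<forall>\<alpha>\<in>P. \<forall>\<beta>\<in>P. \<alpha> + \<beta> \<in> roots br h \<longrightarrow> \<alpha> + \<beta> \<in> P)"

definition n_plus ::
  "('u::real_vector \<Rightarrow> 'u \<Rightarrow> 'u) \<Rightarrow> 'u cpx set \<Rightarrow> ('u cpx \<Rightarrow> complex) set \<Rightarrow> 'u cpx set" where
  "n_plus br h P = cx.span (\<Union>\<alpha>\<in>P. root_space br h \<alpha>)"

definition b_plus ::
  "('u::real_vector \<Rightarrow> 'u \<Rightarrow> 'u) \<Rightarrow> 'u cpx set \<Rightarrow> ('u cpx \<Rightarrow> complex) set \<Rightarrow> 'u cpx set" where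
  "b_plus br h P = {H + X | H X. H \<in> h \<and> X \<in> n_plus br h P}"

text \<open>Since \<open>\<alpha>\<close> vanishes off \<open>h\<close>, the normalisation \<open>\<alpha> H = 2\<close> forces \<open>H \<in> h\<close>.\<close>

definition coroot ::
  "('u::real_vector \<Rightarrow> 'u \<Rightarrow> 'u) \<Rightarrow> 'u cpx set \<Rightarrow> ('u cpx \<Rightarrow> complex) \<Rightarrow> 'u cpx" where
  "coroot br h \<alpha> =
     (THE H. H \<in> bracket_space br (root_space br h \<alpha>) (root_space br h (- \<alpha>)) \<and> \<alpha> H = 2)"

definition weyl_chevalley_basis ::
  "('u::real_vector \<Rightarrow> 'u \<Rightarrow> 'u) \<Rightarrow> 'u cpx set \<Rightarrow> (('u cpx \<Rightarrow> complex) \<Rightarrow> 'u cpx) \<Rightarrow>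
   (('u cpx \<Rightarrow> complex) \<Rightarrow> ('u cpx \<Rightarrow> complex) \<Rightarrow> int) \<Rightarrow> bool" where
  "weyl_chevalley_basis br h E N \<longleftrightarrow>
     (\<forall>\<alpha>\<in>roots br h.
        E \<alpha> \<in> root_space br h \<alpha> \<and>
        cbr br (E \<alpha>) (E (- \<alpha>)) = coroot br h \<alpha> \<and>
        tau (E \<alpha>) = - E (- \<alpha>) \<and>
        tau (coroot br h \<alpha>) = - coroot br h \<alpha>) \<and>
     (\<forall>\<alpha>\<in>roots br h. \<forall>\<beta>\<in>roots br h. \<alpha> + \<beta> \<in> roots br h \<longrightarrow>
        cbr br (E \<alpha>) (E \<beta>) = csc (of_int (N \<alpha> \<beta>)) (E (\<alpha> + \<beta>)) \<and>
        N \<alpha> \<beta> = - N (- \<alpha>) (- \<beta>) \<and>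
        (\<exists>p0 q0. {n::int. \<beta> + (\<lambda>H. of_int n * \<alpha> H) \<in> roots br h} = {p0..q0} \<and>
           \<bar>N \<alpha> \<beta>\<bar> = 1 - p0))"

section \<open>The stem\<close>

definition Phi_plus :: "('u cpx \<Rightarrow> complex) set \<Rightarrow> ('u cpx \<Rightarrow> complex) \<Rightarrow> ('u cpx \<Rightarrow> complex) set" where
  "Phi_plus P \<gamma> = {\<alpha> \<in> P. \<gamma> - \<alpha> \<in> P}"

definition is_stem :: "('u cpx \<Rightarrow> complex) set \<Rightarrow> ('u cpx \<Rightarrow> complex) set \<Rightarrow> bool" where
  "is_stem P \<Gamma> \<longleftrightarrow> \<Gamma> \<subseteq> P \<and> P = \<Gamma> \<union> (\<Union>\<gamma>\<in>\<Gamma>. Phi_plus P \<gamma>) \<and>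
     (\<forall>\<gamma>\<in>\<Gamma>. \<Gamma> \<inter> Phi_plus P \<gamma> = {}) \<and>
     (\<forall>\<gamma>\<in>\<Gamma>. \<forall>\<delta>\<in>\<Gamma>. \<gamma> \<noteq> \<delta> \<longrightarrow> Phi_plus P \<gamma> \<inter> Phi_plus P \<delta> = {})"

section \<open>Complex structures\<close>

definition complex_structure :: "('u::real_vector \<Rightarrow> 'u) \<Rightarrow> bool" where
  "complex_structure I \<longleftrightarrow> linear I \<and> (\<forall>x. I (I x) = - x)"

definition m_plus :: "('u::real_vector \<Rightarrow> 'u) \<Rightarrow> 'u cpx set" where
  "m_plus I = {X. cext I X = csc \<i> X}"

definition integrable_structure :: "('u::real_vector \<Rightarrow> 'u \<Rightarrow> 'u) \<Rightarrow> ('u \<Rightarrow> 'u) \<Rightarrow> bool" where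
  "integrable_structure br I \<longleftrightarrow> complex_structure I \<and> csubalgebra br (m_plus I)"

definition b_complex_structure ::
  "('u::real_vector \<Rightarrow> 'u \<Rightarrow> 'u) \<Rightarrow> 'u cpx set \<Rightarrow> ('u cpx \<Rightarrow> complex) set \<Rightarrow> ('u \<Rightarrow> 'u) \<Rightarrow> bool" where
  "b_complex_structure br h P I \<longleftrightarrow>
     integrable_structure br I \<and> normalizer br (m_plus I) = b_plus br h P"

text \<open>\<open>matches br I J\<close>: the structure \<open>J\<close> matches \<open>I\<close>.\<close>

definition matches :: "('u::real_vector \<Rightarrow> 'u \<Rightarrow> 'u) \<Rightarrow> ('u \<Rightarrow> 'u) \<Rightarrow> ('u \<Rightarrow> 'u) \<Rightarrow> bool" where
  "matches br I J \<longleftrightarrow> integrable_structure br J \<and> (\<forall>x. I (J x) = - J (I x))"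

definition admissible :: "('u::real_vector \<Rightarrow> 'u \<Rightarrow> 'u) \<Rightarrow> ('u \<Rightarrow> 'u) \<Rightarrow> bool" where
  "admissible br I \<longleftrightarrow> (\<exists>J. matches br I J)"

section \<open>The vectors $X_\alpha$, $Y_\alpha$, $W_\gamma$, $Z_\gamma$\<close>

definition Xvec :: "(('u::real_vector cpx \<Rightarrow> complex) \<Rightarrow> 'u cpx) \<Rightarrow> ('u cpx \<Rightarrow> complex) \<Rightarrow> 'u cpx" where
  "Xvec E \<alpha> = csc (1 / 2) (E \<alpha> - E (- \<alpha>))"

definition Yvec :: "(('u::real_vector cpx \<Rightarrow> complex) \<Rightarrow> 'u cpx) \<Rightarrow> ('u cpx \<Rightarrow> complex) \<Rightarrow> 'u cpx" where
  "Yvec E \<alpha> = csc (\<i> / 2) (E \<alpha> + E (- \<alpha>))"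

definition Wvec ::
  "('u::real_vector \<Rightarrow> 'u \<Rightarrow> 'u) \<Rightarrow> 'u cpx set \<Rightarrow> ('u cpx \<Rightarrow> complex) \<Rightarrow> 'u cpx" where
  "Wvec br h \<gamma> = csc (\<i> / 2) (coroot br h \<gamma>)"

definition Zvec ::
  "('u::real_vector \<Rightarrow> 'u \<Rightarrow> 'u) \<Rightarrow> 'u cpx set \<Rightarrow> ('u \<Rightarrow> 'u) \<Rightarrow> ('u cpx \<Rightarrow> complex) \<Rightarrow> 'u cpx" where
  "Zvec br h I \<gamma> = cext I (Wvec br h \<gamma>)"

end

theory Submission
  imports Defs "HOL-Computational_Algebra.Fundamental_Theorem_Algebra"
begin

text \<open>Let \<open>pp\<close> and \<open>pm\<close> be the projections onto the \<open>\<plusminus>\<i>\<close>-eigenspaces \<open>mp\<close> and \<open>mm\<close> of \<open>I\<close>.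
  A matching \<open>J\<close> maps \<open>mp\<close> to \<open>mm\<close>, and its integrability says that it is a
  1-cocycle of \<open>mp\<close> with values in the quotient by \<open>mp\<close>. Up to a map that vanishes on the
  root vectors such a cocycle is a coboundary \<open>X \<mapsto> pm [X, F]\<close> with \<open>F = \<Sum> c \<nu> E (- \<nu>)\<close>, the
  sum ranging over the positive roots. Descending along the stem, \<open>J\<^sup>2 = - 1\<close> on \<open>E \<gamma>\<close> forces
  \<open>\<bar>c \<gamma>\<bar> = 1\<close>, \<open>\<gamma> (pp H) = 1\<close> for the coroot \<open>H\<close> of \<open>\<gamma>\<close>, and \<open>c \<nu> = 0\<close> for every other
  \<open>\<nu>\<close> not orthogonal to \<open>\<gamma>\<close>. So only the numbers \<open>c \<gamma>\<close> with \<open>\<gamma>\<close> in the stem remain, and if twice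
  the size of the stem is the rank, the vectors \<open>pp H\<close>, \<open>pm H\<close> span the Cartan subalgebra, so
  that they determine \<open>J\<close>. Conversely the square of the coboundary depends only on the
  moduli of the \<open>c \<gamma>\<close>, so all phases occur as soon as one does.\<close>

section \<open>Common eigenvectors\<close>

text \<open>Compactness enters through a Hermitian form for which every element of \<open>h\<close>
  acts as a normal operator; this yields the root decomposition, one-dimensional root spaces and the
  sum criteria for roots. A positive system is given only by closure under sums, so the descent runs
  along a relation generated by differences that are positive roots. The coefficients of
  \<open>F\<close> come from two commuting elements \<open>H\<close>, \<open>K\<close> of
  \<open>h \<inter> mp\<close>: the cocycle identity at weight \<open>- \<nu>\<close> makes the
  coordinate of \<open>J' H\<close> proportional to \<open>\<nu> H\<close>. What \<open>F\<close>
  cannot see is the part of \<open>J'\<close> mapping \<open>h \<inter> mp\<close> into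
  \<open>h\<close>; the rank hypothesis settles it, as the vectors \<open>pp (Hc \<gamma>)\<close>
  and their conjugates then span \<open>h\<close>, and \<open>J'\<close> is known on them. The
  modulus is 1 because the square of \<open>J'\<close> gives \<open>\<bar>c\<bar>\<close>-squared
  times \<open>\<gamma> (pp (Hc \<gamma>))\<close> equal to 1, while compatibility with
  \<open>tau\<close> fixes the real part of the second factor at 1. For existence, the signs of the
  structure constants are not computed but read off from the one structure that admissibility
  provides.\<close>

lemma polynomial_annihilates:
  fixes scale :: "complex \<Rightarrow> 'b::ab_group_add \<Rightarrow> 'b"
  assumes "finite_dimensional_vector_space scale B"
  shows "\<exists>p. p \<noteq> 0 \<and> (\<Sum>i\<le>degree p. scale (coeff p i) ((A ^^ i) v)) = 0"
proof -
  interpret V: finite_dimensional_vector_space scale B by fact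
  define f where "f i = (A ^^ i) v" for i :: nat
  have ev: "(\<Sum>i\<le>degree p. scale (coeff p i) (f i)) = (\<Sum>i\<le>n. scale (coeff p i) (f i))"
    if "degree p \<le> n" for p n
    by (rule sum.mono_neutral_left) (use that in \<open>auto simp: coeff_eq_0\<close>)
  \<comment> \<open>Linear dependence is a property of sets, so a repetition among the iterates is
    treated apart; without one, \<open>n + 1\<close> iterates exceed the dimension
    \<open>n\<close>.\<close>
  show ?thesis
  proof (cases "inj f")
    case False
    then obtain i j where ij: "i \<noteq> j" "f i = f j" by (auto simp: inj_def)
    define p :: "complex poly" where "p = monom 1 i - monom 1 j"
    have p0: "p \<noteq> 0" using ij by (auto simp: p_def poly_eq_iff)
    have d: "degree p \<le> i + j" unfolding p_def
      by (rule degree_diff_le) (auto simp: degree_monom_eq)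
    have "(\<Sum>k\<le>i + j. scale (coeff p k) (f k)) =
          (\<Sum>k\<le>i + j. (if k = i then f k else 0) - (if k = j then f k else 0))"
      by (rule sum.cong) (auto simp: p_def)
    also have "\<dots> = 0" using ij by (simp add: sum_subtractf)
    finally show ?thesis using p0 ev[OF d] f_def by auto
  next
    case True
    define n where "n = card B"
    have "V.dependent (f ` {..n})"
    proof (rule ccontr)
      assume "\<not> V.dependent (f ` {..n})"
      then have "card (f ` {..n}) \<le> V.dim UNIV"
        by (rule V.independent_card_le_dim[rotated]) auto
      moreover have "card (f ` {..n}) = Suc n" using True by (simp add: card_image inj_on_subset)
      ultimately show False by (simp add: V.dim_UNIV n_def V.dimension_def)
    qed
    then obtain u where u: "\<exists>v\<in>f ` {..n}. u v \<noteq> 0" "(\<Sum>v\<in>f ` {..n}. scale (u v) v) = 0"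
      by (subst (asm) V.dependent_finite) auto
    have s: "(\<Sum>i\<le>n. scale (u (f i)) (f i)) = 0"
      using u(2) by (subst (asm) sum.reindex) (use True inj_on_subset in \<open>auto\<close>)
    define p where "p = Abs_poly (\<lambda>i. if i \<le> n then u (f i) else 0)"
    have cp: "coeff p = (\<lambda>i. if i \<le> n then u (f i) else 0)"
      unfolding p_def by (rule Abs_poly_inverse)
        (auto simp: MOST_nat intro!: exI[of _ n])
    have "degree p \<le> n" by (rule degree_le) (auto simp: cp)
    moreover have "p \<noteq> 0"
    proof -
      obtain i where "i \<le> n" "u (f i) \<noteq> 0" using u(1) by auto
      then have "coeff p i \<noteq> 0" by (simp add: cp)
      then show ?thesis by auto
    qed
    moreover have "(\<Sum>i\<le>n. scale (coeff p i) (f i)) = 0" using s by (simp add: cp)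
    ultimately show ?thesis using ev[of p n] unfolding f_def by auto
  qed
qed

text \<open>A linear factor is split off from an annihilating polynomial,
  \<open>p = (x - a) q\<close>: either \<open>w = q(A) v\<close> is nonzero and an eigenvector for
  \<open>a\<close>, or \<open>q\<close> annihilates \<open>v\<close> and has smaller degree. All
  vectors that arise are combinations of iterates of \<open>v\<close>, hence in
  \<open>W\<close>.\<close>

lemma eigenvector_in_invariant_subspace:
  fixes scale :: "complex \<Rightarrow> 'b::ab_group_add \<Rightarrow> 'b"
  assumes fd: "finite_dimensional_vector_space scale B"
    and lin: "Vector_Spaces.linear scale scale A"
    and W: "module.subspace scale W" "\<And>x. x \<in> W \<Longrightarrow> A x \<in> W"
    and v: "v \<in> W" "v \<noteq> 0"
  shows "\<exists>x\<in>W. \<exists>c. x \<noteq> 0 \<and> A x = scale c x"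
proof -
  interpret V: finite_dimensional_vector_space scale B by fact
  interpret A: Vector_Spaces.linear scale scale A by fact
  have pw: "(A ^^ i) v \<in> W" for i by (induction i) (auto simp: v W(2))
  have "p \<noteq> 0 \<Longrightarrow> (\<Sum>i\<le>degree p. scale (coeff p i) ((A ^^ i) v)) = 0 \<Longrightarrow> ?thesis" for p
  proof (induction "degree p" arbitrary: p)
    case 0
    then have "scale (coeff p 0) v = 0" "coeff p 0 \<noteq> 0"
      by (auto simp: leading_coeff_0_iff[symmetric] simp del: leading_coeff_0_iff)
    then show ?case using v by simp
  next
    case (Suc n)
    have "\<not> constant (poly p)" using Suc.hyps(2) by (simp add: constant_degree)
    then obtain a where "poly p a = 0" using fundamental_theorem_of_algebra by blast
    then obtain q where pq: "p = [:-a, 1:] * q" by (metis dvdE poly_eq_0_iff_dvd)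
    with Suc.prems have q0: "q \<noteq> 0" by auto
    have dq: "degree q = n"
      using Suc.hyps(2) q0 degree_mult_eq[of "[:-a, 1:]" q] unfolding pq by (simp del: mult_pCons_left)
    define w where "w = (\<Sum>i\<le>n. scale (coeff q i) ((A ^^ i) v))"
    have wW: "w \<in> W" unfolding w_def
      by (intro V.subspace_sum V.subspace_scale W(1) pw)
    have "A w = (\<Sum>i\<le>n. scale (coeff q i) ((A ^^ Suc i) v))"
      by (simp add: w_def A.sum A.scale)
    \<comment> \<open>\<open>A w\<close> and \<open>a w\<close> are both written as sums up to
      \<open>Suc n\<close>, padded by a zero at index 0 and at index \<open>Suc n\<close>
      respectively, for a termwise comparison with \<open>p\<close>.\<close>
    also have "\<dots> = (\<Sum>i\<le>Suc n. if i = 0 then 0 else scale (coeff q (i - 1)) ((A ^^ i) v))"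
      by (subst sum.atMost_Suc_shift) simp
    finally have Aw: "A w = (\<Sum>i\<le>Suc n. if i = 0 then 0 else scale (coeff q (i - 1)) ((A ^^ i) v))" .
    have "w = (\<Sum>i\<le>Suc n. scale (coeff q i) ((A ^^ i) v))"
      by (simp add: w_def coeff_eq_0 dq)
    then have aw: "scale a w = (\<Sum>i\<le>Suc n. scale (a * coeff q i) ((A ^^ i) v))"
      by (simp only: V.scale_sum_right V.scale_scale)
    have coord: "coeff p i = (if i = 0 then 0 else coeff q (i - 1)) - a * coeff q i" for i
      by (cases i) (simp_all add: pq)
    have "0 = (\<Sum>i\<le>Suc n. scale (coeff p i) ((A ^^ i) v))"
      using Suc.prems(2) Suc.hyps(2) by simp
    also have "\<dots> = A w - scale a w"
      unfolding Aw aw sum_subtractf[symmetric]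
      by (rule sum.cong) (auto simp: coord V.scale_left_diff_distrib V.scale_minus_left)
    finally have eig: "A w = scale a w" by simp
    show ?case
    proof (cases "w = 0")
      case True
      then show ?thesis using Suc.hyps(1)[of q] q0 dq by (simp add: w_def)
    next
      case False
      then show ?thesis using wW eig by blast
    qed
  qed
  then show ?thesis using polynomial_annihilates[OF fd, of A v] by blast
qed

text \<open>Induction on the dimension: an operator that is not scalar on \<open>W\<close> has a
  proper eigenspace there, and the others preserve it because they commute. Since the dimension
  drops, an infinite family such as \<open>h\<close> causes no difficulty.\<close>

lemma common_eigenvector:
  fixes scale :: "complex \<Rightarrow> 'b::ab_group_add \<Rightarrow> 'b"
  assumes fd: "finite_dimensional_vector_space scale B"
    and lin: "\<And>i. i \<in> S \<Longrightarrow> Vector_Spaces.linear scale scale (A i)"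
    and comm: "\<And>i j x. i \<in> S \<Longrightarrow> j \<in> S \<Longrightarrow> A i (A j x) = A j (A i x)"
    and W: "module.subspace scale W" "\<And>i x. i \<in> S \<Longrightarrow> x \<in> W \<Longrightarrow> A i x \<in> W" "W \<noteq> {0}"
  shows "\<exists>x\<in>W. x \<noteq> 0 \<and> (\<forall>i\<in>S. \<exists>c. A i x = scale c x)"
proof -
  interpret V: finite_dimensional_vector_space scale B by fact
  show ?thesis using W
  proof (induction "V.dim W" arbitrary: W rule: less_induct)
    case less
    obtain v where v: "v \<in> W" "v \<noteq> 0"
      using less.prems(1,3) V.subspace_0 by blast
    show ?case
    proof (cases "\<forall>i\<in>S. \<exists>c. \<forall>x\<in>W. A i x = scale c x")
      case True
      then show ?thesis using v by metis
    next
      case False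
      then obtain i where i: "i \<in> S" "\<And>c. \<exists>x\<in>W. A i x \<noteq> scale c x" by blast
      obtain x c where x: "x \<in> W" "x \<noteq> 0" "A i x = scale c x"
        using eigenvector_in_invariant_subspace[OF fd lin[OF i(1)] less.prems(1) less.prems(2)[OF i(1)] v]
        by blast
      define W' where "W' = {y \<in> W. A i y = scale c y}"
      interpret A: Vector_Spaces.linear scale scale "A i" by (rule lin) fact
      have s: "V.subspace W'" unfolding W'_def
        using less.prems(1)
        by (auto simp: V.subspace_def A.add A.scale A.zero V.scale_right_distrib mult.commute)
      have "W' \<subset> W" using i(2)[of c] by (auto simp: W'_def)
      then have "V.dim W' < V.dim W"
        using s less.prems(1) V.dim_psubset by (metis V.span_eq_iff)
      moreover have "A j y \<in> W'" if "j \<in> S" "y \<in> W'" for j y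
      proof -
        interpret Aj: Vector_Spaces.linear scale scale "A j" by (rule lin) fact
        show ?thesis using that comm[OF i(1) that(1)] less.prems(2) by (auto simp: W'_def Aj.scale)
      qed
      moreover have "W' \<noteq> {0}" using x by (auto simp: W'_def)
      ultimately show ?thesis using less.hyps[of W'] s by (auto simp: W'_def)
    qed
  qed
qed

section \<open>Compact Lie algebras\<close>

notation csc (infixr "*\<^sub>C" 75)

lemma tau_add: "tau (X + Y) = tau X + tau Y"
  and tau_minus: "tau (- X) = - tau X"
  and tau_diff: "tau (X - Y) = tau X - tau Y"
  and tau_0: "tau 0 = 0"
  and tau_csc: "tau (c *\<^sub>C X) = cnj c *\<^sub>C tau X"
  and tau_tau: "tau (tau X) = X"
  by (simp_all add: tau_def csc_def prod_eq_iff)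

lemmas tau_simps = tau_add tau_minus tau_diff tau_0 tau_csc tau_tau

lemma tau_eq_iff: "tau X = tau Y \<longleftrightarrow> X = Y"
  by (metis tau_tau)

locale compact_lie =
  fixes br :: "'u::real_vector \<Rightarrow> 'u \<Rightarrow> 'u" and ip :: "'u \<Rightarrow> 'u \<Rightarrow> real"
  assumes lie: "lie_bracket br"
    and fin_dim: "\<exists>B::'u set. finite B \<and> span B = UNIV"
    and ip_bilinear: "bilinear ip"
    and ip_sym: "ip x y = ip y x"
    and ip_pos: "x \<noteq> 0 \<Longrightarrow> ip x x > 0"
    and ip_invariant: "ip (br x y) z = - ip y (br x z)"
begin

abbreviation cbracket (infixl "\<odot>" 70) where "X \<odot> Y \<equiv> cbr br X Y"

lemma br_bilinear: "bilinear br" and br_self: "br x x = 0"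
  and br_jacobi: "br x (br y z) + br y (br z x) + br z (br x y) = 0"
  using lie by (auto simp: lie_bracket_def)

lemmas br_simps = bilinear_ladd[OF br_bilinear] bilinear_radd[OF br_bilinear]
  bilinear_lmul[OF br_bilinear] bilinear_rmul[OF br_bilinear]
  bilinear_lneg[OF br_bilinear] bilinear_rneg[OF br_bilinear]
  bilinear_lzero[OF br_bilinear] bilinear_rzero[OF br_bilinear]
  bilinear_lsub[OF br_bilinear] bilinear_rsub[OF br_bilinear]

lemmas ip_simps = bilinear_ladd[OF ip_bilinear] bilinear_radd[OF ip_bilinear]
  bilinear_lmul[OF ip_bilinear] bilinear_rmul[OF ip_bilinear]
  bilinear_lneg[OF ip_bilinear] bilinear_rneg[OF ip_bilinear]
  bilinear_lzero[OF ip_bilinear] bilinear_rzero[OF ip_bilinear]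
  bilinear_lsub[OF ip_bilinear] bilinear_rsub[OF ip_bilinear]

lemma br_skew: "br x y = - br y x"
  using br_self[of "x + y"] br_self[of x] br_self[of y]
  by (simp add: br_simps eq_neg_iff_add_eq_0 add.commute)

lemma cbr_add_left: "(X + Y) \<odot> Z = X \<odot> Z + Y \<odot> Z"
  and cbr_add_right: "Z \<odot> (X + Y) = Z \<odot> X + Z \<odot> Y"
  and cbr_diff_left: "(X - Y) \<odot> Z = X \<odot> Z - Y \<odot> Z"
  and cbr_diff_right: "Z \<odot> (X - Y) = Z \<odot> X - Z \<odot> Y"
  and cbr_minus_left: "(- X) \<odot> Z = - (X \<odot> Z)"
  and cbr_minus_right: "Z \<odot> (- X) = - (Z \<odot> X)"
  and cbr_csc_left: "(c *\<^sub>C X) \<odot> Z = c *\<^sub>C (X \<odot> Z)"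
  and cbr_csc_right: "Z \<odot> (c *\<^sub>C X) = c *\<^sub>C (Z \<odot> X)"
  and cbr_0_left: "0 \<odot> Z = 0"
  and cbr_0_right: "Z \<odot> 0 = 0"
  by (simp_all add: cbr_def csc_def prod_eq_iff br_simps algebra_simps)

lemmas cbr_simps = cbr_add_left cbr_add_right cbr_diff_left cbr_diff_right cbr_minus_left
  cbr_minus_right cbr_csc_left cbr_csc_right cbr_0_left cbr_0_right

lemma cbr_sum_right: "Z \<odot> (\<Sum>i\<in>A. f i) = (\<Sum>i\<in>A. Z \<odot> f i)"
  by (induction A rule: infinite_finite_induct) (simp_all add: cbr_simps)

lemma cbr_skew: "X \<odot> Y = - (Y \<odot> X)"
  using br_skew[of "fst X" "fst Y"] br_skew[of "snd X" "snd Y"]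
    br_skew[of "fst X" "snd Y"] br_skew[of "snd X" "fst Y"]
  by (simp add: cbr_def prod_eq_iff)

lemma br_leibniz: "br x (br y z) = br (br x y) z + br y (br x z)"
  using br_jacobi[of x y z] br_skew[of z "br x y"] br_skew[of z x]
  by (simp add: br_simps algebra_simps eq_neg_iff_add_eq_0)

lemma cbr_leibniz: "X \<odot> (Y \<odot> Z) = (X \<odot> Y) \<odot> Z + Y \<odot> (X \<odot> Z)"
  by (simp add: cbr_def prod_eq_iff br_simps br_leibniz[of "fst X"] br_leibniz[of "snd X"] algebra_simps)

lemma tau_cbr: "tau (X \<odot> Y) = tau X \<odot> tau Y"
  by (simp add: cbr_def tau_def br_simps)

lemma linear_cbr: "Vector_Spaces.linear csc csc (\<lambda>Y. X \<odot> Y)"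
  by unfold_locales (simp_all add: cbr_simps)

text \<open>The Hermitian extension of the inner product, antilinear in the second argument.\<close>

definition hip :: "'u cpx \<Rightarrow> 'u cpx \<Rightarrow> complex" where
  "hip X Y = Complex (ip (fst X) (fst Y) + ip (snd X) (snd Y)) (ip (snd X) (fst Y) - ip (fst X) (snd Y))"

lemma hip_add_left: "hip (X + Y) Z = hip X Z + hip Y Z"
  and hip_add_right: "hip Z (X + Y) = hip Z X + hip Z Y"
  and hip_diff_left: "hip (X - Y) Z = hip X Z - hip Y Z"
  and hip_diff_right: "hip Z (X - Y) = hip Z X - hip Z Y"
  and hip_minus_left: "hip (- X) Z = - hip X Z"
  and hip_minus_right: "hip Z (- X) = - hip Z X"
  and hip_csc_left: "hip (c *\<^sub>C X) Z = c * hip X Z"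
  and hip_csc_right: "hip Z (c *\<^sub>C X) = cnj c * hip Z X"
  and hip_0_left: "hip 0 Z = 0"
  and hip_0_right: "hip Z 0 = 0"
  by (simp_all add: hip_def csc_def complex_eq_iff ip_simps algebra_simps)

lemmas hip_simps = hip_add_left hip_add_right hip_diff_left hip_diff_right hip_minus_left
  hip_minus_right hip_csc_left hip_csc_right hip_0_left hip_0_right

lemma hip_sum_left: "hip (\<Sum>i\<in>A. f i) Z = (\<Sum>i\<in>A. hip (f i) Z)"
  by (induction A rule: infinite_finite_induct) (simp_all add: hip_simps)

text \<open>Invariance of \<open>ip\<close>, complexified; \<open>tau\<close> appears because
  \<open>hip\<close> is antilinear on the right. Real elements thus act skew-adjointly, and elements
  of an abelian \<open>tau\<close>-stable subalgebra act as normal operators.\<close>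

lemma hip_adjoint: "hip (Z \<odot> X) Y = - hip X (tau Z \<odot> Y)"
  by (simp add: hip_def cbr_def tau_def complex_eq_iff ip_simps br_simps ip_invariant)

lemma Re_hip_self_pos:
  assumes "X \<noteq> 0"
  shows "Re (hip X X) > 0"
proof -
  have "ip x x \<ge> 0" for x using ip_pos[of x] by (cases "x = 0") (auto simp: ip_simps)
  then show ?thesis
    using assms ip_pos[of "fst X"] ip_pos[of "snd X"]
    by (auto simp: hip_def prod_eq_iff add_pos_nonneg add_nonneg_pos)
qed

lemma hip_self_eq_0_iff: "hip X X = 0 \<longleftrightarrow> X = 0"
  using Re_hip_self_pos[of X] by (cases "X = 0") (simp_all add: hip_simps complex_eq_iff)

lemma finite_dim_cpx: "\<exists>B::'u cpx set. finite_dimensional_vector_space csc B"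
proof -
  obtain B :: "'u set" where B: "finite B" "span B = UNIV" using fin_dim by blast
  let ?S = "(\<lambda>b. (b, 0)) ` B :: 'u cpx set"
  have 1: "(x, 0) \<in> cx.span ?S" for x
  proof -
    have "x \<in> span B" using B by simp
    then show ?thesis
    proof (induction rule: span_induct_alt)
      case base
      then show ?case using cx.span_zero[of ?S] by (simp add: zero_prod_def)
    next
      case (step c x y)
      have "(c *\<^sub>R x + y, 0) = of_real c *\<^sub>C (x, 0) + (y, 0)" by (simp add: csc_def)
      then show ?case using step by (simp add: cx.span_add cx.span_scale cx.span_base)
    qed
  qed
  have "X \<in> cx.span ?S" for X
  proof -
    have "X = (fst X, 0) + \<i> *\<^sub>C (snd X, 0)" by (simp add: csc_def prod_eq_iff)
    then show ?thesis using 1 by (metis cx.span_add cx.span_scale)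
  qed
  then have S: "cx.span ?S = UNIV" by blast
  obtain B' where B': "B' \<subseteq> ?S" "cx.independent B'" "?S \<subseteq> cx.span B'"
    by (rule cx.maximal_independent_subset[of ?S])
  have "cx.span B' = UNIV"
    using S B'(3) cx.span_mono cx.span_span by (metis top.extremum_uniqueI)
  moreover have "finite B'" using B' B by (meson finite_imageI finite_subset)
  ultimately show ?thesis using B'(2)
    by (intro exI[of _ B'], unfold_locales) auto
qed

end

section \<open>Cartan subalgebras and root spaces\<close>

locale compact_cartan = compact_lie +
  fixes h :: "'a cpx set"
  assumes cartan: "cartan_subalgebra br h" and tau_h: "tau ` h \<subseteq> h"
begin

lemma subspace_h: "cx.subspace h"
  using cartan by (simp add: cartan_subalgebra_def csubalgebra_def)

lemmas h_closed = cx.subspace_add[OF subspace_h] cx.subspace_diff[OF subspace_h]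
  cx.subspace_scale[OF subspace_h] cx.subspace_0[OF subspace_h] cx.subspace_neg[OF subspace_h]

lemma tau_in_h: "H \<in> h \<Longrightarrow> tau H \<in> h"
  using tau_h by blast

lemma in_h_if_normalizes: "(\<And>H. H \<in> h \<Longrightarrow> X \<odot> H \<in> h) \<Longrightarrow> X \<in> h"
  using cartan by (auto simp: cartan_subalgebra_def normalizer_def)

text \<open>For real \<open>H\<close> the operator \<open>ad H\<close> is skew-adjoint, so a vector
  killed by its square is killed by \<open>ad H\<close> itself; powers are removed one at a
  time.\<close>

lemma ad_zero_of_power_zero:
  assumes "tau H = H" "((\<lambda>Y. H \<odot> Y) ^^ n) X = 0"
  shows "H \<odot> X = 0"
  using assms(2)
proof (induction n)
  case (Suc n)
  let ?f = "\<lambda>Y. H \<odot> Y"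
  show ?case
  proof (cases n)
    case (Suc m)
    let ?Y = "(?f ^^ m) X"
    have "hip (H \<odot> ?Y) (H \<odot> ?Y) = - hip ?Y (H \<odot> (H \<odot> ?Y))"
      by (simp add: hip_adjoint assms(1))
    also have "H \<odot> (H \<odot> ?Y) = 0" using Suc.prems Suc by simp
    finally have "(?f ^^ n) X = 0" using Suc by (simp add: hip_simps hip_self_eq_0_iff)
    then show ?thesis using Suc.IH by simp
  qed (use Suc in simp)
qed (simp add: cbr_simps)

text \<open>Nilpotency of \<open>h\<close> makes \<open>ad T\<close> nilpotent on \<open>h\<close>,
  which for real \<open>T\<close> means zero. Stability under \<open>tau\<close> splits
  \<open>H\<close> as \<open>T + \<i> S\<close> with real \<open>T\<close>, \<open>S\<close> in
  \<open>h\<close>.\<close>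

lemma h_abelian:
  assumes "H \<in> h" "K \<in> h"
  shows "H \<odot> K = 0"
proof -
  obtain n where n: "lower_central br h n = {0}"
    using cartan by (auto simp: cartan_subalgebra_def)
  have real: "T \<odot> K = 0" if "T \<in> h" "tau T = T" for T
  proof -
    have "((\<lambda>Y. T \<odot> Y) ^^ m) K \<in> lower_central br h m" for m
      by (induction m) (use assms that in \<open>auto simp: bracket_space_def simp del: split_paired_Ex intro!: cx.span_base\<close>)
    then show ?thesis using n ad_zero_of_power_zero[OF that(2), of n K] by blast
  qed
  define T S where "T = (1/2) *\<^sub>C (H + tau H)" and "S = (-\<i>/2) *\<^sub>C (H - tau H)"
  have "T \<in> h" "S \<in> h" unfolding T_def S_def by (intro h_closed tau_in_h assms)+
  moreover have "tau T = T" "tau S = S"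
    by (simp_all add: T_def S_def tau_simps add.commute cx.scale_right_diff_distrib)
  moreover have "H = T + \<i> *\<^sub>C S"
    by (simp add: T_def S_def csc_def tau_def prod_eq_iff scaleR_right_distrib[symmetric] scaleR_left_distrib[symmetric])
  ultimately show ?thesis using real by (simp add: cbr_simps)
qed

lemma ad_h_commute:
  assumes "H \<in> h" "K \<in> h"
  shows "H \<odot> (K \<odot> X) = K \<odot> (H \<odot> X)"
  by (simp add: cbr_leibniz[of H] h_abelian[OF assms] cbr_simps)

lemma root_spaceD: "X \<in> root_space br h \<alpha> \<Longrightarrow> H \<in> h \<Longrightarrow> H \<odot> X = \<alpha> H *\<^sub>C X"
  by (simp add: root_space_def)

text \<open>On a common eigenvector, \<open>ad H\<close> and its adjoint \<open>- ad (tau H)\<close>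
  have conjugate eigenvalues.\<close>

lemma weight_tau:
  assumes "X \<in> root_space br h \<alpha>" "X \<noteq> 0" "H \<in> h"
  shows "\<alpha> (tau H) = - cnj (\<alpha> H)"
proof -
  have "\<alpha> H * hip X X = hip (H \<odot> X) X"
    using assms by (simp add: root_spaceD hip_simps)
  also have "\<dots> = - (cnj (\<alpha> (tau H)) * hip X X)"
    using assms by (simp add: hip_adjoint root_spaceD[OF _ tau_in_h] hip_simps)
  finally have "(\<alpha> H + cnj (\<alpha> (tau H))) * hip X X = 0" by (simp add: algebra_simps)
  then have "\<alpha> H + cnj (\<alpha> (tau H)) = 0" using assms by (simp add: hip_self_eq_0_iff)
  then show ?thesis by (simp add: complex_eq_iff)
qed

lemma root_dual: "\<alpha> \<in> roots br h \<Longrightarrow> \<alpha> \<in> dual h"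
  by (simp add: roots_def)

lemma dual_simps:
  assumes "\<alpha> \<in> dual h" "H \<in> h"
  shows "K \<in> h \<Longrightarrow> \<alpha> (H + K) = \<alpha> H + \<alpha> K" "K \<in> h \<Longrightarrow> \<alpha> (H - K) = \<alpha> H - \<alpha> K"
    "\<alpha> (c *\<^sub>C H) = c * \<alpha> H" "\<alpha> (- H) = - \<alpha> H"
proof -
  have s: "\<alpha> (c *\<^sub>C H) = c * \<alpha> H" if "H \<in> h" for c H using assms that by (auto simp: dual_def)
  have a: "\<alpha> (H + K) = \<alpha> H + \<alpha> K" if "K \<in> h" for K using assms that by (auto simp: dual_def)
  have m: "\<alpha> (- H) = - \<alpha> H" if "H \<in> h" for H using s[of H "-1"] that by (simp add: cx.scale_minus_left)
  show "\<alpha> (c *\<^sub>C H) = c * \<alpha> H" "\<alpha> (- H) = - \<alpha> H" using s m assms by auto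
  show "K \<in> h \<Longrightarrow> \<alpha> (H + K) = \<alpha> H + \<alpha> K" by (rule a)
  show "K \<in> h \<Longrightarrow> \<alpha> (H - K) = \<alpha> H - \<alpha> K" using a[of "- K"] m[of K] h_closed(5) by simp
qed

lemma dual_outside: "\<alpha> \<in> dual h \<Longrightarrow> H \<notin> h \<Longrightarrow> \<alpha> H = 0"
  unfolding dual_def by blast

lemma dual_sum:
  assumes "\<alpha> \<in> dual h" "\<And>i. i \<in> A \<Longrightarrow> f i \<in> h"
  shows "\<alpha> (\<Sum>i\<in>A. f i) = (\<Sum>i\<in>A. \<alpha> (f i))"
  using assms(2)
proof (induction A rule: infinite_finite_induct)
  case (insert x F)
  then have "(\<Sum>i\<in>F. f i) \<in> h" by (intro cx.subspace_sum[OF subspace_h]) auto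
  then show ?case using insert assms by (simp add: dual_simps)
qed (use dual_simps(3)[OF assms(1) h_closed(4), of 0] in simp_all)

lemma root_tau: "\<alpha> \<in> roots br h \<Longrightarrow> H \<in> h \<Longrightarrow> \<alpha> (tau H) = - cnj (\<alpha> H)"
  using weight_tau[of _ \<alpha> H] cx.subspace_0 by (auto simp: roots_def root_space_def cbr_simps)

lemma tau_root_space:
  assumes "\<alpha> \<in> roots br h" "X \<in> root_space br h \<alpha>"
  shows "tau X \<in> root_space br h (- \<alpha>)"
  unfolding root_space_def
proof (intro CollectI ballI)
  fix H assume H: "H \<in> h"
  have "H \<odot> tau X = tau (tau H \<odot> X)" by (simp add: tau_cbr tau_tau)
  also have "\<dots> = (- \<alpha>) H *\<^sub>C tau X"
    using assms H by (simp add: root_spaceD tau_in_h tau_simps root_tau)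
  finally show "H \<odot> tau X = (- \<alpha>) H *\<^sub>C tau X" .
qed

lemma uminus_dual: "\<alpha> \<in> dual h \<Longrightarrow> - \<alpha> \<in> dual h"
  by (auto simp: dual_def)

lemma add_dual: "\<alpha> \<in> dual h \<Longrightarrow> \<beta> \<in> dual h \<Longrightarrow> \<alpha> + \<beta> \<in> dual h"
  by (auto simp: dual_def algebra_simps)

lemma uminus_root:
  assumes "\<alpha> \<in> roots br h"
  shows "- \<alpha> \<in> roots br h"
proof -
  obtain X where X: "X \<in> root_space br h \<alpha>" "X \<noteq> 0"
    using assms by (auto simp: roots_def root_space_def cbr_simps)
  then have "tau X \<noteq> 0" by (metis tau_tau tau_0)
  then show ?thesis using assms tau_root_space[OF assms X(1)] uminus_dual
    by (auto simp: roots_def)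
qed

lemma subspace_root_space: "cx.subspace (root_space br h \<alpha>)"
  by (auto simp: cx.subspace_def root_space_def cbr_simps cx.scale_right_distrib mult.commute)

lemma cbr_root_space:
  assumes "X \<in> root_space br h \<alpha>" "Y \<in> root_space br h \<beta>"
  shows "X \<odot> Y \<in> root_space br h (\<alpha> + \<beta>)"
  using assms by (auto simp: root_space_def cbr_leibniz[of _ X Y] cbr_simps cx.scale_left_distrib)

text \<open>The weight-zero space centralizes \<open>h\<close>, and a Cartan subalgebra is its own
  normalizer.\<close>

lemma root_space_0: "root_space br h 0 = h"
proof
  show "root_space br h 0 \<subseteq> h"
    by (rule subsetI, rule in_h_if_normalizes, subst cbr_skew)
      (simp add: root_spaceD h_closed)
  show "h \<subseteq> root_space br h 0" by (auto simp: root_space_def h_abelian)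
qed

lemma root_space_zero_or_root:
  assumes "X \<in> root_space br h \<alpha>" "X \<noteq> 0" "\<alpha> \<in> dual h" "\<alpha> \<noteq> 0"
  shows "\<alpha> \<in> roots br h"
  using assms by (auto simp: roots_def)

text \<open>Eigenspaces of normal operators are orthogonal. The case \<open>\<beta> = 0\<close>
  serves to compare root spaces with \<open>h\<close>.\<close>

lemma orthogonal_root_spaces:
  assumes "X \<in> root_space br h \<alpha>" "Y \<in> root_space br h \<beta>" "\<beta> \<in> roots br h \<or> \<beta> = 0"
    "H \<in> h" "\<alpha> H \<noteq> \<beta> H"
  shows "hip X Y = 0"
proof -
  have \<beta>: "cnj (\<beta> (tau H)) = - \<beta> H"
    using assms(3) root_tau[of \<beta> H] assms(4) by auto
  have "\<alpha> H * hip X Y = hip (H \<odot> X) Y" using assms by (simp add: root_spaceD hip_simps)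
  also have "\<dots> = \<beta> H * hip X Y"
    using \<beta> by (simp add: hip_adjoint root_spaceD[OF assms(2) tau_in_h[OF assms(4)]] hip_simps)
  finally show ?thesis using assms(5) by simp
qed

lemma common_eigenvector_weight:
  assumes W: "cx.subspace W" "\<And>H X. H \<in> h \<Longrightarrow> X \<in> W \<Longrightarrow> H \<odot> X \<in> W" "W \<noteq> {0}"
  shows "\<exists>X\<in>W. X \<noteq> 0 \<and> X \<in> h \<union> (\<Union>\<alpha>\<in>roots br h. root_space br h \<alpha>)"
proof -
  obtain B where B: "finite_dimensional_vector_space csc (B::'a cpx set)" using finite_dim_cpx by blast
  obtain X where X: "X \<in> W" "X \<noteq> 0" "\<And>H. H \<in> h \<Longrightarrow> \<exists>c. H \<odot> X = c *\<^sub>C X"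
    using common_eigenvector[OF B linear_cbr ad_h_commute W, of h "\<lambda>H. H"] by auto
  \<comment> \<open>\<open>X\<close> is nonzero, so the eigenvalue is unique and therefore linear in
    \<open>H\<close>; the value 0 off \<open>h\<close> places \<open>\<alpha>\<close> in
    \<open>dual h\<close>.\<close>
  define \<alpha> where "\<alpha> H = (if H \<in> h then SOME c. H \<odot> X = c *\<^sub>C X else 0)" for H
  have \<alpha>: "H \<odot> X = \<alpha> H *\<^sub>C X" if "H \<in> h" for H
    unfolding \<alpha>_def using that someI_ex[OF X(3)[OF that]] by simp
  have inj: "c *\<^sub>C X = d *\<^sub>C X \<Longrightarrow> c = d" for c d using X(2) by simp
  have "\<alpha> \<in> dual h"
    unfolding dual_def
  proof (intro CollectI conjI allI impI ballI)
    show "\<alpha> Y = 0" if "Y \<notin> h" for Y using that by (simp add: \<alpha>_def)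
    show "\<alpha> (H + K) = \<alpha> H + \<alpha> K" if "H \<in> h" "K \<in> h" for H K
      using \<alpha>[OF that(1)] \<alpha>[OF that(2)] \<alpha>[OF h_closed(1)[OF that]]
      by (intro inj) (simp add: cbr_simps cx.scale_left_distrib)
    show "\<alpha> (c *\<^sub>C H) = c * \<alpha> H" if "H \<in> h" for c H
      using \<alpha>[OF that(1)] \<alpha>[OF h_closed(3)[OF that]]
      by (intro inj) (simp only: cbr_simps cx.scale_scale)
  qed
  moreover have "X \<in> root_space br h \<alpha>" by (simp add: root_space_def \<alpha>)
  ultimately have "X \<in> h \<or> (X \<in> root_space br h \<alpha> \<and> \<alpha> \<in> roots br h)"
    using root_space_zero_or_root[of X \<alpha>] X(2) root_space_0 by metis
  then show ?thesis using X by blast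
qed

text \<open>A common eigenvector is split off; its orthogonal complement is again invariant because
  \<open>h\<close> is \<open>tau\<close>-stable and the adjoint of \<open>ad H\<close> is
  \<open>- ad (tau H)\<close>.\<close>

lemma invariant_subset_span:
  assumes "cx.subspace W" "\<And>H X. H \<in> h \<Longrightarrow> X \<in> W \<Longrightarrow> H \<odot> X \<in> W"
  shows "W \<subseteq> cx.span (h \<union> (\<Union>\<alpha>\<in>roots br h. root_space br h \<alpha>))"
proof -
  obtain B where "finite_dimensional_vector_space csc (B::'a cpx set)" using finite_dim_cpx by blast
  then interpret V: finite_dimensional_vector_space csc B .
  let ?S = "h \<union> (\<Union>\<alpha>\<in>roots br h. root_space br h \<alpha>)"
  show ?thesis using assms
  proof (induction "cx.dim W" arbitrary: W rule: less_induct)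
    case less
    show ?case
    proof (cases "W = {0}")
      case True
      then show ?thesis by (simp add: cx.span_zero)
    next
      case False
      then obtain X where X: "X \<in> W" "X \<noteq> 0" "X \<in> ?S"
        using common_eigenvector_weight[OF less.prems] by blast
      define W' where "W' = {Y \<in> W. hip Y X = 0}"
      have s: "cx.subspace W'" using less.prems(1) unfolding W'_def
        by (auto simp: cx.subspace_def hip_simps)
      have "W' \<subset> W" using X hip_self_eq_0_iff[of X] unfolding W'_def by blast
      then have d: "cx.dim W' < cx.dim W"
        using s less.prems(1) V.dim_psubset by (metis cx.span_eq_iff)
      have eig: "\<exists>c. H \<odot> X = c *\<^sub>C X" if "H \<in> h" for H
        using X(3) that by (auto simp: root_space_def h_abelian intro: exI[of _ 0])
      have inv: "H \<odot> Y \<in> W'" if "H \<in> h" "Y \<in> W'" for H Y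
        using that less.prems(2) eig[OF tau_in_h[OF that(1)]]
        by (auto simp: W'_def hip_adjoint hip_simps)
      have W': "W' \<subseteq> cx.span ?S" by (rule less.hyps[OF d s inv])
      show ?thesis
      proof
        fix Y assume Y: "Y \<in> W"
        let ?c = "hip Y X / hip X X"
        have "Y - ?c *\<^sub>C X \<in> W'"
          using Y X less.prems(1)
          by (auto simp: W'_def hip_simps hip_self_eq_0_iff intro!: cx.subspace_diff cx.subspace_scale)
        then have "(Y - ?c *\<^sub>C X) + ?c *\<^sub>C X \<in> cx.span ?S"
          by (intro cx.span_add cx.span_scale cx.span_base[OF X(3)] subsetD[OF W'])
        then show "Y \<in> cx.span ?S" by simp
      qed
    qed
  qed
qed

lemma root_space_decomposition:
  "cx.span (h \<union> (\<Union>\<alpha>\<in>roots br h. root_space br h \<alpha>)) = UNIV"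
  using invariant_subset_span[of UNIV] by auto

text \<open>Moving \<open>X\<close> across \<open>hip\<close> leaves \<open>[tau X, H]\<close>, a
  multiple of \<open>tau X\<close> by \<open>\<alpha> H\<close>. As \<open>hip\<close> is definite,
  the bracket space is at most a line, which makes the coroot unique before root spaces are known to
  be one-dimensional.\<close>

lemma hip_coroot_line:
  assumes "\<alpha> \<in> roots br h" "K \<in> bracket_space br (root_space br h \<alpha>) (root_space br h (- \<alpha>))"
  shows "K \<in> h \<and> (\<exists>k. \<forall>H\<in>h. hip K H = k * cnj (\<alpha> H))"
  using assms(2) unfolding bracket_space_def
proof (induction rule: cx.span_induct_alt)
  case base
  then show ?case by (auto simp: h_closed hip_simps intro: exI[of _ 0])
next
  case (step c x y)
  then obtain X Y k where XY: "x = X \<odot> Y" "X \<in> root_space br h \<alpha>" "Y \<in> root_space br h (- \<alpha>)"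
    and k: "\<And>H. H \<in> h \<Longrightarrow> hip y H = k * cnj (\<alpha> H)" by blast
  have "x \<in> h" using cbr_root_space[OF XY(2,3)] XY(1) root_space_0 by simp
  have "hip x H = - hip Y (tau X) * cnj (\<alpha> H)" if "H \<in> h" for H
  proof -
    have "tau X \<odot> H = - (H \<odot> tau X)" by (rule cbr_skew)
    also have "\<dots> = \<alpha> H *\<^sub>C tau X"
      using tau_root_space[OF assms(1) XY(2)] that by (simp add: root_spaceD)
    finally show ?thesis by (simp add: XY(1) hip_adjoint hip_simps)
  qed
  then have "\<forall>H\<in>h. hip (c *\<^sub>C x + y) H = (c * - hip Y (tau X) + k) * cnj (\<alpha> H)"
    using k by (simp add: hip_simps algebra_simps)
  then show ?case using step \<open>x \<in> h\<close> by (blast intro: h_closed)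
qed

text \<open>The line is spanned by \<open>K = [X, tau X]\<close> for a root vector \<open>X\<close>.
  It is not in the kernel of \<open>\<alpha>\<close>: if \<open>\<alpha> K = 0\<close>, then
  \<open>K\<close> is orthogonal to itself by \<open>hK\<close>, so \<open>K = 0\<close>, and
  \<open>hK\<close> then gives \<open>\<alpha> = 0\<close>.\<close>

lemma coroot_spec:
  assumes "\<alpha> \<in> roots br h"
  shows "coroot br h \<alpha> \<in> bracket_space br (root_space br h \<alpha>) (root_space br h (- \<alpha>)) \<and>
    \<alpha> (coroot br h \<alpha>) = 2"
  unfolding coroot_def
proof (rule theI')
  let ?B = "bracket_space br (root_space br h \<alpha>) (root_space br h (- \<alpha>))"
  have dual: "\<alpha> \<in> dual h" using assms by (rule root_dual)
  have sub: "cx.subspace ?B" by (simp add: bracket_space_def)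
  obtain X where X: "X \<in> root_space br h \<alpha>" "X \<noteq> 0"
    using assms by (auto simp: roots_def root_space_def cbr_simps)
  let ?K = "X \<odot> tau X"
  have K: "?K \<in> ?B" unfolding bracket_space_def
    using X tau_root_space[OF assms X(1)] by (blast intro: cx.span_base)
  then have Kh: "?K \<in> h" using hip_coroot_line[OF assms] by blast
  have hK: "hip ?K H = - cnj (\<alpha> H) * hip (tau X) (tau X)" if "H \<in> h" for H
  proof -
    have "tau X \<odot> H = - (H \<odot> tau X)" by (rule cbr_skew)
    also have "\<dots> = \<alpha> H *\<^sub>C tau X"
      using tau_root_space[OF assms X(1)] that by (simp add: root_spaceD)
    finally show ?thesis by (simp add: hip_adjoint hip_simps)
  qed
  have tX: "hip (tau X) (tau X) \<noteq> 0" using X(2) by (metis hip_self_eq_0_iff tau_tau tau_0)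
  have nz: "\<alpha> ?K \<noteq> 0"
  proof
    assume "\<alpha> ?K = 0"
    then have "?K = 0" using hK[OF Kh] by (simp add: hip_self_eq_0_iff)
    then have "\<alpha> H = 0" for H
      using hK[of H] tX dual_outside[OF dual, of H] by (cases "H \<in> h") (auto simp: hip_simps)
    then have "\<alpha> = 0" by (simp add: fun_eq_iff)
    then show False using assms by (simp add: roots_def)
  qed
  show "\<exists>!H. H \<in> ?B \<and> \<alpha> H = 2"
  proof (rule ex_ex1I)
    have "(2 / \<alpha> ?K) *\<^sub>C ?K \<in> ?B \<and> \<alpha> ((2 / \<alpha> ?K) *\<^sub>C ?K) = 2"
      using K nz Kh dual sub by (simp add: cx.subspace_scale dual_simps)
    then show "\<exists>H. H \<in> ?B \<and> \<alpha> H = 2" by blast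
  next
    fix L M assume L: "L \<in> ?B \<and> \<alpha> L = 2" and M: "M \<in> ?B \<and> \<alpha> M = 2"
    obtain k l where kl: "L \<in> h" "M \<in> h" "\<And>H. H \<in> h \<Longrightarrow> hip L H = k * cnj (\<alpha> H)"
      "\<And>H. H \<in> h \<Longrightarrow> hip M H = l * cnj (\<alpha> H)"
      using L M hip_coroot_line[OF assms] by meson
    have "hip (l *\<^sub>C L - k *\<^sub>C M) (l *\<^sub>C L - k *\<^sub>C M) = 0"
      using kl(3,4)[of "l *\<^sub>C L - k *\<^sub>C M"] kl(1,2) by (simp add: hip_simps(3,7) h_closed)
    then have eq: "l *\<^sub>C L = k *\<^sub>C M" by (simp add: hip_self_eq_0_iff)
    then have "l = k" using dual_simps(3)[OF dual kl(1), of l] dual_simps(3)[OF dual kl(2), of k] L M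
      by simp
    moreover have "k \<noteq> 0"
    proof
      assume "k = 0"
      then have "L = 0" using kl(3)[OF kl(1)] by (simp add: hip_self_eq_0_iff)
      then show False using L dual_simps(3)[OF dual kl(1), of 0] by simp
    qed
    ultimately show "L = M" using eq by simp
  qed
qed

lemma coroot_in_h: "\<alpha> \<in> roots br h \<Longrightarrow> coroot br h \<alpha> \<in> h"
  and root_coroot: "\<alpha> \<in> roots br h \<Longrightarrow> \<alpha> (coroot br h \<alpha>) = 2"
  using coroot_spec[of \<alpha>] hip_coroot_line[of \<alpha> "coroot br h \<alpha>"] by simp_all

end

section \<open>The Weyl-Chevalley basis\<close>

locale weyl_chevalley = compact_cartan +
  fixes P :: "('a cpx \<Rightarrow> complex) set"
    and E :: "('a cpx \<Rightarrow> complex) \<Rightarrow> 'a cpx"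
    and N :: "('a cpx \<Rightarrow> complex) \<Rightarrow> ('a cpx \<Rightarrow> complex) \<Rightarrow> int"
  assumes positive: "positive_system br h P"
    and chevalley: "weyl_chevalley_basis br h E N"
begin

abbreviation "\<Delta> \<equiv> roots br h"
abbreviation "Hc \<equiv> coroot br h"

lemma E_root_space: "\<alpha> \<in> \<Delta> \<Longrightarrow> E \<alpha> \<in> root_space br h \<alpha>"
  and E_bracket: "\<alpha> \<in> \<Delta> \<Longrightarrow> E \<alpha> \<odot> E (- \<alpha>) = Hc \<alpha>"
  and tau_E: "\<alpha> \<in> \<Delta> \<Longrightarrow> tau (E \<alpha>) = - E (- \<alpha>)"
  and tau_coroot: "\<alpha> \<in> \<Delta> \<Longrightarrow> tau (Hc \<alpha>) = - Hc \<alpha>"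
  and E_bracket_N: "\<alpha> \<in> \<Delta> \<Longrightarrow> \<beta> \<in> \<Delta> \<Longrightarrow> \<alpha> + \<beta> \<in> \<Delta> \<Longrightarrow>
    E \<alpha> \<odot> E \<beta> = of_int (N \<alpha> \<beta>) *\<^sub>C E (\<alpha> + \<beta>)"
  and N_uminus: "\<alpha> \<in> \<Delta> \<Longrightarrow> \<beta> \<in> \<Delta> \<Longrightarrow> \<alpha> + \<beta> \<in> \<Delta> \<Longrightarrow> N (- \<alpha>) (- \<beta>) = - N \<alpha> \<beta>"
  using chevalley by (simp_all add: weyl_chevalley_basis_def)

text \<open>The root string contains \<open>n = 0\<close>, hence \<open>p0 \<le> 0\<close> and the
  absolute value is at least 1.\<close>

lemma N_nonzero:
  assumes "\<alpha> \<in> \<Delta>" "\<beta> \<in> \<Delta>" "\<alpha> + \<beta> \<in> \<Delta>"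
  shows "N \<alpha> \<beta> \<noteq> 0"
proof -
  obtain p0 q0 where pq: "{n::int. \<beta> + (\<lambda>H. of_int n * \<alpha> H) \<in> \<Delta>} = {p0..q0}" "\<bar>N \<alpha> \<beta>\<bar> = 1 - p0"
    using chevalley assms unfolding weyl_chevalley_basis_def by blast
  have "\<beta> + (\<lambda>H. of_int 0 * \<alpha> H) = \<beta>" by (simp add: fun_eq_iff)
  then have "0 \<in> {p0..q0}" using assms(2) unfolding pq(1)[symmetric] by simp
  then show ?thesis using pq(2) by auto
qed

lemma H_E: "\<alpha> \<in> \<Delta> \<Longrightarrow> H \<in> h \<Longrightarrow> H \<odot> E \<alpha> = \<alpha> H *\<^sub>C E \<alpha>"
  and E_H: "\<alpha> \<in> \<Delta> \<Longrightarrow> H \<in> h \<Longrightarrow> E \<alpha> \<odot> H = - (\<alpha> H *\<^sub>C E \<alpha>)"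
proof -
  show 1: "\<alpha> \<in> \<Delta> \<Longrightarrow> H \<in> h \<Longrightarrow> H \<odot> E \<alpha> = \<alpha> H *\<^sub>C E \<alpha>"
    by (rule root_spaceD[OF E_root_space])
  show "\<alpha> \<in> \<Delta> \<Longrightarrow> H \<in> h \<Longrightarrow> E \<alpha> \<odot> H = - (\<alpha> H *\<^sub>C E \<alpha>)"
    using 1 cbr_skew[of "E \<alpha>" H] by simp
qed

lemma E_nonzero: "\<alpha> \<in> \<Delta> \<Longrightarrow> E \<alpha> \<noteq> 0"
  using E_bracket[of \<alpha>] root_coroot[of \<alpha>] dual_simps(3)[OF root_dual coroot_in_h, of \<alpha> \<alpha> 0]
  by (auto simp: cbr_simps)

lemma coroot_uminus: "\<alpha> \<in> \<Delta> \<Longrightarrow> Hc (- \<alpha>) = - Hc \<alpha>"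
  using E_bracket[of \<alpha>] E_bracket[OF uminus_root, of \<alpha>] cbr_skew[of "E \<alpha>" "E (- \<alpha>)"]
  by (metis minus_minus)

section \<open>Raising and lowering operators, and criteria for sums of roots\<close>

lemma root_coroot_real: "\<alpha> \<in> \<Delta> \<Longrightarrow> \<beta> \<in> \<Delta> \<Longrightarrow> Im (\<beta> (Hc \<alpha>)) = 0"
  using root_tau[of \<beta> "Hc \<alpha>"] tau_coroot[of \<alpha>] dual_simps(4)[OF root_dual coroot_in_h, of \<beta> \<alpha>]
  by (simp add: complex_eq_iff coroot_in_h)

text \<open>By \<open>tau_E\<close> the adjoint of \<open>ad (E \<alpha>)\<close> is
  \<open>ad (E (- \<alpha>))\<close>. So a nonzero vector killed by the lowering operator cannot
  have positive weight, and if its weight is zero the raised vector vanishes too.\<close>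

lemma hip_raise:
  assumes "\<alpha> \<in> \<Delta>" "E (- \<alpha>) \<odot> Y = 0" "Hc \<alpha> \<odot> Y = w *\<^sub>C Y"
  shows "hip (E \<alpha> \<odot> Y) (E \<alpha> \<odot> Y) = - cnj w * hip Y Y"
proof -
  have "hip (E \<alpha> \<odot> Y) (E \<alpha> \<odot> Y) = hip Y (E (- \<alpha>) \<odot> (E \<alpha> \<odot> Y))"
    using assms(1) by (simp add: hip_adjoint tau_E cbr_simps hip_simps)
  also have "E (- \<alpha>) \<odot> (E \<alpha> \<odot> Y) = (E (- \<alpha>) \<odot> E \<alpha>) \<odot> Y"
    using assms(2) by (simp add: cbr_leibniz[of "E (- \<alpha>)"] cbr_simps)
  also have "E (- \<alpha>) \<odot> E \<alpha> = - Hc \<alpha>"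
    using assms(1) cbr_skew[of "E (- \<alpha>)" "E \<alpha>"] by (simp add: E_bracket)
  finally show ?thesis using assms(3) by (simp add: cbr_simps hip_simps)
qed

text \<open>A vector of weight \<open>\<alpha>\<close> orthogonal to \<open>E \<alpha>\<close> is annihilated by \<open>E (- \<alpha>)\<close>, which is
  impossible for a positive weight in a unitary representation.\<close>

lemma root_space_one_dim:
  assumes "\<alpha> \<in> \<Delta>" "X \<in> root_space br h \<alpha>"
  shows "\<exists>c. X = c *\<^sub>C E \<alpha>"
proof -
  define Y where "Y = X - (hip X (E \<alpha>) / hip (E \<alpha>) (E \<alpha>)) *\<^sub>C E \<alpha>"
  have Y: "Y \<in> root_space br h \<alpha>" unfolding Y_def
    using assms by (intro cx.subspace_diff cx.subspace_scale subspace_root_space E_root_space)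
  have orth: "hip Y (E \<alpha>) = 0"
    using E_nonzero[OF assms(1)] by (simp add: Y_def hip_simps hip_self_eq_0_iff)
  let ?K = "E (- \<alpha>) \<odot> Y"
  have K: "?K \<in> h"
    using cbr_root_space[OF E_root_space[OF uminus_root[OF assms(1)]] Y] root_space_0 by simp
  have "hip ?K ?K = hip Y (E \<alpha> \<odot> ?K)"
    using assms(1) by (simp add: hip_adjoint tau_E uminus_root cbr_simps hip_simps)
  also have "\<dots> = 0" using orth assms(1) K by (simp add: E_H hip_simps)
  finally have "?K = 0" by (simp add: hip_self_eq_0_iff)
  moreover have "Hc \<alpha> \<odot> Y = 2 *\<^sub>C Y"
    using root_spaceD[OF Y coroot_in_h] assms(1) by (simp add: root_coroot)
  ultimately have "hip (E \<alpha> \<odot> Y) (E \<alpha> \<odot> Y) = - 2 * hip Y Y"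
    using hip_raise[OF assms(1), of Y 2] by simp
  then have "Re (hip (E \<alpha> \<odot> Y) (E \<alpha> \<odot> Y)) = - 2 * Re (hip Y Y)" by simp
  moreover have "Re (hip (E \<alpha> \<odot> Y) (E \<alpha> \<odot> Y)) \<ge> 0"
    using Re_hip_self_pos[of "E \<alpha> \<odot> Y"] by (cases "E \<alpha> \<odot> Y = 0") (auto simp: hip_simps)
  ultimately have "Y = 0" using Re_hip_self_pos[of Y] by fastforce
  then show ?thesis by (auto simp: Y_def)
qed

text \<open>\<open>hip_raise\<close> with \<open>- \<alpha>\<close> in place of
  \<open>\<alpha>\<close>. This norm identity stands in for the theory of root strings in the two
  sum criteria below.\<close>

lemma lower_bracket_nonzero:
  assumes "\<alpha> \<in> \<Delta>" "\<beta> \<in> \<Delta>" "E \<alpha> \<odot> E \<beta> = 0"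
  shows "hip (E (- \<alpha>) \<odot> E \<beta>) (E (- \<alpha>) \<odot> E \<beta>) = \<beta> (Hc \<alpha>) * hip (E \<beta>) (E \<beta>)"
proof -
  have "Hc (- \<alpha>) \<odot> E \<beta> = (- \<beta> (Hc \<alpha>)) *\<^sub>C E \<beta>"
    using assms by (simp add: coroot_uminus cbr_simps H_E coroot_in_h cx.scale_minus_left)
  then have "hip (E (- \<alpha>) \<odot> E \<beta>) (E (- \<alpha>) \<odot> E \<beta>) = - cnj (- \<beta> (Hc \<alpha>)) * hip (E \<beta>) (E \<beta>)"
    using assms by (intro hip_raise) (simp_all add: uminus_root)
  also have "cnj (- \<beta> (Hc \<alpha>)) = - \<beta> (Hc \<alpha>)"
    using root_coroot_real[OF assms(1,2)] by (simp add: complex_eq_iff)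
  finally show ?thesis by (simp only: minus_minus)
qed

lemma bracket_root:
  assumes "\<alpha> \<in> \<Delta>" "\<beta> \<in> \<Delta>" "\<alpha> + \<beta> \<noteq> 0" "E \<alpha> \<odot> E \<beta> \<noteq> 0"
  shows "\<alpha> + \<beta> \<in> \<Delta>"
  using root_space_zero_or_root[OF cbr_root_space[OF E_root_space E_root_space]] assms
  by (simp add: add_dual root_dual)

text \<open>If the bracket of the root vectors vanished, \<open>lower_bracket_nonzero\<close> would
  produce a vector of negative square norm.\<close>

lemma root_add:
  assumes "\<alpha> \<in> \<Delta>" "\<beta> \<in> \<Delta>" "\<alpha> + \<beta> \<noteq> 0" "Re (\<beta> (Hc \<alpha>)) < 0"
  shows "\<alpha> + \<beta> \<in> \<Delta>"
proof (rule bracket_root[OF assms(1-3)], rule notI)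
  assume "E \<alpha> \<odot> E \<beta> = 0"
  from lower_bracket_nonzero[OF assms(1,2) this]
  have "Re (hip (E (- \<alpha>) \<odot> E \<beta>) (E (- \<alpha>) \<odot> E \<beta>)) = Re (\<beta> (Hc \<alpha>)) * Re (hip (E \<beta>) (E \<beta>))"
    using root_coroot_real[OF assms(1,2)] by simp
  also have "\<dots> < 0"
    using assms(4) Re_hip_self_pos[OF E_nonzero[OF assms(2)]] by (simp add: mult_neg_pos)
  finally show False
    using Re_hip_self_pos[of "E (- \<alpha>) \<odot> E \<beta>"]
    by (cases "E (- \<alpha>) \<odot> E \<beta> = 0") (auto simp: hip_simps)
qed

text \<open>A string centred at \<open>\<beta>\<close> continues on both sides or on neither: a
  vanishing upper bracket would force a vanishing lower one, against
  \<open>N_nonzero\<close>.\<close>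

lemma root_add_of_orthogonal:
  assumes "\<alpha> \<in> \<Delta>" "\<beta> \<in> \<Delta>" "\<beta> (Hc \<alpha>) = 0" "\<beta> - \<alpha> \<in> \<Delta>"
  shows "\<alpha> + \<beta> \<in> \<Delta>"
proof (rule bracket_root[OF assms(1,2)])
  show "\<alpha> + \<beta> \<noteq> 0"
  proof
    assume "\<alpha> + \<beta> = 0"
    then have "\<beta> = - \<alpha>" by (simp add: add_eq_0_iff)
    then show False using assms(3) root_coroot[OF assms(1)] by simp
  qed
  show "E \<alpha> \<odot> E \<beta> \<noteq> 0"
  proof
    assume "E \<alpha> \<odot> E \<beta> = 0"
    then have "E (- \<alpha>) \<odot> E \<beta> = 0"
      using lower_bracket_nonzero[OF assms(1,2)] assms(3) by (simp add: hip_self_eq_0_iff)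
    moreover have s: "- \<alpha> + \<beta> \<in> \<Delta>" using assms(4) by simp
    ultimately show False
      using E_bracket_N[OF uminus_root[OF assms(1)] assms(2) s] E_nonzero[OF s]
        N_nonzero[OF uminus_root[OF assms(1)] assms(2) s] by simp
  qed
qed

section \<open>Orthogonality of the root decomposition and coordinates\<close>

lemma hip_E_E:
  assumes "\<alpha> \<in> \<Delta>" "\<beta> \<in> \<Delta>" "\<alpha> \<noteq> \<beta>"
  shows "hip (E \<alpha>) (E \<beta>) = 0"
proof -
  obtain H where H: "\<alpha> H \<noteq> \<beta> H" using assms(3) by (auto simp: fun_eq_iff)
  then have "H \<in> h" using dual_outside[OF root_dual] assms by metis
  then show ?thesis using orthogonal_root_spaces E_root_space assms H by blast
qed

lemma hip_h_E:
  assumes "\<alpha> \<in> \<Delta>" "K \<in> h"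
  shows "hip K (E \<alpha>) = 0"
  by (rule orthogonal_root_spaces[of K 0 "E \<alpha>" \<alpha> "Hc \<alpha>"])
    (use assms root_space_0 in \<open>simp_all add: E_root_space coroot_in_h root_coroot\<close>)

lemma span_h_E: "cx.span (h \<union> E ` \<Delta>) = UNIV"
proof -
  have "h \<union> (\<Union>\<alpha>\<in>\<Delta>. root_space br h \<alpha>) \<subseteq> cx.span (h \<union> E ` \<Delta>)"
  proof
    fix X assume X: "X \<in> h \<union> (\<Union>\<alpha>\<in>\<Delta>. root_space br h \<alpha>)"
    then consider "X \<in> h" | \<alpha> c where "\<alpha> \<in> \<Delta>" "X = c *\<^sub>C E \<alpha>" using root_space_one_dim by blast
    then show "X \<in> cx.span (h \<union> E ` \<Delta>)"
      by cases (auto intro: cx.span_base cx.span_scale)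
  qed
  then show ?thesis
    using root_space_decomposition cx.span_mono cx.span_span by (metis top.extremum_uniqueI)
qed

lemma in_h_if_orthogonal:
  assumes "\<And>\<alpha>. \<alpha> \<in> \<Delta> \<Longrightarrow> hip X (E \<alpha>) = 0"
  shows "X \<in> h"
proof -
  have "X \<in> cx.span (h \<union> E ` \<Delta>)" using span_h_E by simp
  then obtain K Z where KZ: "X = K + Z" "K \<in> h" "Z \<in> cx.span (E ` \<Delta>)"
    unfolding cx.span_Un cx.span_eq_iff[THEN iffD2, OF subspace_h] by blast
  have "hip X Z = 0 \<and> hip K Z = 0" using KZ(3)
    by (induction rule: cx.span_induct_alt) (auto simp: hip_simps assms hip_h_E[OF _ KZ(2)] simp del: split_paired_All)
  then have "hip Z Z = 0" using KZ(1) by (auto simp: hip_simps)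
  then show ?thesis using KZ by (simp add: hip_self_eq_0_iff)
qed

text \<open>The vectors \<open>E \<alpha>\<close> are nonzero and mutually orthogonal, hence
  independent.\<close>

lemma finite_roots: "finite \<Delta>"
proof -
  obtain B where "finite_dimensional_vector_space csc (B::'a cpx set)" using finite_dim_cpx by blast
  then interpret V: finite_dimensional_vector_space csc B .
  have inj: "inj_on E \<Delta>"
    using hip_E_E E_nonzero by (metis inj_onI hip_self_eq_0_iff)
  have "cx.independent (E ` \<Delta>)"
  proof
    assume "cx.dependent (E ` \<Delta>)"
    then obtain t u v where t: "finite t" "t \<subseteq> E ` \<Delta>" "(\<Sum>v\<in>t. u v *\<^sub>C v) = 0" "v \<in> t" "u v \<noteq> 0"
      unfolding cx.dependent_explicit by blast
    have "hip w v = (if w = v then hip v v else 0)" if wt: "w \<in> t" for w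
    proof (cases "w = v")
      case False
      obtain \<alpha> \<beta> where "\<alpha> \<in> \<Delta>" "\<beta> \<in> \<Delta>" "w = E \<alpha>" "v = E \<beta>"
        using t(2,4) wt by blast
      then show ?thesis using False hip_E_E[of \<alpha> \<beta>] by auto
    qed simp
    then have "hip (\<Sum>v\<in>t. u v *\<^sub>C v) v = (\<Sum>w\<in>t. if w = v then u v * hip v v else 0)"
      unfolding hip_sum_left by (intro sum.cong) (auto simp: hip_simps)
    then have "u v * hip v v = 0" using t by (simp add: hip_simps)
    then show False using t E_nonzero by (auto simp: hip_self_eq_0_iff)
  qed
  then show ?thesis using V.finiteI_independent inj finite_image_iff by blast
qed

text \<open>The coefficient of \<open>E \<alpha>\<close> in the root decomposition; as that
  decomposition is orthogonal, it can be computed by projection.\<close>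

definition coord :: "('a cpx \<Rightarrow> complex) \<Rightarrow> 'a cpx \<Rightarrow> complex" where
  "coord \<alpha> X = hip X (E \<alpha>) / hip (E \<alpha>) (E \<alpha>)"

lemma coord_add: "coord \<alpha> (X + Y) = coord \<alpha> X + coord \<alpha> Y"
  and coord_diff: "coord \<alpha> (X - Y) = coord \<alpha> X - coord \<alpha> Y"
  and coord_minus: "coord \<alpha> (- X) = - coord \<alpha> X"
  and coord_csc: "coord \<alpha> (c *\<^sub>C X) = c * coord \<alpha> X"
  and coord_sum: "coord \<alpha> (\<Sum>i\<in>A. f i) = (\<Sum>i\<in>A. coord \<alpha> (f i))"
  by (simp_all add: coord_def hip_simps hip_sum_left add_divide_distrib diff_divide_distrib sum_divide_distrib)

lemmas coord_simps = coord_add coord_diff coord_minus coord_csc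

lemma coord_E: "\<alpha> \<in> \<Delta> \<Longrightarrow> \<beta> \<in> \<Delta> \<Longrightarrow> coord \<alpha> (E \<beta>) = (if \<alpha> = \<beta> then 1 else 0)"
  by (auto simp: coord_def hip_E_E hip_self_eq_0_iff E_nonzero)

lemma coord_eq_0_iff: "\<alpha> \<in> \<Delta> \<Longrightarrow> coord \<alpha> X = 0 \<longleftrightarrow> hip X (E \<alpha>) = 0"
  by (simp add: coord_def hip_self_eq_0_iff E_nonzero)

lemma coord_H_bracket:
  assumes "\<alpha> \<in> \<Delta>" "H \<in> h"
  shows "coord \<alpha> (H \<odot> X) = \<alpha> H * coord \<alpha> X"
  using assms by (simp add: coord_def hip_adjoint H_E tau_in_h root_tau hip_simps)

section \<open>Positive roots and the stem\<close>

lemma P_roots: "\<alpha> \<in> P \<Longrightarrow> \<alpha> \<in> \<Delta>" "\<alpha> \<in> P \<Longrightarrow> - \<alpha> \<in> \<Delta>"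
  using positive uminus_root by (auto simp: positive_system_def)

lemma P_uminus: "\<alpha> \<in> P \<Longrightarrow> - \<alpha> \<notin> P"
  using positive P_roots by (auto simp: positive_system_def)

lemma root_cases: "\<alpha> \<in> \<Delta> \<Longrightarrow> \<alpha> \<in> P \<or> - \<alpha> \<in> P"
  using positive by (auto simp: positive_system_def)

lemma P_add: "\<alpha> \<in> P \<Longrightarrow> \<beta> \<in> P \<Longrightarrow> \<alpha> + \<beta> \<in> \<Delta> \<Longrightarrow> \<alpha> + \<beta> \<in> P"
  using positive by (auto simp: positive_system_def)

lemma P_add_nonzero: "\<alpha> \<in> P \<Longrightarrow> \<beta> \<in> P \<Longrightarrow> \<alpha> + \<beta> \<noteq> 0"
  using P_uminus by (metis add_eq_0_iff)

lemma finite_P: "finite P"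
  using finite_roots P_roots(1) by (meson finite_subset subsetI)

text \<open>If the sum is 0, evaluating it at the coroot of the first root \<open>a\<close> shows
  that some other \<open>y\<close> is negative there. Then \<open>a + y\<close> is a positive root,
  and merging the two gives a shorter list with sum 0.\<close>

lemma P_sum_list_nonzero: "xs \<noteq> [] \<Longrightarrow> set xs \<subseteq> P \<Longrightarrow> sum_list xs \<noteq> 0"
proof (induction "length xs" arbitrary: xs rule: less_induct)
  case less
  then obtain a ys where xs: "xs = a # ys" by (cases xs) auto
  have aP: "a \<in> P" using less.prems xs by simp
  show ?case
  proof
    assume "sum_list xs = 0"
    then have s: "sum_list ys = - a" using xs by (simp add: eq_neg_iff_add_eq_0 add.commute)
    have app: "(sum_list zs) H = (\<Sum>z\<leftarrow>zs. z H)" for zs :: "('a cpx \<Rightarrow> complex) list" and H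
      by (induction zs) auto
    have Res: "Re (\<Sum>z\<leftarrow>zs. z H) = (\<Sum>z\<leftarrow>zs. Re (z H))" for zs :: "('a cpx \<Rightarrow> complex) list" and H
      by (induction zs) auto
    have "Re ((sum_list ys) (Hc a)) = - 2"
      using aP by (simp add: s root_coroot P_roots)
    then have "(\<Sum>z\<leftarrow>ys. Re (z (Hc a))) < 0" by (simp add: app Res)
    then obtain y where y: "y \<in> set ys" "Re (y (Hc a)) < 0"
      by (metis (no_types, lifting) sum_list_nonneg imageE list.set_map not_le)
    have yP: "y \<in> P" using y less.prems xs by auto
    have ay: "a + y \<in> P" using aP yP y(2) P_add_nonzero
      by (intro P_add root_add) (auto simp: P_roots)
    let ?zs = "(a + y) # remove1 y ys"
    have "length ys > 0" using y(1) by (cases ys) auto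
    then have "length ?zs < length xs" using y(1) by (simp add: xs length_remove1)
    moreover have "set ?zs \<subseteq> P" using ay less.prems xs set_remove1_subset[of y ys] by auto
    ultimately have "sum_list ?zs \<noteq> 0" using less.hyps by blast
    moreover have "sum_list ys = y + sum_list (remove1 y ys)"
      using sum_list_map_remove1[OF y(1), of "\<lambda>x. x"] by simp
    ultimately have "a + sum_list ys \<noteq> 0" by (simp add: add.assoc)
    then show False by (simp add: s)
  qed
qed

text \<open>The larger root stands first, so well-founded induction descends from the highest roots.
  The closure is taken because a sum of positive roots need not be a root.\<close>

definition above :: "(('a cpx \<Rightarrow> complex) \<times> ('a cpx \<Rightarrow> complex)) set" where
  "above = {(\<nu>, \<alpha>). \<nu> \<in> P \<and> \<alpha> \<in> P \<and> \<nu> - \<alpha> \<in> P}\<^sup>+"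

lemma above_base: "\<nu> \<in> P \<Longrightarrow> \<alpha> \<in> P \<Longrightarrow> \<nu> - \<alpha> \<in> P \<Longrightarrow> (\<nu>, \<alpha>) \<in> above"
  unfolding above_def by (rule r_into_trancl) simp

lemma above_trans: "(\<nu>, \<alpha>) \<in> above \<Longrightarrow> (\<alpha>, \<beta>) \<in> above \<Longrightarrow> (\<nu>, \<beta>) \<in> above"
  unfolding above_def by (rule trancl_trans)

text \<open>A cycle would write 0 as a nonempty sum of positive roots.\<close>

lemma above_irrefl: "(\<alpha>, \<alpha>) \<notin> above"
proof
  have "\<exists>xs. xs \<noteq> [] \<and> set xs \<subseteq> P \<and> \<nu> - \<beta> = sum_list xs" if "(\<nu>, \<beta>) \<in> above" for \<nu> \<beta>
    using that unfolding above_def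
  proof (induction rule: trancl_induct)
    case (base y)
    then show ?case by (intro exI[of _ "[\<nu> - y]"]) auto
  next
    case (step y z)
    then obtain xs where "xs \<noteq> []" "set xs \<subseteq> P" "\<nu> - y = sum_list xs" by blast
    then show ?case using step(2) by (intro exI[of _ "(y - z) # xs"]) (auto simp: algebra_simps)
  qed
  moreover assume "(\<alpha>, \<alpha>) \<in> above"
  ultimately obtain xs where "xs \<noteq> []" "set xs \<subseteq> P" "\<alpha> - \<alpha> = sum_list xs" by blast
  then show False using P_sum_list_nonzero[of xs] by simp
qed

lemma wf_above: "wf above"
  unfolding above_def
proof (rule wf_trancl, rule finite_acyclic_wf)
  show "finite {(\<nu>, \<alpha>). \<nu> \<in> P \<and> \<alpha> \<in> P \<and> \<nu> - \<alpha> \<in> P}"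
    by (rule finite_subset[of _ "P \<times> P"]) (auto simp: finite_P)
  show "acyclic {(\<nu>, \<alpha>). \<nu> \<in> P \<and> \<alpha> \<in> P \<and> \<nu> - \<alpha> \<in> P}"
    using above_irrefl by (simp add: acyclic_def above_def)
qed

end

locale stem = weyl_chevalley +
  fixes \<Gamma> :: "('a cpx \<Rightarrow> complex) set"
  assumes stem: "is_stem P \<Gamma>"
begin

lemma stem_P: "\<gamma> \<in> \<Gamma> \<Longrightarrow> \<gamma> \<in> P"
  and stem_cases: "\<alpha> \<in> P \<Longrightarrow> \<alpha> \<in> \<Gamma> \<or> (\<exists>\<gamma>\<in>\<Gamma>. \<alpha> \<in> Phi_plus P \<gamma>)"
  and stem_not_Phi: "\<gamma> \<in> \<Gamma> \<Longrightarrow> \<delta> \<in> \<Gamma> \<Longrightarrow> \<gamma> \<notin> Phi_plus P \<delta>"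
  and Phi_unique: "\<gamma> \<in> \<Gamma> \<Longrightarrow> \<delta> \<in> \<Gamma> \<Longrightarrow> \<alpha> \<in> Phi_plus P \<gamma> \<Longrightarrow> \<alpha> \<in> Phi_plus P \<delta> \<Longrightarrow> \<gamma> = \<delta>"
proof -
  have s: "\<Gamma> \<subseteq> P" "P = \<Gamma> \<union> (\<Union>\<gamma>\<in>\<Gamma>. Phi_plus P \<gamma>)"
    "\<And>\<gamma>. \<gamma> \<in> \<Gamma> \<Longrightarrow> \<Gamma> \<inter> Phi_plus P \<gamma> = {}"
    "\<And>\<gamma> \<delta>. \<gamma> \<in> \<Gamma> \<Longrightarrow> \<delta> \<in> \<Gamma> \<Longrightarrow> \<gamma> \<noteq> \<delta> \<Longrightarrow> Phi_plus P \<gamma> \<inter> Phi_plus P \<delta> = {}"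
    using stem by (simp_all add: is_stem_def)
  show "\<gamma> \<in> \<Gamma> \<Longrightarrow> \<gamma> \<in> P" using s(1) by blast
  show "\<alpha> \<in> P \<Longrightarrow> \<alpha> \<in> \<Gamma> \<or> (\<exists>\<gamma>\<in>\<Gamma>. \<alpha> \<in> Phi_plus P \<gamma>)" using s(2) by blast
  show "\<gamma> \<in> \<Gamma> \<Longrightarrow> \<delta> \<in> \<Gamma> \<Longrightarrow> \<gamma> \<notin> Phi_plus P \<delta>" using s(3) by blast
  show "\<gamma> \<in> \<Gamma> \<Longrightarrow> \<delta> \<in> \<Gamma> \<Longrightarrow> \<alpha> \<in> Phi_plus P \<gamma> \<Longrightarrow> \<alpha> \<in> Phi_plus P \<delta> \<Longrightarrow> \<gamma> = \<delta>"
    using s(4) by blast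
qed

lemma Phi_iff: "\<alpha> \<in> Phi_plus P \<gamma> \<longleftrightarrow> \<alpha> \<in> P \<and> \<gamma> - \<alpha> \<in> P"
  by (simp add: Phi_plus_def)

lemma Phi_above: "\<gamma> \<in> \<Gamma> \<Longrightarrow> \<alpha> \<in> Phi_plus P \<gamma> \<Longrightarrow> (\<gamma>, \<alpha>) \<in> above"
  using stem_P by (simp add: Phi_iff above_base)

text \<open>A stem element is reached by successively removing highest roots: the positive roots not
  orthogonal to it are itself, \<open>Phi_plus\<close>, and roots removed at an earlier stage.\<close>

lemma stem_descent:
  assumes "\<gamma> \<in> \<Gamma>"
  shows "(\<forall>\<alpha>\<in>P. \<alpha> (Hc \<gamma>) \<noteq> 0 \<longrightarrow>
      \<alpha> = \<gamma> \<or> (\<exists>\<delta>\<in>\<Gamma>. (\<delta> = \<gamma> \<or> (\<delta>, \<gamma>) \<in> above) \<and> \<alpha> \<in> Phi_plus P \<delta>)) \<and>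
    (\<forall>\<alpha>\<in>Phi_plus P \<gamma>. \<alpha> (Hc \<gamma>) \<noteq> 0)"
  using assms
proof (induction \<gamma> rule: wf_induct_rule[OF wf_above])
  case (1 \<gamma>)
  note G = \<open>\<gamma> \<in> \<Gamma>\<close>
  have gP: "\<gamma> \<in> P" using G by (rule stem_P)
  have gR: "\<gamma> \<in> \<Delta>" using gP by (rule P_roots)
  have IH1: "\<alpha> = \<zeta> \<or> (\<exists>\<delta>\<in>\<Gamma>. (\<delta> = \<zeta> \<or> (\<delta>, \<zeta>) \<in> above) \<and> \<alpha> \<in> Phi_plus P \<delta>)"
    if "\<zeta> \<in> \<Gamma>" "(\<zeta>, \<gamma>) \<in> above" "\<alpha> \<in> P" "\<alpha> (Hc \<zeta>) \<noteq> 0" for \<zeta> \<alpha>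
    using "1.IH" that by blast
  have IH2: "\<alpha> (Hc \<zeta>) \<noteq> 0" if "\<zeta> \<in> \<Gamma>" "(\<zeta>, \<gamma>) \<in> above" "\<alpha> \<in> Phi_plus P \<zeta>" for \<zeta> \<alpha>
    using "1.IH" that by blast
  \<comment> \<open>Otherwise the induction hypothesis would give \<open>\<gamma> = \<zeta>\<close>,
    against irreflexivity, or place the stem element \<open>\<gamma>\<close> in some
    \<open>Phi_plus\<close>.\<close>
  have orth: "\<gamma> (Hc \<zeta>) = 0" if "\<zeta> \<in> \<Gamma>" "(\<zeta>, \<gamma>) \<in> above" for \<zeta>
    using IH1[OF that gP] stem_not_Phi[OF G] above_irrefl that by blast
  text \<open>A sum \<open>\<alpha> + \<gamma>\<close> is removed before \<open>\<gamma>\<close>, hence so is \<open>\<alpha>\<close>.\<close>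
  have sum_case: "\<exists>\<delta>\<in>\<Gamma>. (\<delta>, \<gamma>) \<in> above \<and> \<alpha> \<in> Phi_plus P \<delta>"
    if a: "\<alpha> \<in> P" "\<gamma> + \<alpha> \<in> P" for \<alpha>
  proof -
    have "\<gamma> \<in> Phi_plus P (\<gamma> + \<alpha>)" using gP that by (simp add: Phi_iff)
    then have "\<gamma> + \<alpha> \<notin> \<Gamma>" using stem_not_Phi G by blast
    then obtain \<zeta> where z: "\<zeta> \<in> \<Gamma>" "\<gamma> + \<alpha> \<in> Phi_plus P \<zeta>" using stem_cases a by blast
    have "(\<gamma> + \<alpha>, \<gamma>) \<in> above" using that gP by (intro above_base) auto
    then have zg: "(\<zeta>, \<gamma>) \<in> above" using Phi_above[OF z] above_trans by blast
    \<comment> \<open>\<open>\<gamma>\<close> is orthogonal to \<open>\<zeta>\<close> but the sum is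
      not, so \<open>\<alpha>\<close> is not, and the induction hypothesis at \<open>\<zeta>\<close>
      locates \<open>\<alpha>\<close>.\<close>
    have "\<alpha> (Hc \<zeta>) \<noteq> 0" using IH2[OF z(1) zg z(2)] orth[OF z(1) zg] by simp
    then consider "\<alpha> = \<zeta>" | \<delta> where "\<delta> \<in> \<Gamma>" "\<delta> = \<zeta> \<or> (\<delta>, \<zeta>) \<in> above" "\<alpha> \<in> Phi_plus P \<delta>"
      using IH1[OF z(1) zg a(1)] by blast
    then show ?thesis
    proof cases
      case 1
      \<comment> \<open>Here \<open>\<zeta> - (\<gamma> + \<alpha>)\<close> equals
        \<open>- \<gamma>\<close>.\<close>
      then have "- \<gamma> \<in> P" using z(2) by (simp add: Phi_iff)
      then show ?thesis using P_uminus gP by blast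
    next
      case 2
      then show ?thesis using zg above_trans by blast
    qed
  qed
  show ?case
  proof (intro conjI ballI impI)
    fix \<alpha> assume a: "\<alpha> \<in> P" "\<alpha> (Hc \<gamma>) \<noteq> 0"
    then have aR: "\<alpha> \<in> \<Delta>" by (simp add: P_roots)
    have "Im (\<alpha> (Hc \<gamma>)) = 0" using root_coroot_real gR aR by blast
    then have "Re (\<alpha> (Hc \<gamma>)) < 0 \<or> Re (\<alpha> (Hc \<gamma>)) > 0" using a(2) by (auto simp: complex_eq_iff)
    then show "\<alpha> = \<gamma> \<or> (\<exists>\<delta>\<in>\<Gamma>. (\<delta> = \<gamma> \<or> (\<delta>, \<gamma>) \<in> above) \<and> \<alpha> \<in> Phi_plus P \<delta>)"
    proof
      assume "Re (\<alpha> (Hc \<gamma>)) < 0"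
      then have "\<gamma> + \<alpha> \<in> P" using a gP P_add_nonzero
        by (intro P_add root_add) (auto simp: P_roots)
      then show ?thesis using sum_case a(1) by blast
    next
      assume pos: "Re (\<alpha> (Hc \<gamma>)) > 0"
      show ?thesis
      proof (cases "\<alpha> = \<gamma>")
        case False
        \<comment> \<open>\<open>root_add\<close> for \<open>- \<gamma>\<close>, whose coroot has
          the opposite sign. If \<open>\<alpha> - \<gamma>\<close> is positive,
          \<open>\<alpha>\<close> was removed earlier; if \<open>\<gamma> - \<alpha>\<close> is,
          \<open>\<alpha>\<close> belongs to \<open>Phi_plus P \<gamma>\<close>.\<close>
        have "- \<gamma> + \<alpha> \<in> \<Delta>"
          by (rule root_add) (use pos False gR aR in \<open>simp_all add: uminus_root coroot_uminus
            dual_simps(4)[OF root_dual coroot_in_h]\<close>)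
        then have "\<alpha> - \<gamma> \<in> \<Delta>" by simp
        then consider "\<alpha> - \<gamma> \<in> P" | "\<gamma> - \<alpha> \<in> P" using root_cases by fastforce
        then show ?thesis
        proof cases
          case 1
          then have g: "\<gamma> \<in> Phi_plus P \<alpha>" using gP by (simp add: Phi_iff)
          then have "\<alpha> \<notin> \<Gamma>" using stem_not_Phi G by blast
          then obtain \<zeta> where z: "\<zeta> \<in> \<Gamma>" "\<alpha> \<in> Phi_plus P \<zeta>" using stem_cases a by blast
          moreover have "(\<alpha>, \<gamma>) \<in> above" using 1 a gP by (simp add: above_base)
          ultimately show ?thesis using Phi_above above_trans by blast
        next
          case 2
          then show ?thesis using a G by (auto simp: Phi_iff)
        qed
      qed simp
    qed
  next
    fix \<alpha> assume a: "\<alpha> \<in> Phi_plus P \<gamma>"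
    then have aP: "\<alpha> \<in> P" "\<gamma> - \<alpha> \<in> P" by (simp_all add: Phi_iff)
    show "\<alpha> (Hc \<gamma>) \<noteq> 0"
    proof
      \<comment> \<open>Orthogonality would make \<open>\<gamma> + \<alpha>\<close> a root as well,
        and \<open>\<alpha>\<close> would lie in the \<open>Phi_plus\<close> of an earlier stem
        element too, against disjointness.\<close>
      assume "\<alpha> (Hc \<gamma>) = 0"
      moreover have "\<alpha> - \<gamma> \<in> \<Delta>" using P_roots(2)[OF aP(2)] by simp
      ultimately have "\<gamma> + \<alpha> \<in> P"
        using aP gP by (intro P_add root_add_of_orthogonal) (auto simp: P_roots)
      then obtain \<delta> where "\<delta> \<in> \<Gamma>" "(\<delta>, \<gamma>) \<in> above" "\<alpha> \<in> Phi_plus P \<delta>"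
        using sum_case aP(1) by blast
      then show False using Phi_unique[OF G _ a] above_irrefl by blast
    qed
  qed
qed

lemma Phi_coroot_nonzero: "\<gamma> \<in> \<Gamma> \<Longrightarrow> \<alpha> \<in> Phi_plus P \<gamma> \<Longrightarrow> \<alpha> (Hc \<gamma>) \<noteq> 0"
  using stem_descent[of \<gamma>] by blast

end

declare split_paired_All [simp del] split_paired_Ex [simp del]

section \<open>Complex structures\<close>

lemma cext_simps:
  assumes "complex_structure J"
  shows "cext J (X + Y) = cext J X + cext J Y" "cext J (X - Y) = cext J X - cext J Y"
    "cext J (- X) = - cext J X" "cext J (c *\<^sub>C X) = c *\<^sub>C cext J X" "cext J 0 = 0"
    "cext J (cext J X) = - X" "cext J (tau X) = tau (cext J X)"
proof -
  have "linear J" and [simp]: "J (J x) = - x" for x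
    using assms by (auto simp: complex_structure_def)
  then interpret J: linear J by simp
  show "cext J (X + Y) = cext J X + cext J Y" "cext J (X - Y) = cext J X - cext J Y"
    "cext J (- X) = - cext J X" "cext J (c *\<^sub>C X) = c *\<^sub>C cext J X" "cext J 0 = 0"
    "cext J (cext J X) = - X" "cext J (tau X) = tau (cext J X)"
    by (simp_all add: cext_def csc_def tau_def prod_eq_iff J.add J.diff J.neg J.scale J.zero)
qed

lemma cext_eq_iff: "cext J = cext K \<longleftrightarrow> J = K"
  by (metis (no_types, lifting) cext_def ext fst_conv)

locale b_structure = stem +
  fixes I :: "'a \<Rightarrow> 'a"
  assumes b_structure: "b_complex_structure br h P I"
begin

abbreviation "I' \<equiv> cext I"

lemma integrable_I: "integrable_structure br I"
  and normalizer_I: "normalizer br (m_plus I) = b_plus br h P"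
  and complex_I: "complex_structure I"
  using b_structure by (auto simp: b_complex_structure_def integrable_structure_def)

lemmas I_simps = cext_simps[OF complex_I]

definition mp :: "'a cpx set" where "mp = {X. I' X = \<i> *\<^sub>C X}"
definition mm :: "'a cpx set" where "mm = {X. I' X = (- \<i>) *\<^sub>C X}"
definition pp :: "'a cpx \<Rightarrow> 'a cpx" where "pp X = (1/2) *\<^sub>C (X - \<i> *\<^sub>C I' X)"
definition pm :: "'a cpx \<Rightarrow> 'a cpx" where "pm X = (1/2) *\<^sub>C (X + \<i> *\<^sub>C I' X)"

lemma subspace_mp: "cx.subspace mp" and subspace_mm: "cx.subspace mm"
  by (auto simp: cx.subspace_def mp_def mm_def I_simps cx.scale_right_distrib mult.commute)

lemmas mp_closed = cx.subspace_add[OF subspace_mp] cx.subspace_diff[OF subspace_mp]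
  cx.subspace_scale[OF subspace_mp] cx.subspace_0[OF subspace_mp] cx.subspace_neg[OF subspace_mp]
lemmas mm_closed = cx.subspace_add[OF subspace_mm] cx.subspace_diff[OF subspace_mm]
  cx.subspace_scale[OF subspace_mm] cx.subspace_0[OF subspace_mm] cx.subspace_neg[OF subspace_mm]

lemma tau_mm: "tau X \<in> mm \<longleftrightarrow> X \<in> mp"
proof -
  have "tau X \<in> mm \<longleftrightarrow> tau (I' X) = tau (\<i> *\<^sub>C X)" by (simp add: mm_def I_simps tau_simps)
  then show ?thesis by (simp add: tau_eq_iff mp_def)
qed

lemma tau_mp: "tau X \<in> mp \<longleftrightarrow> X \<in> mm"
  using tau_mm[of "tau X"] by (simp add: tau_tau)

lemma half_simps: "(1/2 :: complex) *\<^sub>C (X + X) = X"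
  by (simp add: csc_def prod_eq_iff flip: scaleR_add_left)

lemma pp_pm: "pp X + pm X = X"
  by (simp add: pp_def pm_def flip: cx.scale_right_distrib)
     (simp add: half_simps)

lemma pp_in: "pp X \<in> mp"
  by (simp add: mp_def pp_def I_simps cx.scale_right_diff_distrib cx.scale_minus_left algebra_simps)

lemma pm_in: "pm X \<in> mm"
  by (simp add: mm_def pm_def I_simps cx.scale_right_distrib cx.scale_minus_left algebra_simps)

lemma pp_mp: "X \<in> mp \<Longrightarrow> pp X = X" and pm_mp: "X \<in> mp \<Longrightarrow> pm X = 0"
  and pm_mm: "X \<in> mm \<Longrightarrow> pm X = X" and pp_mm: "X \<in> mm \<Longrightarrow> pp X = 0"
  by (simp_all add: pp_def pm_def mp_def mm_def cx.scale_minus_left half_simps)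

lemma mp_mm: "X \<in> mp \<Longrightarrow> X \<in> mm \<Longrightarrow> X = 0"
  using pp_mp pp_mm by metis

lemma pp_add: "pp (X + Y) = pp X + pp Y" and pm_add: "pm (X + Y) = pm X + pm Y"
  and pp_diff: "pp (X - Y) = pp X - pp Y" and pm_diff: "pm (X - Y) = pm X - pm Y"
  and pp_minus: "pp (- X) = - pp X" and pm_minus: "pm (- X) = - pm X"
  and pp_csc: "pp (c *\<^sub>C X) = c *\<^sub>C pp X" and pm_csc: "pm (c *\<^sub>C X) = c *\<^sub>C pm X"
  and pp_0: "pp 0 = 0" and pm_0: "pm 0 = 0"
  by (simp_all add: pp_def pm_def I_simps cx.scale_right_distrib cx.scale_right_diff_distrib
      cx.scale_minus_left mult.commute algebra_simps)

lemmas pi_simps = pp_add pm_add pp_diff pm_diff pp_minus pm_minus pp_csc pm_csc pp_0 pm_0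

lemma pm_sum: "pm (\<Sum>i\<in>A. f i) = (\<Sum>i\<in>A. pm (f i))"
  by (induction A rule: infinite_finite_induct) (simp_all add: pi_simps)

lemma tau_pp: "tau (pp X) = pm (tau X)" and tau_pm: "tau (pm X) = pp (tau X)"
  by (simp_all add: pp_def pm_def tau_simps I_simps cx.scale_minus_left)

lemma mp_bracket: "X \<in> mp \<Longrightarrow> Y \<in> mp \<Longrightarrow> X \<odot> Y \<in> mp"
  using integrable_I by (simp add: integrable_structure_def csubalgebra_def m_plus_def mp_def)

lemma mm_bracket: "X \<in> mm \<Longrightarrow> Y \<in> mm \<Longrightarrow> X \<odot> Y \<in> mm"
  using mp_bracket[of "tau X" "tau Y"] by (simp add: tau_mp flip: tau_cbr)

section \<open>Position of \<open>h\<close> and of the root vectors relative to the eigenspaces of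
  \<open>I\<close>\<close>

lemma h_mp: "H \<in> h \<Longrightarrow> X \<in> mp \<Longrightarrow> H \<odot> X \<in> mp"
proof -
  assume H: "H \<in> h" "X \<in> mp"
  have "0 \<in> n_plus br h P" by (simp add: n_plus_def cx.span_zero)
  then have "H \<in> b_plus br h P" using H unfolding b_plus_def
    by (intro CollectI exI[of _ H] exI[of _ 0]) simp
  then show ?thesis using H by (simp add: normalizer_def m_plus_def mp_def flip: normalizer_I)
qed

lemma h_mm: "H \<in> h \<Longrightarrow> X \<in> mm \<Longrightarrow> H \<odot> X \<in> mm"
  using h_mp[OF tau_in_h, of H "tau X"] by (simp add: tau_mp flip: tau_cbr)

text \<open>\<open>h\<close> lies in the normalizer \<open>b_plus\<close> of \<open>mp\<close> and,
  by conjugation, also normalizes \<open>mm\<close>.\<close>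

lemma pp_h_bracket: "H \<in> h \<Longrightarrow> pp (H \<odot> X) = H \<odot> pp X"
proof -
  assume H: "H \<in> h"
  have "H \<odot> X = H \<odot> pp X + H \<odot> pm X" by (simp add: pp_pm flip: cbr_add_right)
  then show ?thesis using H by (simp add: pi_simps pp_mp pp_mm h_mp h_mm pp_in pm_in)
qed

text \<open>\<open>pp\<close> commutes with the action of \<open>h\<close>, so \<open>pp H\<close>
  centralizes \<open>h\<close>, which is its own normalizer.\<close>

lemma pp_in_h: "H \<in> h \<Longrightarrow> pp H \<in> h"
proof (rule in_h_if_normalizes)
  fix K assume "H \<in> h" "K \<in> h"
  then have "K \<odot> pp H = 0" by (simp add: h_abelian pi_simps flip: pp_h_bracket)
  then show "pp H \<odot> K \<in> h" using cbr_skew[of "pp H" K] h_closed by simp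
qed

lemma pm_in_h: "H \<in> h \<Longrightarrow> pm H \<in> h"
  using pp_in_h h_closed(2) pp_pm by (metis add_diff_cancel_left')

lemma b_plus_orthogonal:
  assumes "X \<in> b_plus br h P" "\<nu> \<in> P"
  shows "hip X (E (- \<nu>)) = 0"
proof -
  obtain H n where X: "X = H + n" "H \<in> h" "n \<in> n_plus br h P"
    using assms(1) unfolding b_plus_def by blast
  have "hip n (E (- \<nu>)) = 0" using X(3) unfolding n_plus_def
  proof (induction rule: cx.span_induct_alt)
    case (step c x y)
    then obtain \<alpha> where \<alpha>: "\<alpha> \<in> P" "x \<in> root_space br h \<alpha>" by blast
    then obtain k where "x = k *\<^sub>C E \<alpha>" using root_space_one_dim P_roots by blast
    moreover have "hip (E \<alpha>) (E (- \<nu>)) = 0"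
      using hip_E_E[of \<alpha> "- \<nu>"] \<alpha>(1) assms(2) P_roots P_uminus by blast
    ultimately show ?case using step by (simp add: hip_simps fun_Compl_def)
  qed (simp add: hip_simps)
  then show ?thesis using X assms(2) by (simp add: hip_simps hip_h_E P_roots)
qed

text \<open>A subalgebra normalizes itself, so \<open>mp\<close> lies in \<open>b_plus\<close>,
  where negative roots do not occur.\<close>

lemma coord_mp:
  assumes "X \<in> mp" "\<nu> \<in> P"
  shows "coord (- \<nu>) X = 0"
proof -
  have "X \<in> b_plus br h P"
    using assms(1) mp_bracket by (auto simp: normalizer_def m_plus_def mp_def simp flip: normalizer_I)
  then show ?thesis using b_plus_orthogonal assms(2) by (simp add: coord_def)
qed

lemma hip_tau: "hip (tau X) (tau Y) = cnj (hip X Y)"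
  by (simp add: hip_def tau_def complex_eq_iff ip_simps)

lemma coord_mm:
  assumes "X \<in> mm" "\<nu> \<in> P"
  shows "coord \<nu> X = 0"
proof -
  have "coord (- \<nu>) (tau X) = 0" using assms by (intro coord_mp) (simp_all add: tau_mp)
  then have "hip (tau X) (E (- \<nu>)) = 0" using assms by (simp add: coord_eq_0_iff P_roots)
  moreover have "E (- \<nu>) = - tau (E \<nu>)" using assms by (simp add: tau_E P_roots)
  ultimately have "hip X (E \<nu>) = 0" by (simp add: hip_simps hip_tau)
  then show ?thesis by (simp add: coord_def)
qed

text \<open>\<open>pp\<close> preserves the one-dimensional root space, so
  \<open>pp (E \<alpha>)\<close> is a multiple of \<open>E \<alpha>\<close>. Were it zero,
  \<open>E \<alpha>\<close> would lie in \<open>mm\<close> and \<open>E (- \<alpha>)\<close> in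
  \<open>mp\<close>, against \<open>coord_mp\<close>.\<close>

lemma E_mp:
  assumes "\<alpha> \<in> P"
  shows "E \<alpha> \<in> mp"
proof -
  have R: "\<alpha> \<in> \<Delta>" "- \<alpha> \<in> \<Delta>" using assms P_roots by auto
  have "pp (E \<alpha>) \<in> root_space br h \<alpha>"
    using R by (auto simp: root_space_def H_E pi_simps simp flip: pp_h_bracket)
  then obtain c where c: "pp (E \<alpha>) = c *\<^sub>C E \<alpha>" using root_space_one_dim R by blast
  show ?thesis
  proof (cases "c = 0")
    case True
    then have "pm (E \<alpha>) = E \<alpha>" using pp_pm[of "E \<alpha>"] c by simp
    then have "tau (E \<alpha>) \<in> mp" using pm_in by (metis tau_mp)
    then have "- tau (E \<alpha>) \<in> mp" by (rule mp_closed(5))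
    then have "coord (- \<alpha>) (E (- \<alpha>)) = 0" using assms R by (intro coord_mp) (simp_all add: tau_E)
    then show ?thesis using coord_E R by simp
  next
    case False
    then have "E \<alpha> = (1 / c) *\<^sub>C pp (E \<alpha>)" by (simp add: c)
    then show ?thesis using mp_closed(3)[OF pp_in] by metis
  qed
qed

lemma E_uminus: "\<alpha> \<in> P \<Longrightarrow> E (- \<alpha>) = - tau (E \<alpha>)"
  by (simp add: tau_E P_roots)

lemma E_mm: "\<alpha> \<in> P \<Longrightarrow> E (- \<alpha>) \<in> mm"
  by (simp add: E_uminus mm_closed(5) tau_mm E_mp)

text \<open>The bracket has weight \<open>\<alpha> - \<nu>\<close>, so it is zero or a multiple of a
  positive root vector, which lies in \<open>mp\<close>. Hence in a coboundary evaluated at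
  \<open>E \<alpha>\<close> only \<open>\<nu> = \<alpha>\<close> and the \<open>\<nu>\<close>
  exceeding \<open>\<alpha>\<close> by a positive root contribute.\<close>

lemma pm_bracket_zero:
  assumes "\<alpha> \<in> P" "\<nu> \<in> P" "\<alpha> \<noteq> \<nu>" "\<nu> - \<alpha> \<notin> P"
  shows "pm (E \<alpha> \<odot> E (- \<nu>)) = 0"
proof (cases "\<alpha> - \<nu> \<in> \<Delta>")
  case True
  then have p: "\<alpha> - \<nu> \<in> P" using root_cases[OF True] assms(4) by simp
  have "E \<alpha> \<odot> E (- \<nu>) \<in> root_space br h (\<alpha> - \<nu>)"
    using cbr_root_space[OF E_root_space E_root_space, of \<alpha> "- \<nu>"] assms P_roots by simp
  then obtain c where "E \<alpha> \<odot> E (- \<nu>) = c *\<^sub>C E (\<alpha> - \<nu>)"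
    using root_space_one_dim True by blast
  then show ?thesis using E_mp[OF p] by (simp add: pi_simps pm_mp)
next
  case False
  then have "E \<alpha> \<odot> E (- \<nu>) = 0"
    using bracket_root[of \<alpha> "- \<nu>"] assms P_roots by auto
  then show ?thesis by (simp add: pi_simps)
qed

lemma tau_pp_coroot: "\<alpha> \<in> \<Delta> \<Longrightarrow> tau (pp (Hc \<alpha>)) = - pm (Hc \<alpha>)"
  and tau_pm_coroot: "\<alpha> \<in> \<Delta> \<Longrightarrow> tau (pm (Hc \<alpha>)) = - pp (Hc \<alpha>)"
  by (simp_all add: tau_pp tau_pm tau_coroot pi_simps)

lemma root_pm_coroot:
  assumes "\<alpha> \<in> \<Delta>" "\<beta> \<in> \<Delta>"
  shows "\<beta> (pm (Hc \<alpha>)) = cnj (\<beta> (pp (Hc \<alpha>)))"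
  using root_tau[OF assms(2) pp_in_h[OF coroot_in_h[OF assms(1)]]] assms(1)
    dual_simps(4)[OF root_dual[OF assms(2)] pm_in_h[OF coroot_in_h[OF assms(1)]]]
  by (simp add: tau_pp_coroot)

text \<open>The two projections of the coroot contribute conjugate values. Only the real part is
  fixed in this way; on the stem, \<open>J_stem\<close> later excludes an imaginary part.\<close>

lemma Re_root_pp_coroot:
  assumes "\<alpha> \<in> \<Delta>" "\<beta> \<in> \<Delta>"
  shows "2 * Re (\<beta> (pp (Hc \<alpha>))) = Re (\<beta> (Hc \<alpha>))"
proof -
  have "\<beta> (Hc \<alpha>) = \<beta> (pp (Hc \<alpha>)) + \<beta> (pm (Hc \<alpha>))"
    using dual_simps(1)[OF root_dual[OF assms(2)] pp_in_h[OF coroot_in_h[OF assms(1)]]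
      pm_in_h[OF coroot_in_h[OF assms(1)]]] by (simp add: pp_pm)
  then show ?thesis using root_pm_coroot[OF assms] by simp
qed

text \<open>The map \<open>\<lambda>X. pm (X \<odot> F)\<close> is a coboundary of \<open>mp\<close> with values in
  the quotient of the whole algebra by \<open>mp\<close>.\<close>

lemma coboundary_cocycle:
  assumes "X \<in> mp" "Y \<in> mp"
  shows "pm (X \<odot> F) \<odot> Y + X \<odot> pm (Y \<odot> F) - pm ((X \<odot> Y) \<odot> F) \<in> mp"
proof -
  have pm: "pm Z = Z - pp Z" for Z using pp_pm[of Z] by (simp add: algebra_simps)
  have "pm (X \<odot> F) \<odot> Y + X \<odot> pm (Y \<odot> F) - pm ((X \<odot> Y) \<odot> F) =
      pp ((X \<odot> Y) \<odot> F) - pp (X \<odot> F) \<odot> Y - X \<odot> pp (Y \<odot> F)"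
    using cbr_leibniz[of X Y F] cbr_skew[of "X \<odot> F" Y] by (simp add: pm cbr_simps algebra_simps)
  then show ?thesis using assms by (simp add: mp_closed mp_bracket pp_in)
qed

text \<open>\<open>ad H\<close> commutes with its adjoint \<open>- ad (tau H)\<close>, so it is
  normal, and expanding the square norm of \<open>?V\<close> gives 0. This carries eigenvalue
  equations from \<open>h \<inter> mp\<close> to \<open>h \<inter> mm\<close>.\<close>

lemma normal_eigenvector:
  assumes "H \<in> h" "H \<odot> Y = a *\<^sub>C Y"
  shows "tau H \<odot> Y = (- cnj a) *\<^sub>C Y"
proof -
  let ?V = "tau H \<odot> Y + cnj a *\<^sub>C Y"
  have 1: "hip Y (tau H \<odot> Y) = - (a * hip Y Y)"
    using hip_adjoint[of H Y Y] assms(2) by (simp add: hip_simps)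
  have 2: "hip (tau H \<odot> Y) Y = - (cnj a * hip Y Y)"
    using hip_adjoint[of "tau H" Y Y] assms(2) by (simp add: hip_simps tau_tau)
  have "hip (tau H \<odot> Y) (tau H \<odot> Y) = - hip Y (H \<odot> (tau H \<odot> Y))"
    by (simp add: hip_adjoint tau_tau)
  also have "H \<odot> (tau H \<odot> Y) = a *\<^sub>C (tau H \<odot> Y)"
    using ad_h_commute[OF assms(1) tau_in_h[OF assms(1)]] assms(2) by (simp add: cbr_simps)
  finally have 3: "hip (tau H \<odot> Y) (tau H \<odot> Y) = cnj a * a * hip Y Y"
    using 1 by (simp add: hip_simps)
  have "hip ?V ?V = 0" using 1 2 3 by (simp add: hip_simps algebra_simps)
  then have "?V = 0" by (simp add: hip_self_eq_0_iff)
  then show ?thesis by (simp add: cx.scale_minus_left eq_neg_iff_add_eq_0)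
qed

end

section \<open>Matching structures\<close>

locale matching = b_structure +
  fixes J :: "'a \<Rightarrow> 'a"
  assumes matches: "matches br I J"
begin

abbreviation "J' \<equiv> cext J"

lemma integrable_J: "integrable_structure br J" and anticommute: "I (J x) = - J (I x)"
  using matches by (auto simp: matches_def)

lemma complex_J: "complex_structure J"
  using integrable_J by (simp add: integrable_structure_def)

lemmas J_simps = cext_simps[OF complex_J]

lemma I_J: "I' (J' X) = - J' (I' X)"
  using anticommute by (simp add: cext_def prod_eq_iff)

lemma J_mp: "X \<in> mp \<Longrightarrow> J' X \<in> mm" and J_mm: "X \<in> mm \<Longrightarrow> J' X \<in> mp"
  by (simp_all add: mp_def mm_def I_J J_simps cx.scale_minus_left)

text \<open>The defect below lies in the \<open>\<i>\<close>-eigenspace of \<open>J'\<close>; as it is compatible with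
  conjugation, it lies in the conjugate eigenspace as well.\<close>

lemma nijenhuis: "J' (X \<odot> Y - J' X \<odot> J' Y) = J' X \<odot> Y + X \<odot> J' Y"
proof -
  \<comment> \<open>Up to sign, \<open>J'\<close> applied to the Nijenhuis tensor of
    \<open>J\<close>.\<close>
  define C where "C X Y = J' (X \<odot> Y - J' X \<odot> J' Y) - (J' X \<odot> Y + X \<odot> J' Y)" for X Y
  have eig: "J' (C X Y) = \<i> *\<^sub>C C X Y" for X Y
  proof -
    define A B where "A = X \<odot> Y - J' X \<odot> J' Y" and "B = J' X \<odot> Y + X \<odot> J' Y"
    \<comment> \<open>Twice the projection of \<open>Z\<close> onto \<open>m_plus J\<close>.\<close>
    have in_J: "Z - \<i> *\<^sub>C J' Z \<in> m_plus J" for Z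
      by (simp add: m_plus_def J_simps cx.scale_right_diff_distrib)
    have "(X - \<i> *\<^sub>C J' X) \<odot> (Y - \<i> *\<^sub>C J' Y) \<in> m_plus J"
      using integrable_J in_J by (simp add: integrable_structure_def csubalgebra_def)
    moreover have "(X - \<i> *\<^sub>C J' X) \<odot> (Y - \<i> *\<^sub>C J' Y) = A - \<i> *\<^sub>C B"
      by (simp add: A_def B_def cbr_simps cx.scale_right_distrib cx.scale_right_diff_distrib
          cx.scale_minus_left algebra_simps)
    ultimately have e: "J' A - \<i> *\<^sub>C J' B = \<i> *\<^sub>C A + B"
      by (simp add: m_plus_def J_simps cx.scale_right_diff_distrib cx.scale_minus_left)
    have "\<i> *\<^sub>C (J' A - \<i> *\<^sub>C J' B) = \<i> *\<^sub>C (\<i> *\<^sub>C A + B)" using e by simp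
    then have "J' B + A = \<i> *\<^sub>C B - \<i> *\<^sub>C J' A"
      by (simp add: cx.scale_right_diff_distrib cx.scale_right_distrib cx.scale_minus_left algebra_simps)
    then have "- A - J' B = \<i> *\<^sub>C (J' A - B)"
      by (simp add: cx.scale_right_diff_distrib algebra_simps)
    then show ?thesis by (simp add: C_def J_simps flip: A_def B_def)
  qed
  have "tau (C (tau X) (tau Y)) = C X Y"
    by (simp add: C_def tau_simps tau_cbr J_simps flip: J_simps(7))
  then have "J' (C X Y) = tau (J' (C (tau X) (tau Y)))" by (simp flip: J_simps(7))
  also have "\<dots> = (- \<i>) *\<^sub>C C X Y"
    using \<open>tau (C (tau X) (tau Y)) = C X Y\<close> by (simp add: eig tau_simps)
  finally have "\<i> *\<^sub>C C X Y = (- \<i>) *\<^sub>C C X Y" by (simp only: eig)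
  then have "C X Y = 0" unfolding cx.scale_cancel_right by (simp add: complex_eq_iff)
  then show ?thesis by (simp add: C_def)
qed

text \<open>By \<open>nijenhuis\<close> the expression equals \<open>- J' [J' X, J' Y]\<close>. Here
  \<open>J' X\<close> and \<open>J' Y\<close> lie in the subalgebra \<open>mm\<close>, which
  \<open>J'\<close> maps into \<open>mp\<close>.\<close>

lemma J_cocycle:
  assumes "X \<in> mp" "Y \<in> mp"
  shows "J' X \<odot> Y + X \<odot> J' Y - J' (X \<odot> Y) \<in> mp"
proof -
  have "J' X \<odot> Y + X \<odot> J' Y - J' (X \<odot> Y) = - J' (J' X \<odot> J' Y)"
    using nijenhuis[of X Y] by (simp add: J_simps algebra_simps)
  then show ?thesis using assms by (simp add: mp_closed(5) J_mm J_mp mm_bracket)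
qed

section \<open>The coboundary attached to \<open>J\<close>\<close>

lemma root_pp_nonzero: "\<alpha> \<in> \<Delta> \<Longrightarrow> \<alpha> (pp (Hc \<alpha>)) \<noteq> 0"
  using Re_root_pp_coroot[of \<alpha> \<alpha>] by (auto simp: root_coroot)

lemma root_coroot_zero:
  assumes "\<alpha> \<in> \<Delta>" "\<beta> \<in> \<Delta>" "\<beta> (pp (Hc \<alpha>)) = 0"
  shows "\<beta> (Hc \<alpha>) = 0"
  using Re_root_pp_coroot[OF assms(1,2)] root_coroot_real[OF assms(1,2)] assms(3)
  by (simp add: complex_eq_iff)

text \<open>Solved from the requirement that \<open>J' H\<close> and
  \<open>[H, cc \<nu> E (- \<nu>)]\<close> have the same coordinate at \<open>- \<nu>\<close> for
  \<open>H = pp (Hc \<nu>)\<close>, an element of \<open>h \<inter> mp\<close> on which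
  \<open>\<nu>\<close> does not vanish.\<close>

definition cc :: "('a cpx \<Rightarrow> complex) \<Rightarrow> complex" where
  "cc \<nu> = - coord (- \<nu>) (J' (pp (Hc \<nu>))) / \<nu> (pp (Hc \<nu>))"

definition F :: "'a cpx" where
  "F = (\<Sum>\<nu>\<in>P. cc \<nu> *\<^sub>C E (- \<nu>))"

text \<open>\<open>H\<close> commutes with \<open>K = pp (Hc \<nu>)\<close>, and elements of
  \<open>mp\<close> have no coordinate at \<open>- \<nu>\<close>. The cocycle identity for
  \<open>H\<close>, \<open>K\<close> therefore says that the coordinates of \<open>J' H\<close> and
  \<open>J' K\<close> are in the ratio \<open>\<nu> H : \<nu> K\<close>.\<close>

lemma coord_J:
  assumes "\<nu> \<in> P" "H \<in> h" "H \<in> mp"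
  shows "coord (- \<nu>) (J' H) = - (\<nu> H * cc \<nu>)"
proof -
  let ?K = "pp (Hc \<nu>)"
  have R: "\<nu> \<in> \<Delta>" "- \<nu> \<in> \<Delta>" using assms P_roots by auto
  have K: "?K \<in> h" "?K \<in> mp" using R by (simp_all add: pp_in_h coroot_in_h pp_in)
  have "coord (- \<nu>) (J' H \<odot> ?K + H \<odot> J' ?K - J' (H \<odot> ?K)) = 0"
    by (intro coord_mp J_cocycle assms K)
  then have "\<nu> ?K * coord (- \<nu>) (J' H) = \<nu> H * coord (- \<nu>) (J' ?K)"
    using R K assms(2) cbr_skew[of "J' H" ?K]
    by (simp add: h_abelian J_simps coord_simps coord_H_bracket)
  then show ?thesis using root_pp_nonzero[OF R(1)] by (simp add: cc_def field_simps)
qed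

lemma H_F:
  assumes "H \<in> h"
  shows "H \<odot> F = (\<Sum>\<nu>\<in>P. (- (\<nu> H * cc \<nu>)) *\<^sub>C E (- \<nu>))"
  unfolding F_def cbr_sum_right
  by (rule sum.cong) (use assms in \<open>auto simp: cbr_simps H_E P_roots mult.commute\<close>)

text \<open>The difference lies in \<open>mm\<close>, so it has no coordinate at a positive root,
  and at negative roots the choice of \<open>cc\<close> makes it cancel.\<close>

lemma J_minus_coboundary_h:
  assumes "H \<in> h" "H \<in> mp"
  shows "J' H - pm (H \<odot> F) \<in> h"
proof (rule in_h_if_orthogonal)
  fix \<alpha> assume \<alpha>: "\<alpha> \<in> \<Delta>"
  have HF: "H \<odot> F \<in> mm" unfolding H_F[OF assms(1)]
    by (intro cx.subspace_sum[OF subspace_mm] mm_closed(3) E_mm)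
  have "coord \<alpha> (J' H - pm (H \<odot> F)) = 0"
  proof (cases "\<alpha> \<in> P")
    case True
    then show ?thesis using assms J_mp pm_in by (intro coord_mm mm_closed(2)) auto
  next
    case False
    then have "- \<alpha> \<in> P" using root_cases \<alpha> by blast
    then obtain \<nu> where \<nu>: "\<nu> \<in> P" "\<alpha> = - \<nu>" by (metis minus_minus)
    have "coord (- \<nu>) (H \<odot> F) = (\<Sum>\<kappa>\<in>P. if \<kappa> = \<nu> then - (\<nu> H * cc \<nu>) else 0)"
      unfolding H_F[OF assms(1)] coord_sum
      by (rule sum.cong) (use \<nu>(1) in \<open>auto simp: coord_simps coord_E P_roots\<close>)
    also have "\<dots> = - (\<nu> H * cc \<nu>)" using \<nu>(1) finite_P by simp
    finally show ?thesis using coord_J[OF \<nu>(1) assms] HF by (simp add: \<nu>(2) coord_simps pm_mm)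
  qed
  then show "hip (J' H - pm (H \<odot> F)) (E \<alpha>) = 0" using coord_eq_0_iff \<alpha> by blast
qed

text \<open>The difference \<open>D\<close> is again a cocycle modulo \<open>mp\<close>, and it maps
  \<open>h \<inter> mp\<close> into \<open>h\<close>. So \<open>[D H, E \<alpha>]\<close> lies in
  \<open>mp\<close>, and \<open>[H, Y] - \<alpha> H Y\<close> lies in \<open>mp\<close> and
  \<open>mm\<close>, hence is 0. Thus \<open>Y\<close> has weight \<open>\<alpha>\<close>, which
  puts it in \<open>mp\<close> as well as in \<open>mm\<close>.\<close>

lemma J_E_coboundary:
  assumes "\<alpha> \<in> P"
  shows "J' (E \<alpha>) = pm (E \<alpha> \<odot> F)"
proof -
  define D where "D X = J' X - pm (X \<odot> F)" for X
  define Y where "Y = D (E \<alpha>)"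
  have R: "\<alpha> \<in> \<Delta>" using assms P_roots by auto
  have Ymm: "Y \<in> mm" unfolding Y_def D_def
    by (intro mm_closed(2) J_mp E_mp pm_in assms)
  have eig: "H \<odot> Y = \<alpha> H *\<^sub>C Y" if H: "H \<in> h" "H \<in> mp" for H
  proof -
    have "(J' H \<odot> E \<alpha> + H \<odot> J' (E \<alpha>) - J' (H \<odot> E \<alpha>)) -
        (pm (H \<odot> F) \<odot> E \<alpha> + H \<odot> pm (E \<alpha> \<odot> F) - pm ((H \<odot> E \<alpha>) \<odot> F)) \<in> mp"
      using H assms by (intro mp_closed(2) J_cocycle coboundary_cocycle E_mp)
    also have "(J' H \<odot> E \<alpha> + H \<odot> J' (E \<alpha>) - J' (H \<odot> E \<alpha>)) -
        (pm (H \<odot> F) \<odot> E \<alpha> + H \<odot> pm (E \<alpha> \<odot> F) - pm ((H \<odot> E \<alpha>) \<odot> F)) =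
        D H \<odot> E \<alpha> + (H \<odot> Y - \<alpha> H *\<^sub>C Y)"
      using R H(1) by (simp add: Y_def D_def cbr_simps H_E J_simps pi_simps
          cx.scale_right_diff_distrib algebra_simps)
    finally have "D H \<odot> E \<alpha> + (H \<odot> Y - \<alpha> H *\<^sub>C Y) \<in> mp" .
    moreover have "D H \<odot> E \<alpha> \<in> mp"
      using J_minus_coboundary_h[OF H] assms by (simp add: D_def h_mp E_mp)
    ultimately have "H \<odot> Y - \<alpha> H *\<^sub>C Y \<in> mp" using mp_closed(2) by fastforce
    moreover have "H \<odot> Y - \<alpha> H *\<^sub>C Y \<in> mm" using Ymm H(1) by (intro mm_closed h_mm)
    ultimately show ?thesis using mp_mm by fastforce
  qed
  have "Y \<in> root_space br h \<alpha>" unfolding root_space_def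
  proof (intro CollectI ballI)
    fix H assume H: "H \<in> h"
    \<comment> \<open>Its conjugate is \<open>pm H\<close>; normality transfers the eigenvalue
      equation from \<open>?K\<close> to \<open>pm H\<close>.\<close>
    let ?K = "pp (tau H)"
    have K: "?K \<in> h" "?K \<in> mp" using H by (simp_all add: pp_in_h tau_in_h pp_in)
    have "tau ?K \<odot> Y = \<alpha> (tau ?K) *\<^sub>C Y"
      using normal_eigenvector[OF K(1) eig[OF K]] root_tau[OF R K(1)] by simp
    then have "pm H \<odot> Y = \<alpha> (pm H) *\<^sub>C Y" by (simp add: tau_pp tau_tau)
    moreover have "pp H \<odot> Y = \<alpha> (pp H) *\<^sub>C Y" using H by (intro eig pp_in_h pp_in)
    moreover have "\<alpha> H = \<alpha> (pp H) + \<alpha> (pm H)"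
      using dual_simps(1)[OF root_dual[OF R] pp_in_h[OF H] pm_in_h[OF H]] by (simp add: pp_pm)
    moreover have "H \<odot> Y = pp H \<odot> Y + pm H \<odot> Y" by (simp add: pp_pm flip: cbr_add_left)
    ultimately show "H \<odot> Y = \<alpha> H *\<^sub>C Y" by (simp add: cx.scale_left_distrib)
  qed
  then obtain c where "Y = c *\<^sub>C E \<alpha>" using root_space_one_dim R by blast
  then have "Y \<in> mp" using assms by (simp add: mp_closed(3) E_mp)
  then have "Y = 0" using Ymm mp_mm by blast
  then show ?thesis by (simp add: Y_def D_def)
qed

lemma J_uminus_E: "\<alpha> \<in> P \<Longrightarrow> J' (E (- \<alpha>)) = - tau (J' (E \<alpha>))"
  by (simp add: E_uminus J_simps)

lemma J_pm_coroot: "\<alpha> \<in> \<Delta> \<Longrightarrow> J' (pm (Hc \<alpha>)) = - tau (J' (pp (Hc \<alpha>)))"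
  by (simp add: tau_pp_coroot J_simps(3) flip: J_simps(7))

text \<open>All clauses are proved together because the induction uses the last one at the stem
  elements above \<open>\<gamma>\<close>. Comparing the square of \<open>J'\<close> on
  \<open>E \<gamma>\<close> with the coordinates in \<open>coord_J\<close> yields them.\<close>

lemma J_stem:
  assumes "\<gamma> \<in> \<Gamma>"
  shows "J' (E \<gamma>) = cc \<gamma> *\<^sub>C pm (Hc \<gamma>) \<and> J' (pp (Hc \<gamma>)) = (- cc \<gamma>) *\<^sub>C E (- \<gamma>) \<and>
    cmod (cc \<gamma>) = 1 \<and> \<gamma> (pp (Hc \<gamma>)) = 1 \<and>
    (\<forall>\<nu>\<in>P. \<nu> \<noteq> \<gamma> \<longrightarrow> cc \<nu> \<noteq> 0 \<longrightarrow> \<nu> (pp (Hc \<gamma>)) = 0)"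
  using assms
proof (induction \<gamma> rule: wf_induct_rule[OF wf_above])
  case (1 \<gamma>)
  note G = \<open>\<gamma> \<in> \<Gamma>\<close>
  have gP: "\<gamma> \<in> P" using G by (rule stem_P)
  have gR: "\<gamma> \<in> \<Delta>" "- \<gamma> \<in> \<Delta>" using gP by (rule P_roots)+
  \<comment> \<open>Such a \<open>\<nu>\<close> is outside the stem, so it lies in the
    \<open>Phi_plus\<close> of a stem element \<open>\<delta>\<close> above \<open>\<gamma>\<close>
    and is not orthogonal to \<open>\<delta>\<close>; a nonzero \<open>cc \<nu>\<close> would make
    it orthogonal by the induction hypothesis.\<close>
  have kill: "cc \<nu> = 0" if \<nu>: "\<nu> \<in> P" "\<nu> - \<gamma> \<in> P" for \<nu>
  proof (rule ccontr)
    assume nz: "cc \<nu> \<noteq> 0"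
    have "\<gamma> \<in> Phi_plus P \<nu>" using gP \<nu> by (simp add: Phi_iff)
    then have "\<nu> \<notin> \<Gamma>" using stem_not_Phi G by blast
    then obtain \<delta> where d: "\<delta> \<in> \<Gamma>" "\<nu> \<in> Phi_plus P \<delta>" using stem_cases \<nu> by blast
    have "(\<delta>, \<gamma>) \<in> above" using Phi_above[OF d] above_base[OF \<nu>(1) gP \<nu>(2)] above_trans by blast
    moreover have "\<nu> \<noteq> \<delta>" using d(1) \<open>\<nu> \<notin> \<Gamma>\<close> by blast
    ultimately have "\<nu> (pp (Hc \<delta>)) = 0" using "1.IH"[of \<delta>] d \<nu>(1) nz by simp
    then have "\<nu> (Hc \<delta>) = 0"
      using root_coroot_zero[of \<delta> \<nu>] d(1) \<nu>(1) by (simp add: stem_P P_roots)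
    then show False using Phi_coroot_nonzero[OF d] by blast
  qed
  let ?c = "cc \<gamma>" and ?H = "Hc \<gamma>"
  have JE: "J' (E \<gamma>) = ?c *\<^sub>C pm ?H"
  proof -
    have "J' (E \<gamma>) = (\<Sum>\<nu>\<in>P. cc \<nu> *\<^sub>C pm (E \<gamma> \<odot> E (- \<nu>)))"
      unfolding J_E_coboundary[OF gP] F_def cbr_sum_right pm_sum by (simp add: cbr_simps pi_simps)
    also have "\<dots> = (\<Sum>\<nu>\<in>P. if \<nu> = \<gamma> then ?c *\<^sub>C pm ?H else 0)"
    proof (rule sum.cong)
      fix \<nu> assume "\<nu> \<in> P"
      then show "cc \<nu> *\<^sub>C pm (E \<gamma> \<odot> E (- \<nu>)) = (if \<nu> = \<gamma> then ?c *\<^sub>C pm ?H else 0)"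
        using kill[of \<nu>] pm_bracket_zero[OF gP, of \<nu>] gR by (auto simp: E_bracket)
    qed simp
    also have "\<dots> = ?c *\<^sub>C pm ?H" using gP finite_P by simp
    finally show ?thesis .
  qed
  have c0: "?c \<noteq> 0"
  proof
    assume "?c = 0"
    then have "J' (J' (E \<gamma>)) = 0" using JE by (simp add: J_simps)
    then show False using E_nonzero gR by (simp add: J_simps)
  qed
  \<comment> \<open>Applying \<open>J'\<close> once more and conjugating turns the formula for
    \<open>J' (E \<gamma>)\<close> into one for \<open>J' (pp ?H)\<close>.\<close>
  have "- E \<gamma> = ?c *\<^sub>C J' (pm ?H)" using J_simps(6)[of "E \<gamma>"] JE by (simp add: J_simps)
  then have "?c *\<^sub>C tau (J' (pp ?H)) = E \<gamma>" using gR by (simp add: J_pm_coroot)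
  then have "tau (?c *\<^sub>C tau (J' (pp ?H))) = tau (E \<gamma>)" by simp
  then have e: "cnj ?c *\<^sub>C J' (pp ?H) = - E (- \<gamma>)" using gR by (simp add: tau_simps tau_E)
  have ph: "pp ?H \<in> h" "pp ?H \<in> mp" using gR by (simp_all add: pp_in_h coroot_in_h pp_in)
  \<comment> \<open>The coordinate of \<open>J' (pp ?H)\<close> at \<open>- \<nu>\<close> is known
    from \<open>e\<close> and from \<open>coord_J\<close>.\<close>
  have cfs: "cnj ?c * (\<nu> (pp ?H) * cc \<nu>) = (if \<nu> = \<gamma> then 1 else 0)" if \<nu>: "\<nu> \<in> P" for \<nu>
  proof -
    have "coord (- \<nu>) (cnj ?c *\<^sub>C J' (pp ?H)) = - (if \<nu> = \<gamma> then 1 else 0)"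
      unfolding e using \<nu> gR by (simp add: coord_simps coord_E P_roots)
    then show ?thesis using coord_J[OF \<nu> ph] by (simp add: coord_simps split: if_splits)
  qed
  have r: "\<gamma> (pp ?H) * of_real ((cmod ?c)\<^sup>2) = 1"
    using cfs[OF gP] complex_norm_square[of ?c] by (simp add: mult_ac)
  \<comment> \<open>As the other factor in \<open>r\<close> is real, taking real parts isolates the
    modulus of \<open>?c\<close>.\<close>
  have "Re (\<gamma> (pp ?H)) = 1" using Re_root_pp_coroot[OF gR(1) gR(1)] root_coroot[OF gR(1)] by simp
  then have c1: "cmod ?c = 1" using arg_cong[OF r, of Re]
    by (simp add: power2_eq_1_iff) (use norm_ge_zero[of ?c] in linarith)
  then have g1: "\<gamma> (pp ?H) = 1" using r by simp
  have "?c * cnj ?c = 1" using c1 complex_norm_square[of ?c] by simp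
  then have "J' (pp ?H) = ?c *\<^sub>C (cnj ?c *\<^sub>C J' (pp ?H))" by simp
  then have "J' (pp ?H) = (- ?c) *\<^sub>C E (- \<gamma>)" by (simp only: e) (simp add: cx.scale_minus_left)
  moreover have "\<nu> (pp ?H) = 0" if "\<nu> \<in> P" "\<nu> \<noteq> \<gamma>" "cc \<nu> \<noteq> 0" for \<nu>
    using cfs[OF that(1)] that c0 by simp
  ultimately show ?case using JE c1 g1 by blast
qed

lemma J_E_stem: "\<gamma> \<in> \<Gamma> \<Longrightarrow> J' (E \<gamma>) = cc \<gamma> *\<^sub>C pm (Hc \<gamma>)"
  and J_pp_coroot: "\<gamma> \<in> \<Gamma> \<Longrightarrow> J' (pp (Hc \<gamma>)) = (- cc \<gamma>) *\<^sub>C E (- \<gamma>)"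
  and cmod_cc: "\<gamma> \<in> \<Gamma> \<Longrightarrow> cmod (cc \<gamma>) = 1"
  using J_stem by blast+

lemma stem_dual_basis:
  assumes "\<gamma> \<in> \<Gamma>" "\<delta> \<in> \<Gamma>"
  shows "\<delta> (pp (Hc \<gamma>)) = (if \<delta> = \<gamma> then 1 else 0)"
  using J_stem[OF assms(1)] cmod_cc[OF assms(2)] stem_P[OF assms(2)] by force

text \<open>A root in \<open>Phi_plus P \<delta>\<close> is not orthogonal to
  \<open>\<delta>\<close>, whereas the last clause of \<open>J_stem\<close> would make it so if its
  coefficient were nonzero.\<close>

lemma cc_outside_stem:
  assumes "\<nu> \<in> P" "\<nu> \<notin> \<Gamma>"
  shows "cc \<nu> = 0"
proof (rule ccontr)
  assume nz: "cc \<nu> \<noteq> 0"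
  obtain \<delta> where d: "\<delta> \<in> \<Gamma>" "\<nu> \<in> Phi_plus P \<delta>" using stem_cases assms by blast
  moreover have "\<nu> \<noteq> \<delta>" using d(1) assms(2) by blast
  ultimately have "\<nu> (pp (Hc \<delta>)) = 0" using J_stem[OF d(1)] assms(1) nz by simp
  then have "\<nu> (Hc \<delta>) = 0"
    using root_coroot_zero[of \<delta> \<nu>] d(1) assms(1) by (simp add: stem_P P_roots)
  then show False using Phi_coroot_nonzero[OF d] by blast
qed

lemma F_stem: "F = (\<Sum>\<gamma>\<in>\<Gamma>. cc \<gamma> *\<^sub>C E (- \<gamma>))"
  unfolding F_def
  by (rule sum.mono_neutral_right) (use finite_P stem_P cc_outside_stem in auto)

end

section \<open>Uniqueness and existence\<close>

context b_structure
begin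

lemma finite_stem: "finite \<Gamma>"
  using finite_P stem_P by (meson finite_subset subsetI)

text \<open>The functionals \<open>\<delta> \<circ> pp\<close> and
  \<open>\<delta> \<circ> pm\<close> are dual to these \<open>2 * card \<Gamma>\<close> vectors,
  which are therefore independent, and \<open>dim\<close> makes them a basis. Duality is a premise
  so that no particular \<open>J\<close> occurs in the statement.\<close>

lemma stem_span_h:
  assumes dual: "\<And>\<gamma> \<delta>. \<gamma> \<in> \<Gamma> \<Longrightarrow> \<delta> \<in> \<Gamma> \<Longrightarrow> \<delta> (pp (Hc \<gamma>)) = (if \<delta> = \<gamma> then 1 else 0)"
    and dim: "2 * card \<Gamma> = cx.dim h"
  shows "h \<subseteq> cx.span ((\<lambda>\<gamma>. pp (Hc \<gamma>)) ` \<Gamma> \<union> (\<lambda>\<gamma>. pm (Hc \<gamma>)) ` \<Gamma>)"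
proof -
  note fin = finite_stem
  obtain B where "finite_dimensional_vector_space csc (B::'a cpx set)" using finite_dim_cpx by blast
  then interpret V: finite_dimensional_vector_space csc B .
  let ?p = "\<lambda>\<gamma>. pp (Hc \<gamma>)" and ?m = "\<lambda>\<gamma>. pm (Hc \<gamma>)"
  have R: "\<gamma> \<in> \<Delta>" if "\<gamma> \<in> \<Gamma>" for \<gamma> using that stem_P P_roots by blast
  have ph: "?p \<gamma> \<in> h" and mh: "?m \<gamma> \<in> h" if "\<gamma> \<in> \<Gamma>" for \<gamma>
    using R[OF that] by (simp_all add: pp_in_h pm_in_h coroot_in_h)
  have pz: "\<delta> (pp (?p \<gamma>)) = (if \<delta> = \<gamma> then 1 else 0)" "\<delta> (pp (?m \<gamma>)) = 0"
    "\<delta> (pm (?m \<gamma>)) = (if \<delta> = \<gamma> then 1 else 0)" "\<delta> (pm (?p \<gamma>)) = 0"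
    if "\<gamma> \<in> \<Gamma>" "\<delta> \<in> \<Gamma>" for \<gamma> \<delta>
    using dual[OF that] root_pm_coroot[OF R[OF that(1)] R[OF that(2)]]
      dual_simps(3)[OF root_dual[OF R[OF that(2)]] h_closed(4), of 0]
    by (auto simp: pp_mp pm_mp pp_mm pm_mm pp_in pm_in)
  have inj: "inj_on ?p \<Gamma>" "inj_on ?m \<Gamma>"
  proof -
    show "inj_on ?p \<Gamma>"
    proof (rule inj_onI)
      fix \<gamma> \<delta> assume a: "\<gamma> \<in> \<Gamma>" "\<delta> \<in> \<Gamma>" "?p \<gamma> = ?p \<delta>"
      show "\<gamma> = \<delta>" using pz(1)[OF a(1,2)] pz(1)[OF a(2,2)] a(3) by (metis zero_neq_one)
    qed
    show "inj_on ?m \<Gamma>"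
    proof (rule inj_onI)
      fix \<gamma> \<delta> assume a: "\<gamma> \<in> \<Gamma>" "\<delta> \<in> \<Gamma>" "?m \<gamma> = ?m \<delta>"
      show "\<gamma> = \<delta>" using pz(3)[OF a(1,2)] pz(3)[OF a(2,2)] a(3) by (metis zero_neq_one)
    qed
  qed
  have "?p \<gamma> \<noteq> ?m \<delta>" if "\<gamma> \<in> \<Gamma>" "\<delta> \<in> \<Gamma>" for \<gamma> \<delta>
    using pz(1)[OF that(1) that(1)] pz(2)[OF that(2) that(1)] by (metis zero_neq_one)
  then have disj: "?p ` \<Gamma> \<inter> ?m ` \<Gamma> = {}" by blast
  let ?B = "?p ` \<Gamma> \<union> ?m ` \<Gamma>"
  have card: "card ?B = cx.dim h"
    using fin inj disj dim by (simp add: card_Un_disjoint card_image)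
  have Bh: "?B \<subseteq> h" using ph mh by blast
  have "cx.independent ?B"
    unfolding cx.dependent_finite[OF finite_UnI[OF finite_imageI[OF fin] finite_imageI[OF fin]]]
  proof (intro notI, elim exE conjE bexE)
    fix u v assume v: "v \<in> ?B" "u v \<noteq> 0" and s: "(\<Sum>v\<in>?B. u v *\<^sub>C v) = 0"
    \<comment> \<open>With \<open>\<phi>\<close> equal to \<open>pp\<close> or \<open>pm\<close>,
      the functional \<open>\<delta> \<circ> \<phi>\<close> extracts the coefficient
      \<open>u v\<close> from the vanishing combination.\<close>
    have detect: False if \<delta>: "\<delta> \<in> \<Gamma>" and \<phi>: "\<And>X Y. \<phi> (X + Y) = \<phi> X + \<phi> Y"
      "\<And>c X. \<phi> (c *\<^sub>C X) = c *\<^sub>C \<phi> X" "\<And>X. X \<in> h \<Longrightarrow> \<phi> X \<in> h"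
      and w: "\<And>w. w \<in> ?B \<Longrightarrow> \<delta> (\<phi> w) = (if w = v then 1 else 0)" for \<delta> \<phi>
    proof -
      have \<phi>0: "\<phi> 0 = 0" using \<phi>(2)[of 0 0] by simp
      have "\<phi> (\<Sum>v\<in>A. u v *\<^sub>C v) = (\<Sum>v\<in>A. u v *\<^sub>C \<phi> v)" for A
        by (induction A rule: infinite_finite_induct) (simp_all add: \<phi>(1,2) \<phi>0)
      moreover have uh: "u w *\<^sub>C \<phi> w \<in> h" if "w \<in> ?B" for w
        using that Bh by (intro h_closed(3) \<phi>(3)) blast
      ultimately have "\<delta> (\<phi> (\<Sum>v\<in>?B. u v *\<^sub>C v)) = (\<Sum>w\<in>?B. \<delta> (u w *\<^sub>C \<phi> w))"
        by (simp only: dual_sum[OF root_dual[OF R[OF \<delta>]] uh])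
      also have "\<dots> = (\<Sum>w\<in>?B. if w = v then u v else 0)"
      proof (rule sum.cong)
        fix x assume x: "x \<in> ?B"
        have "\<delta> (u x *\<^sub>C \<phi> x) = u x * \<delta> (\<phi> x)"
          using x Bh by (intro dual_simps(3)[OF root_dual[OF R[OF \<delta>]]] \<phi>(3)) blast
        then show "\<delta> (u x *\<^sub>C \<phi> x) = (if x = v then u v else 0)" unfolding w[OF x] by simp
      qed simp
      also have "\<dots> = u v" using v(1) fin by simp
      finally show False
        unfolding s \<phi>0 using v(2) dual_simps(3)[OF root_dual[OF R[OF \<delta>]] h_closed(4), of 0] by simp
    qed
    from v(1) show False
    proof
      assume "v \<in> ?p ` \<Gamma>"
      then obtain \<delta> where d: "\<delta> \<in> \<Gamma>" "v = ?p \<delta>" by blast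
      show False
      proof (rule detect[OF d(1), of pp])
        fix w assume "w \<in> ?B"
        then show "\<delta> (pp w) = (if w = v then 1 else 0)"
        proof
          assume "w \<in> ?p ` \<Gamma>"
          then obtain \<gamma> where g: "\<gamma> \<in> \<Gamma>" "w = ?p \<gamma>" by blast
          then have "w = v \<longleftrightarrow> \<delta> = \<gamma>" using d inj_on_eq_iff[OF inj(1)] by auto
          then show ?thesis unfolding g(2) using pz(1)[OF g(1) d(1)] by argo
        next
          assume w: "w \<in> ?m ` \<Gamma>"
          then have "w \<noteq> v" using d disj by blast
          moreover obtain \<gamma> where g: "\<gamma> \<in> \<Gamma>" "w = ?m \<gamma>" using w by blast
          ultimately show ?thesis unfolding g(2) using pz(2)[OF g(1) d(1)] by argo
        qed
      qed (simp_all add: pi_simps pp_in_h)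
    next
      assume "v \<in> ?m ` \<Gamma>"
      then obtain \<delta> where d: "\<delta> \<in> \<Gamma>" "v = ?m \<delta>" by blast
      show False
      proof (rule detect[OF d(1), of pm])
        fix w assume "w \<in> ?B"
        then show "\<delta> (pm w) = (if w = v then 1 else 0)"
        proof
          assume "w \<in> ?m ` \<Gamma>"
          then obtain \<gamma> where g: "\<gamma> \<in> \<Gamma>" "w = ?m \<gamma>" by blast
          then have "w = v \<longleftrightarrow> \<delta> = \<gamma>" using d inj_on_eq_iff[OF inj(2)] by auto
          then show ?thesis unfolding g(2) using pz(3)[OF g(1) d(1)] by argo
        next
          assume w: "w \<in> ?p ` \<Gamma>"
          then have "w \<noteq> v" using d disj by blast
          moreover obtain \<gamma> where g: "\<gamma> \<in> \<Gamma>" "w = ?p \<gamma>" using w by blast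
          ultimately show ?thesis unfolding g(2) using pz(4)[OF g(1) d(1)] by argo
        qed
      qed (simp_all add: pi_simps pm_in_h)
    qed
  qed
  then show ?thesis using V.card_ge_dim_independent[OF Bh] card by simp
qed

text \<open>Conjugation extends agreement to all root vectors and to the
  \<open>pm (Hc \<gamma>)\<close>, which together with the given vectors span everything. General
  linear maps are allowed because the lemma is applied to \<open>J'\<close> and to the square of
  \<open>Jc\<close>.\<close>

lemma stem_determines:
  assumes dual: "\<And>\<gamma> \<delta>. \<gamma> \<in> \<Gamma> \<Longrightarrow> \<delta> \<in> \<Gamma> \<Longrightarrow> \<delta> (pp (Hc \<gamma>)) = (if \<delta> = \<gamma> then 1 else 0)"
    and dim: "2 * card \<Gamma> = cx.dim h"
    and f: "\<And>X Y. f (X + Y) = f X + f Y" "\<And>c X. f (c *\<^sub>C X) = c *\<^sub>C f X" "\<And>X. f (tau X) = tau (f X)"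
    and g: "\<And>X Y. g (X + Y) = g X + g Y" "\<And>c X. g (c *\<^sub>C X) = c *\<^sub>C g X" "\<And>X. g (tau X) = tau (g X)"
    and E: "\<And>\<alpha>. \<alpha> \<in> P \<Longrightarrow> f (E \<alpha>) = g (E \<alpha>)"
    and H: "\<And>\<gamma>. \<gamma> \<in> \<Gamma> \<Longrightarrow> f (pp (Hc \<gamma>)) = g (pp (Hc \<gamma>))"
  shows "f = g"
proof
  define S where "S = {X. f X = g X}"
  have S: "cx.subspace S"
    using f(2)[of 0 0] g(2)[of 0 0] by (auto simp: S_def cx.subspace_def f g)
  have tS: "tau X \<in> S" if "X \<in> S" for X using that by (simp add: S_def f g)
  have mS: "- X \<in> S" if "X \<in> S" for X using S that by (rule cx.subspace_neg)
  have ES: "E \<alpha> \<in> S" if "\<alpha> \<in> \<Delta>" for \<alpha>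
  proof (cases "\<alpha> \<in> P")
    case True
    then show ?thesis by (simp add: S_def E)
  next
    case False
    then have n: "- \<alpha> \<in> P" using root_cases that by blast
    then have "- tau (E (- \<alpha>)) \<in> S" by (intro mS tS) (simp add: S_def E)
    then show ?thesis using E_uminus[OF n] by simp
  qed
  have pS: "pp (Hc \<gamma>) \<in> S" if "\<gamma> \<in> \<Gamma>" for \<gamma> using that by (simp add: S_def H)
  have qS: "pm (Hc \<gamma>) \<in> S" if "\<gamma> \<in> \<Gamma>" for \<gamma>
  proof -
    have "pm (Hc \<gamma>) = - tau (pp (Hc \<gamma>))" using that stem_P P_roots by (simp add: tau_pp_coroot)
    then show ?thesis using mS[OF tS[OF pS[OF that]]] by simp
  qed
  have "cx.span ((\<lambda>\<gamma>. pp (Hc \<gamma>)) ` \<Gamma> \<union> (\<lambda>\<gamma>. pm (Hc \<gamma>)) ` \<Gamma>) \<subseteq> S"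
    using pS qS S by (intro cx.span_minimal) auto
  then have "h \<subseteq> S" using stem_span_h[OF dual dim] by blast
  then have "cx.span (h \<union> E ` \<Delta>) \<subseteq> S" using ES S by (intro cx.span_minimal) auto
  then show "f X = g X" for X using span_h_E by (auto simp: S_def)
qed

text \<open>On \<open>mp\<close> this is the coboundary of \<open>F\<close>; the second summand is
  what commuting with \<open>tau\<close> forces on \<open>mm\<close>.\<close>

definition Jc :: "'a cpx \<Rightarrow> 'a cpx \<Rightarrow> 'a cpx" where
  "Jc F X = pm (pp X \<odot> F) + pp (pm X \<odot> tau F)"

text \<open>The general form of the element \<open>F\<close> of a matching structure, with freely
  prescribed coefficients on the stem.\<close>

definition Fs :: "(('a cpx \<Rightarrow> complex) \<Rightarrow> complex) \<Rightarrow> 'a cpx" where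
  "Fs c = (\<Sum>\<gamma>\<in>\<Gamma>. c \<gamma> *\<^sub>C E (- \<gamma>))"

lemma Jc_add: "Jc F (X + Y) = Jc F X + Jc F Y"
  and Jc_csc: "Jc F (c *\<^sub>C X) = c *\<^sub>C Jc F X"
  and Jc_minus: "Jc F (- X) = - Jc F X"
  and Jc_diff: "Jc F (X - Y) = Jc F X - Jc F Y"
  by (simp_all add: Jc_def pi_simps cbr_simps cx.scale_right_distrib algebra_simps)

lemma Jc_tau: "Jc F (tau X) = tau (Jc F X)"
  by (simp add: Jc_def tau_simps tau_pp tau_pm tau_cbr add.commute)

lemma Jc_mp: "X \<in> mp \<Longrightarrow> Jc F X = pm (X \<odot> F)"
  by (simp add: Jc_def pp_mp pm_mp cbr_simps pi_simps)

lemma Jc_in_mm: "X \<in> mp \<Longrightarrow> Jc F X \<in> mm"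
  by (simp add: Jc_mp pm_in)

lemma Jc_in_mp: "X \<in> mm \<Longrightarrow> Jc F X \<in> mp"
  using Jc_in_mm[of "tau X" F] by (simp add: Jc_tau tau_mp tau_mm)

lemma Jc_uminus_E: "\<alpha> \<in> P \<Longrightarrow> Jc F (E (- \<alpha>)) = - tau (Jc F (E \<alpha>))"
  by (simp add: E_uminus Jc_minus Jc_tau)

lemma Jc_Fs_sum:
  assumes "X \<in> mp"
  shows "Jc (Fs c) X = (\<Sum>\<delta>\<in>\<Gamma>. c \<delta> *\<^sub>C pm (X \<odot> E (- \<delta>)))"
  unfolding Jc_mp[OF assms] Fs_def cbr_sum_right pm_sum by (simp add: cbr_simps pi_simps)

text \<open>A stem element lies in no \<open>Phi_plus\<close>, so \<open>pm_bracket_zero\<close>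
  removes all terms with \<open>\<delta> \<noteq> \<gamma>\<close>.\<close>

lemma Jc_Fs_stem:
  assumes "\<gamma> \<in> \<Gamma>"
  shows "Jc (Fs c) (E \<gamma>) = c \<gamma> *\<^sub>C pm (Hc \<gamma>)"
proof -
  have gP: "\<gamma> \<in> P" using assms stem_P by blast
  have "Jc (Fs c) (E \<gamma>) = (\<Sum>\<delta>\<in>\<Gamma>. if \<delta> = \<gamma> then c \<gamma> *\<^sub>C pm (Hc \<gamma>) else 0)"
    unfolding Jc_Fs_sum[OF E_mp[OF gP]]
  proof (rule sum.cong)
    fix \<delta> assume d: "\<delta> \<in> \<Gamma>"
    have "\<delta> - \<gamma> \<notin> P" using stem_not_Phi[OF assms d] gP by (simp add: Phi_iff)
    then show "c \<delta> *\<^sub>C pm (E \<gamma> \<odot> E (- \<delta>)) = (if \<delta> = \<gamma> then c \<gamma> *\<^sub>C pm (Hc \<gamma>) else 0)"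
      using pm_bracket_zero[OF gP stem_P[OF d]] gP by (auto simp: E_bracket P_roots)
  qed simp
  then show ?thesis using assms finite_stem by simp
qed

text \<open>\<open>\<alpha>\<close> is outside the stem and lies in only one
  \<open>Phi_plus\<close>, so again a single term survives.\<close>

lemma Jc_Fs_Phi:
  assumes "\<gamma> \<in> \<Gamma>" "\<alpha> \<in> Phi_plus P \<gamma>"
  shows "Jc (Fs c) (E \<alpha>) = (c \<gamma> * of_int (N \<alpha> (- \<gamma>))) *\<^sub>C E (- (\<gamma> - \<alpha>))"
proof -
  have aP: "\<alpha> \<in> P" "\<gamma> - \<alpha> \<in> P" using assms(2) by (simp_all add: Phi_iff)
  have gP: "\<gamma> \<in> P" using assms stem_P by blast
  let ?R = "(c \<gamma> * of_int (N \<alpha> (- \<gamma>))) *\<^sub>C E (- (\<gamma> - \<alpha>))"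
  have "Jc (Fs c) (E \<alpha>) = (\<Sum>\<delta>\<in>\<Gamma>. if \<delta> = \<gamma> then ?R else 0)"
    unfolding Jc_Fs_sum[OF E_mp[OF aP(1)]]
  proof (rule sum.cong)
    fix \<delta> assume d: "\<delta> \<in> \<Gamma>"
    show "c \<delta> *\<^sub>C pm (E \<alpha> \<odot> E (- \<delta>)) = (if \<delta> = \<gamma> then ?R else 0)"
    proof (cases "\<delta> = \<gamma>")
      case True
      have "\<alpha> + - \<gamma> = - (\<gamma> - \<alpha>)" by simp
      moreover have "- (\<gamma> - \<alpha>) \<in> \<Delta>" using aP(2) by (rule P_roots)
      ultimately have "E \<alpha> \<odot> E (- \<gamma>) = of_int (N \<alpha> (- \<gamma>)) *\<^sub>C E (- (\<gamma> - \<alpha>))"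
        using E_bracket_N[of \<alpha> "- \<gamma>"] aP(1) gP P_roots by metis
      then show ?thesis using True E_mm[OF aP(2)] by (simp add: pi_simps pm_mm)
    next
      case False
      have "\<alpha> \<noteq> \<delta>" using assms(2) stem_not_Phi[OF d assms(1)] by blast
      moreover have "\<delta> - \<alpha> \<notin> P" using Phi_unique[OF assms(1) d assms(2)] False aP by (auto simp: Phi_iff)
      ultimately show ?thesis using False pm_bracket_zero[OF aP(1) stem_P[OF d]] by simp
    qed
  qed simp
  then show ?thesis using assms finite_stem by simp
qed

lemma Jc_Fs_coroot:
  assumes dual: "\<And>\<gamma> \<delta>. \<gamma> \<in> \<Gamma> \<Longrightarrow> \<delta> \<in> \<Gamma> \<Longrightarrow> \<delta> (pp (Hc \<gamma>)) = (if \<delta> = \<gamma> then 1 else 0)"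
    and "\<gamma> \<in> \<Gamma>"
  shows "Jc (Fs c) (pp (Hc \<gamma>)) = (- c \<gamma>) *\<^sub>C E (- \<gamma>)"
proof -
  have h: "pp (Hc \<gamma>) \<in> h" using assms(2) stem_P P_roots by (simp add: pp_in_h coroot_in_h)
  have "Jc (Fs c) (pp (Hc \<gamma>)) = (\<Sum>\<delta>\<in>\<Gamma>. if \<delta> = \<gamma> then (- c \<gamma>) *\<^sub>C E (- \<gamma>) else 0)"
    unfolding Jc_Fs_sum[OF pp_in]
  proof (rule sum.cong)
    fix \<delta> assume d: "\<delta> \<in> \<Gamma>"
    show "c \<delta> *\<^sub>C pm (pp (Hc \<gamma>) \<odot> E (- \<delta>)) = (if \<delta> = \<gamma> then (- c \<gamma>) *\<^sub>C E (- \<gamma>) else 0)"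
      using d h dual[OF assms(2) d] stem_P[OF d] by (auto simp: H_E P_roots pi_simps pm_mm E_mm cx.scale_minus_left)
  qed simp
  then show ?thesis using assms finite_stem by simp
qed

text \<open>\<open>Q\<close> measures how far \<open>Jc F\<close> is from a derivation; it maps
  pairs from \<open>mp\<close> into \<open>mp\<close> and, by conjugation, pairs from
  \<open>mm\<close> into \<open>mm\<close>. At \<open>(U, V)\<close> this yields the
  \<open>pm\<close> part of \<open>B\<close>, at \<open>(Jc F U, Jc F V)\<close> the
  \<open>pp\<close> part.\<close>

lemma Jc_nijenhuis:
  assumes sq: "\<And>X. Jc F (Jc F X) = - X" and UV: "U \<in> mp" "V \<in> mp"
  shows "Jc F (U \<odot> V - Jc F U \<odot> Jc F V) = Jc F U \<odot> V + U \<odot> Jc F V"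
proof -
  define Q where "Q X Y = Jc F X \<odot> Y + X \<odot> Jc F Y - Jc F (X \<odot> Y)" for X Y
  have Q: "Q X Y \<in> mp" if "X \<in> mp" "Y \<in> mp" for X Y
    using coboundary_cocycle[OF that, of F] that by (simp add: Q_def Jc_mp mp_bracket)
  have "tau (Q X Y) = Q (tau X) (tau Y)" for X Y by (simp add: Q_def tau_simps tau_cbr flip: Jc_tau)
  then have Q': "Q X Y \<in> mm" if "X \<in> mm" "Y \<in> mm" for X Y
    using Q[of "tau X" "tau Y"] tau_mm[of "Q (tau X) (tau Y)"] that
    by (simp add: tau_mp tau_tau \<open>\<And>X Y. tau (Q X Y) = Q (tau X) (tau Y)\<close>)
  define B where "B = Jc F U \<odot> V + U \<odot> Jc F V"
  have "pm (Q U V) = 0" "pp (Q (Jc F U) (Jc F V)) = 0"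
    using Q Q' UV by (simp_all add: pm_mp pp_mm Jc_in_mm)
  moreover have "Q U V = B - Jc F (U \<odot> V)" by (simp add: Q_def B_def)
  moreover have "Q (Jc F U) (Jc F V) = - B - Jc F (Jc F U \<odot> Jc F V)"
    by (simp add: Q_def B_def sq cbr_simps)
  moreover have "Jc F (U \<odot> V) \<in> mm" "Jc F (Jc F U \<odot> Jc F V) \<in> mp"
    using UV by (simp_all add: Jc_in_mm Jc_in_mp mp_bracket mm_bracket)
  ultimately have "pm B = Jc F (U \<odot> V)" "- pp B = Jc F (Jc F U \<odot> Jc F V)"
    by (simp_all add: pm_diff pp_diff pp_minus pm_mm pp_mp)
  then have "Jc F (U \<odot> V - Jc F U \<odot> Jc F V) = pp B + pm B"
    by (simp add: Jc_diff flip: \<open>- pp B = Jc F (Jc F U \<odot> Jc F V)\<close>)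
  then show ?thesis by (simp add: pp_pm B_def)
qed

text \<open>\<open>Jc F\<close> commutes with \<open>tau\<close>, so it restricts to the real form;
  it exchanges \<open>mp\<close> and \<open>mm\<close>, so the restriction anticommutes with
  \<open>I\<close>.\<close>

lemma Jc_matches:
  assumes sq: "\<And>X. Jc F (Jc F X) = - X"
  shows "\<exists>J. matches br I J \<and> cext J = Jc F"
proof -
  define J :: "'a \<Rightarrow> 'a" where "J x = fst (Jc F (x, 0))" for x
  have real: "Jc F (x, 0) = (J x, 0)" for x
  proof -
    have "snd (Jc F (x, 0)) = - snd (Jc F (x, 0))"
      using Jc_tau[of F "(x, 0)"] by (simp add: tau_def prod_eq_iff)
    then have "snd (Jc F (x, 0)) = 0"
      by (metis add.right_inverse scaleR_2 scaleR_eq_0_iff zero_neq_numeral)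
    then show ?thesis by (simp add: J_def prod_eq_iff)
  qed
  have ext: "cext J = Jc F"
  proof
    fix X :: "'a cpx"
    have "X = (fst X, 0) + \<i> *\<^sub>C (snd X, 0)" by (simp add: csc_def prod_eq_iff)
    then have "Jc F X = (J (fst X), 0) + \<i> *\<^sub>C (J (snd X), 0)" using real by (metis Jc_add Jc_csc)
    then show "cext J X = Jc F X" by (simp add: cext_def csc_def)
  qed
  have "linear J"
  proof
    fix x y and r :: real
    show "J (x + y) = J x + J y" using Jc_add[of F "(x, 0)" "(y, 0)"] by (simp add: real)
    show "J (r *\<^sub>R x) = r *\<^sub>R J x" using Jc_csc[of F "of_real r" "(x, 0)"] by (simp add: csc_def real)
  qed
  moreover have "J (J x) = - x" for x using sq[of "(x, 0)"] by (simp add: real)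
  ultimately have cs: "complex_structure J" by (simp add: complex_structure_def)
  have anti: "I' (Jc F X) = - Jc F (I' X)" for X
  proof -
    have "I' (Jc F (pp X)) = (- \<i>) *\<^sub>C Jc F (pp X)" "I' (pp X) = \<i> *\<^sub>C pp X"
      using Jc_in_mm[OF pp_in] pp_in by (simp_all add: mm_def mp_def)
    moreover have "I' (Jc F (pm X)) = \<i> *\<^sub>C Jc F (pm X)" "I' (pm X) = (- \<i>) *\<^sub>C pm X"
      using Jc_in_mp[OF pm_in] pm_in by (simp_all add: mm_def mp_def)
    ultimately have "I' (Jc F (pp X + pm X)) = - Jc F (I' (pp X + pm X))"
      by (simp only: Jc_add I_simps Jc_csc) (simp add: cx.scale_minus_left)
    then show ?thesis by (simp add: pp_pm)
  qed
  have "csubalgebra br (m_plus J)" unfolding csubalgebra_def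
  proof (intro conjI ballI)
    show "cx.subspace (m_plus J)"
      by (auto simp: cx.subspace_def m_plus_def cext_simps[OF cs] cx.scale_right_distrib mult.commute)
    fix X Y assume XY: "X \<in> m_plus J" "Y \<in> m_plus J"
    \<comment> \<open>The equation \<open>Jc F X = \<i> X\<close> determines \<open>pm X\<close>
      from \<open>pp X\<close>, so closure under brackets reduces to \<open>U\<close>,
      \<open>V\<close> in \<open>mp\<close>, the case of \<open>Jc_nijenhuis\<close>.\<close>
    have dec: "X = pp X - \<i> *\<^sub>C Jc F (pp X)" if "X \<in> m_plus J" for X
    proof -
      have "Jc F X = \<i> *\<^sub>C X" using that by (simp add: m_plus_def ext)
      then have "pm (Jc F (pp X) + Jc F (pm X)) = \<i> *\<^sub>C pm X" by (simp add: pp_pm flip: Jc_add pi_simps)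
      then have "Jc F (pp X) = \<i> *\<^sub>C pm X"
        by (simp add: pi_simps pm_mm pm_mp Jc_in_mm Jc_in_mp pp_in pm_in)
      then have "pm X = - (\<i> *\<^sub>C Jc F (pp X))" by (simp add: cx.scale_minus_left)
      then show ?thesis using pp_pm[of X] by simp
    qed
    define U V where "U = pp X" and "V = pp Y"
    define A B where "A = U \<odot> V - Jc F U \<odot> Jc F V" and "B = Jc F U \<odot> V + U \<odot> Jc F V"
    have AB: "Jc F A = B" unfolding A_def B_def U_def V_def by (rule Jc_nijenhuis[OF sq pp_in pp_in])
    then have BA: "Jc F B = - A" using sq[of A] by simp
    have "X \<odot> Y = (U - \<i> *\<^sub>C Jc F U) \<odot> (V - \<i> *\<^sub>C Jc F V)"
      using dec XY by (simp add: U_def V_def)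
    also have "\<dots> = A - \<i> *\<^sub>C B"
      by (simp add: A_def B_def cbr_simps cx.scale_right_distrib cx.scale_right_diff_distrib
          cx.scale_minus_left algebra_simps)
    finally show "X \<odot> Y \<in> m_plus J"
      by (simp add: m_plus_def ext Jc_diff Jc_csc AB BA cx.scale_right_diff_distrib cx.scale_minus_left)
  qed
  then have "matches br I J"
    using cs anti[of "(_, 0)"] I_simps
    by (auto simp: matches_def integrable_structure_def cext_def real prod_eq_iff simp flip: ext)
  then show ?thesis using ext by blast
qed

end

section \<open>What one matching structure implies for structure constants and for other
  phases\<close>

context matching
begin

text \<open>The rank hypothesis enters here: it leaves no freedom for \<open>J'\<close> on
  \<open>h\<close> beyond the vectors \<open>pp (Hc \<gamma>)\<close> and their conjugates.\<close>

lemma J_eq_Jc: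
  assumes dim: "2 * card \<Gamma> = cx.dim h"
  shows "J' = Jc (Fs cc)"
proof (rule stem_determines[OF stem_dual_basis dim])
  show "J' (E \<alpha>) = Jc (Fs cc) (E \<alpha>)" if "\<alpha> \<in> P" for \<alpha>
    using J_E_coboundary[OF that] E_mp[OF that] by (simp add: Jc_mp F_stem Fs_def)
  show "J' (pp (Hc \<gamma>)) = Jc (Fs cc) (pp (Hc \<gamma>))" if "\<gamma> \<in> \<Gamma>" for \<gamma>
    unfolding J_pp_coroot[OF that] by (rule Jc_Fs_coroot[OF stem_dual_basis that, symmetric])
qed (simp_all add: J_simps Jc_add Jc_csc Jc_tau)

lemma J_uminus_stem:
  assumes "\<gamma> \<in> \<Gamma>"
  shows "J' (E (- \<gamma>)) = cnj (cc \<gamma>) *\<^sub>C pp (Hc \<gamma>)"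
  unfolding J_uminus_E[OF stem_P[OF assms]] J_E_stem[OF assms] tau_csc
    tau_pm_coroot[OF P_roots(1)[OF stem_P[OF assms]]] by simp

lemma stem_J_uminus_stem:
  assumes "\<gamma> \<in> \<Gamma>"
  shows "J' (E (- \<gamma>)) \<in> h" "\<gamma> (J' (E (- \<gamma>))) = cnj (cc \<gamma>)"
proof -
  have R: "\<gamma> \<in> \<Delta>" using assms stem_P P_roots by blast
  have ph: "pp (Hc \<gamma>) \<in> h" using R by (simp add: pp_in_h coroot_in_h)
  show "J' (E (- \<gamma>)) \<in> h" by (simp add: J_uminus_stem[OF assms] h_closed(3) ph)
  show "\<gamma> (J' (E (- \<gamma>))) = cnj (cc \<gamma>)"
    by (simp add: J_uminus_stem[OF assms] dual_simps(3)[OF root_dual[OF R] ph] stem_dual_basis assms)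
qed

lemma J_Phi:
  assumes "\<gamma> \<in> \<Gamma>" "\<alpha> \<in> Phi_plus P \<gamma>"
  shows "J' (E \<alpha>) = (cc \<gamma> * of_int (N \<alpha> (- \<gamma>))) *\<^sub>C E (- (\<gamma> - \<alpha>))"
proof -
  have "\<alpha> \<in> P" using assms by (simp add: Phi_iff)
  then have "J' (E \<alpha>) = Jc (Fs cc) (E \<alpha>)"
    using J_E_coboundary E_mp by (simp add: Jc_mp F_stem Fs_def)
  then show ?thesis using Jc_Fs_Phi[OF assms] by simp
qed

lemma Phi_mirror: "\<alpha> \<in> Phi_plus P \<gamma> \<Longrightarrow> \<gamma> - \<alpha> \<in> Phi_plus P \<gamma>"
  by (simp add: Phi_iff)

text \<open>Applying \<open>J'\<close> twice to \<open>E \<alpha>\<close> multiplies it by this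
  product, since the phases \<open>cc \<gamma>\<close> and \<open>cnj (cc \<gamma>)\<close> cancel.
  The identity itself no longer mentions \<open>J\<close>, so it can be reused for other
  phases.\<close>

lemma N_product:
  assumes "\<gamma> \<in> \<Gamma>" "\<alpha> \<in> Phi_plus P \<gamma>"
  shows "N \<alpha> (- \<gamma>) * N (\<gamma> - \<alpha>) (- \<gamma>) = - 1"
proof -
  have aP: "\<alpha> \<in> P" "\<gamma> - \<alpha> \<in> P" using assms(2) by (simp_all add: Phi_iff)
  let ?n = "of_int (N \<alpha> (- \<gamma>)) :: complex" and ?m = "of_int (N (\<gamma> - \<alpha>) (- \<gamma>)) :: complex"
  have cc1: "cc \<gamma> * cnj (cc \<gamma>) = 1"
    using cmod_cc[OF assms(1)] complex_norm_square[of "cc \<gamma>"] by simp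
  have "J' (E (\<gamma> - \<alpha>)) = (cc \<gamma> * ?m) *\<^sub>C E (- \<alpha>)"
    using J_Phi[OF assms(1) Phi_mirror[OF assms(2)]] by simp
  then have "J' (E (- (\<gamma> - \<alpha>))) = (cnj (cc \<gamma>) * ?m) *\<^sub>C E \<alpha>"
    using J_uminus_E[OF aP(2)] aP(1) by (simp add: tau_simps E_uminus)
  then have "J' (J' (E \<alpha>)) = (cc \<gamma> * ?n * (cnj (cc \<gamma>) * ?m)) *\<^sub>C E \<alpha>"
    by (simp only: J_Phi[OF assms] J_simps cx.scale_scale)
  also have "cc \<gamma> * ?n * (cnj (cc \<gamma>) * ?m) = ?n * ?m" using cc1 by (simp add: algebra_simps)
  finally have "- E \<alpha> = (?n * ?m) *\<^sub>C E \<alpha>" by (simp only: J_simps)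
  then have "(?n * ?m + 1) *\<^sub>C E \<alpha> = 0"
    by (simp add: cx.scale_left_distrib flip: eq_neg_iff_add_eq_0)
  then have "?n * ?m + 1 = 0" using E_nonzero P_roots(1)[OF aP(1)] by simp
  then have "of_int (N \<alpha> (- \<gamma>) * N (\<gamma> - \<alpha>) (- \<gamma>) + 1) = (0 :: complex)" by simp
  then show ?thesis unfolding of_int_eq_0_iff by simp
qed

text \<open>Skew symmetry and the sign rule for negated roots identify the left side with
  \<open>N (\<gamma> - \<alpha>) (- \<gamma>)\<close>. By \<open>N_product\<close> this integer and
  \<open>N \<alpha> (- \<gamma>)\<close> are opposite signs \<open>1\<close> and
  \<open>- 1\<close>.\<close>

lemma N_reflect:
  assumes "\<gamma> \<in> \<Gamma>" "\<alpha> \<in> Phi_plus P \<gamma>"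
  shows "N \<gamma> (- (\<gamma> - \<alpha>)) = - N \<alpha> (- \<gamma>)"
proof -
  let ?\<mu> = "\<gamma> - \<alpha>"
  have aP: "\<alpha> \<in> P" "?\<mu> \<in> P" using assms(2) by (simp_all add: Phi_iff)
  have R: "\<gamma> \<in> \<Delta>" "- \<gamma> \<in> \<Delta>" "\<alpha> \<in> \<Delta>" "- \<alpha> \<in> \<Delta>" "?\<mu> \<in> \<Delta>" "- ?\<mu> \<in> \<Delta>"
    by (simp_all only: P_roots aP stem_P assms(1))
  have s: "\<gamma> + - ?\<mu> = \<alpha>" "- ?\<mu> + \<gamma> = \<alpha>" "?\<mu> + - \<gamma> = - \<alpha>" by simp_all
  have "of_int (N \<gamma> (- ?\<mu>)) *\<^sub>C E \<alpha> = E \<gamma> \<odot> E (- ?\<mu>)"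
    using E_bracket_N[of \<gamma> "- ?\<mu>"] R unfolding s by simp
  also have "\<dots> = - (E (- ?\<mu>) \<odot> E \<gamma>)" by (rule cbr_skew)
  also have "\<dots> = (- of_int (N (- ?\<mu>) \<gamma>)) *\<^sub>C E \<alpha>"
    using E_bracket_N[of "- ?\<mu>" \<gamma>] R unfolding s by (simp add: cx.scale_minus_left)
  finally have "(of_int (N \<gamma> (- ?\<mu>)) :: complex) = - of_int (N (- ?\<mu>) \<gamma>)"
    unfolding cx.scale_cancel_right using E_nonzero[OF R(3)] by blast
  then have "(of_int (N \<gamma> (- ?\<mu>)) :: complex) = of_int (- N (- ?\<mu>) \<gamma>)" by simp
  then have 1: "N \<gamma> (- ?\<mu>) = - N (- ?\<mu>) \<gamma>" unfolding of_int_eq_iff .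
  have 2: "N (- ?\<mu>) (- (- \<gamma>)) = - N ?\<mu> (- \<gamma>)"
    using N_uminus[of ?\<mu> "- \<gamma>"] R unfolding s by blast
  have "N \<alpha> (- \<gamma>) * - N ?\<mu> (- \<gamma>) = 1"
    using N_product[OF assms] by simp
  then have "N \<alpha> (- \<gamma>) = - N ?\<mu> (- \<gamma>)" unfolding zmult_eq_1_iff by auto
  then show ?thesis using 1 2 by simp
qed

text \<open>The second application contributes the conjugate coefficient, so only moduli remain. The
  signs come from \<open>N_product\<close> and duality from \<open>stem_dual_basis\<close>, both
  supplied by the given \<open>J\<close>, whatever its own phases.\<close>

lemma Jc_involution:
  assumes dim: "2 * card \<Gamma> = cx.dim h" and c: "\<And>\<gamma>. \<gamma> \<in> \<Gamma> \<Longrightarrow> cmod (c \<gamma>) = 1"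
  shows "Jc (Fs c) (Jc (Fs c) X) = - X"
proof -
  let ?J = "Jc (Fs c)"
  have cc1: "c \<gamma> * cnj (c \<gamma>) = 1" if "\<gamma> \<in> \<Gamma>" for \<gamma>
    using c[OF that] complex_norm_square[of "c \<gamma>"] by simp
  have R: "\<gamma> \<in> \<Delta>" "\<gamma> \<in> P" if "\<gamma> \<in> \<Gamma>" for \<gamma> using that stem_P P_roots by auto
  have "(\<lambda>X. ?J (?J X)) = uminus"
  proof (rule stem_determines[OF stem_dual_basis dim])
    fix \<alpha> assume a: "\<alpha> \<in> P"
    show "?J (?J (E \<alpha>)) = - E \<alpha>"
    proof (cases "\<alpha> \<in> \<Gamma>")
      case True
      have "pm (Hc \<alpha>) = - tau (pp (Hc \<alpha>))" using R[OF True] by (simp add: tau_pp_coroot)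
      then have "?J (pm (Hc \<alpha>)) = cnj (c \<alpha>) *\<^sub>C tau (E (- \<alpha>))"
        by (simp add: Jc_minus Jc_tau Jc_Fs_coroot[OF stem_dual_basis True] tau_simps cx.scale_minus_left)
      then have "?J (?J (E \<alpha>)) = (c \<alpha> * cnj (c \<alpha>)) *\<^sub>C tau (E (- \<alpha>))"
        by (simp only: Jc_Fs_stem[OF True] Jc_csc cx.scale_scale)
      then show ?thesis using cc1[OF True] a by (simp add: E_uminus tau_simps)
    next
      case False
      then obtain \<gamma> where g: "\<gamma> \<in> \<Gamma>" "\<alpha> \<in> Phi_plus P \<gamma>" using stem_cases a by blast
      have mP: "\<gamma> - \<alpha> \<in> P" using g(2) by (simp add: Phi_iff)
      let ?n = "of_int (N \<alpha> (- \<gamma>)) :: complex" and ?m = "of_int (N (\<gamma> - \<alpha>) (- \<gamma>)) :: complex"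
      have "?J (E (\<gamma> - \<alpha>)) = (c \<gamma> * ?m) *\<^sub>C E (- \<alpha>)"
        using Jc_Fs_Phi[OF g(1) Phi_mirror[OF g(2)]] by simp
      then have "?J (E (- (\<gamma> - \<alpha>))) = (cnj (c \<gamma>) * ?m) *\<^sub>C E \<alpha>"
        using Jc_uminus_E[OF mP] a by (simp add: tau_simps E_uminus)
      then have "?J (?J (E \<alpha>)) = (c \<gamma> * ?n * (cnj (c \<gamma>) * ?m)) *\<^sub>C E \<alpha>"
        by (simp only: Jc_Fs_Phi[OF g] Jc_csc cx.scale_scale)
      also have "c \<gamma> * ?n * (cnj (c \<gamma>) * ?m) = ?n * ?m" using cc1[OF g(1)] by (simp add: algebra_simps)
      also have "\<dots> = of_int (N \<alpha> (- \<gamma>) * N (\<gamma> - \<alpha>) (- \<gamma>))" by simp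
      finally show ?thesis unfolding N_product[OF g] by (simp add: cx.scale_minus_left)
    qed
  next
    fix \<gamma> assume g: "\<gamma> \<in> \<Gamma>"
    have "?J (E (- \<gamma>)) = cnj (c \<gamma>) *\<^sub>C pp (Hc \<gamma>)"
      using R[OF g] by (simp add: Jc_uminus_E Jc_Fs_stem[OF g] tau_simps tau_pm_coroot)
    then have "?J (?J (pp (Hc \<gamma>))) = (- c \<gamma> * cnj (c \<gamma>)) *\<^sub>C pp (Hc \<gamma>)"
      by (simp only: Jc_Fs_coroot[OF stem_dual_basis g] Jc_csc cx.scale_scale)
    then show "?J (?J (pp (Hc \<gamma>))) = - pp (Hc \<gamma>)" using cc1[OF g] by (simp add: cx.scale_minus_left)
  qed (simp_all add: Jc_add Jc_csc Jc_tau tau_simps)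
  then show ?thesis by metis
qed

lemma J_Wvec_Zvec_Xvec:
  assumes one: "\<i> * \<gamma> (J' (E (- \<gamma>))) = 1" and g: "\<gamma> \<in> \<Gamma>"
  shows "J' (Wvec br h \<gamma>) = - Xvec E \<gamma>" "J' (Zvec br h I \<gamma>) = Yvec E \<gamma>"
    "\<alpha> \<in> Phi_plus P \<gamma> \<Longrightarrow>
      J' (Xvec E \<alpha>) = (- of_int (N \<gamma> (- (\<gamma> - \<alpha>)))) *\<^sub>C Yvec E (\<gamma> - \<alpha>)"
proof -
  have R: "\<gamma> \<in> \<Delta>" "\<gamma> \<in> P" using g stem_P P_roots by auto
  have "\<i> * cnj (cc \<gamma>) = 1" using one stem_J_uminus_stem(2)[OF g] by simp
  then have ci: "cc \<gamma> = \<i>" by (simp add: complex_eq_iff)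
  have Jp: "J' (pp (Hc \<gamma>)) = (- \<i>) *\<^sub>C E (- \<gamma>)" using J_pp_coroot[OF g] ci by simp
  have Jm: "J' (pm (Hc \<gamma>)) = \<i> *\<^sub>C E \<gamma>"
    using R by (simp add: J_pm_coroot Jp tau_simps tau_E P_roots cx.scale_minus_left)
  \<comment> \<open>\<open>J'\<close> is known on the two projections of the coroot, and
    \<open>I'\<close> acts on them by \<open>\<i>\<close> and \<open>- \<i>\<close>; so
    \<open>W\<close> and \<open>Z\<close> are expanded in them.\<close>
  have W: "Wvec br h \<gamma> = (\<i>/2) *\<^sub>C (pp (Hc \<gamma>) + pm (Hc \<gamma>))" by (simp add: Wvec_def pp_pm)
  have "I' (pp (Hc \<gamma>)) = \<i> *\<^sub>C pp (Hc \<gamma>)" "I' (pm (Hc \<gamma>)) = (- \<i>) *\<^sub>C pm (Hc \<gamma>)"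
    using pp_in pm_in by (simp_all add: mp_def mm_def)
  then have Z: "Zvec br h I \<gamma> = (\<i>/2) *\<^sub>C (\<i> *\<^sub>C pp (Hc \<gamma>) + (- \<i>) *\<^sub>C pm (Hc \<gamma>))"
    by (simp only: Zvec_def W I_simps)
  show "J' (Wvec br h \<gamma>) = - Xvec E \<gamma>"
    unfolding W J_simps Jp Jm
    by (simp add: Xvec_def csc_def prod_eq_iff scaleR_right_diff_distrib)
  show "J' (Zvec br h I \<gamma>) = Yvec E \<gamma>"
    unfolding Z J_simps Jp Jm
    by (simp add: Yvec_def csc_def prod_eq_iff scaleR_right_distrib)
  assume a: "\<alpha> \<in> Phi_plus P \<gamma>"
  let ?\<mu> = "\<gamma> - \<alpha>"
  have aP: "\<alpha> \<in> P" "?\<mu> \<in> P" using a by (simp_all add: Phi_iff)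
  let ?n = "of_int (N \<alpha> (- \<gamma>)) :: complex"
  have JE: "J' (E \<alpha>) = (\<i> * ?n) *\<^sub>C E (- ?\<mu>)" using J_Phi[OF g a] ci by simp
  have JmE: "J' (E (- \<alpha>)) = (- (\<i> * ?n)) *\<^sub>C E ?\<mu>"
    unfolding J_uminus_E[OF aP(1)] JE E_uminus[OF aP(2)]
    by (simp add: tau_simps cx.scale_minus_left)
  have "J' (Xvec E \<alpha>) = ?n *\<^sub>C Yvec E ?\<mu>"
    unfolding Xvec_def J_simps JE JmE Yvec_def
    by (simp add: cx.scale_right_diff_distrib cx.scale_right_distrib cx.scale_minus_left mult.commute)
  moreover have "?n = - of_int (N \<gamma> (- ?\<mu>))" using N_reflect[OF g a] by simp
  ultimately show "J' (Xvec E \<alpha>) = (- of_int (N \<gamma> (- ?\<mu>))) *\<^sub>C Yvec E ?\<mu>" by simp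
qed

end

section \<open>Uniqueness, and realisation of every family of phases\<close>

context b_structure
begin

lemma matchingI: "matches br I J \<Longrightarrow> matching br ip h P E N \<Gamma> I J"
  by unfold_locales

lemma matching_unique:
  assumes J: "matches br I J" and K: "matches br I K" and dim: "2 * card \<Gamma> = cx.dim h"
    and eq: "\<And>\<gamma>. \<gamma> \<in> \<Gamma> \<Longrightarrow> \<gamma> (cext J (E (- \<gamma>))) = \<gamma> (cext K (E (- \<gamma>)))"
  shows "J = K"
proof -
  interpret J: matching br ip h P E N \<Gamma> I J using J by (rule matchingI)
  interpret K: matching br ip h P E N \<Gamma> I K using K by (rule matchingI)
  have "J.cc \<gamma> = K.cc \<gamma>" if "\<gamma> \<in> \<Gamma>" for \<gamma>
    using eq[OF that] J.stem_J_uminus_stem(2)[OF that] K.stem_J_uminus_stem(2)[OF that] by simp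
  then have "Fs J.cc = Fs K.cc" by (simp add: Fs_def)
  then show ?thesis using J.J_eq_Jc[OF dim] K.J_eq_Jc[OF dim] cext_eq_iff by metis
qed

lemma matching_exists:
  assumes K: "matches br I K" and dim: "2 * card \<Gamma> = cx.dim h"
    and \<rho>: "\<And>\<gamma>. \<gamma> \<in> \<Gamma> \<Longrightarrow> cmod (\<rho> \<gamma>) = 1"
  shows "\<exists>J. matches br I J \<and> (\<forall>\<gamma>\<in>\<Gamma>. \<i> * \<gamma> (cext J (E (- \<gamma>))) = \<rho> \<gamma>)"
proof -
  interpret K: matching br ip h P E N \<Gamma> I K using K by (rule matchingI)
  \<comment> \<open>Solves \<open>\<i> * cnj (c \<gamma>) = \<rho> \<gamma>\<close>, because
    \<open>\<gamma> (J' (E (- \<gamma>)))\<close> is the conjugate of the coefficient.\<close>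
  define c where "c \<gamma> = \<i> * cnj (\<rho> \<gamma>)" for \<gamma>
  have "cmod (c \<gamma>) = 1" if "\<gamma> \<in> \<Gamma>" for \<gamma> using \<rho>[OF that] by (simp add: c_def norm_mult)
  then obtain J where J: "matches br I J" "cext J = Jc (Fs c)"
    using Jc_matches K.Jc_involution[OF dim] by metis
  have "\<i> * \<gamma> (cext J (E (- \<gamma>))) = \<rho> \<gamma>" if g: "\<gamma> \<in> \<Gamma>" for \<gamma>
  proof -
    have R: "\<gamma> \<in> \<Delta>" "\<gamma> \<in> P" using g stem_P P_roots by auto
    have "cext J (E (- \<gamma>)) = cnj (c \<gamma>) *\<^sub>C pp (Hc \<gamma>)"
      using R by (simp add: J(2) Jc_uminus_E Jc_Fs_stem[OF g] tau_simps tau_pm_coroot)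
    then have "\<gamma> (cext J (E (- \<gamma>))) = cnj (c \<gamma>)"
      using dual_simps(3)[OF root_dual[OF R(1)] pp_in_h[OF coroot_in_h[OF R(1)]]]
        K.stem_dual_basis[OF g g] by simp
    then show ?thesis by (simp add: c_def)
  qed
  then show ?thesis using J by blast
qed

end

no_notation csc (infixr "*\<^sub>C" 75)

theorem theorem4p29:
  fixes br :: "'u::real_vector \<Rightarrow> 'u \<Rightarrow> 'u"
    and h :: "'u cpx set"
    and P \<Gamma> :: "('u cpx \<Rightarrow> complex) set"
    and E :: "('u cpx \<Rightarrow> complex) \<Rightarrow> 'u cpx"
    and N :: "('u cpx \<Rightarrow> complex) \<Rightarrow> ('u cpx \<Rightarrow> complex) \<Rightarrow> int"
    and I :: "'u \<Rightarrow> 'u"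
  assumes "compact_lie_algebra br"
    and "cartan_subalgebra br h" and "tau ` h \<subseteq> h"
    and "positive_system br h P"
    and "weyl_chevalley_basis br h E N"
    and "is_stem P \<Gamma>"
    and "2 * card \<Gamma> = cx.dim h"
    and "b_complex_structure br h P I"
    and "admissible br I"
  shows "(\<forall>J. matches br I J \<longrightarrow>
            (\<forall>\<gamma>\<in>\<Gamma>. cext J (E (- \<gamma>)) \<in> h \<and> cmod (\<i> * \<gamma> (cext J (E (- \<gamma>)))) = 1)) \<and>
         (\<forall>\<rho> :: ('u cpx \<Rightarrow> complex) \<Rightarrow> complex. (\<forall>\<gamma>\<in>\<Gamma>. cmod (\<rho> \<gamma>) = 1) \<longrightarrow>
            (\<exists>!J. matches br I J \<and> (\<forall>\<gamma>\<in>\<Gamma>. \<i> * \<gamma> (cext J (E (- \<gamma>))) = \<rho> \<gamma>))) \<and>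
         (\<forall>J. matches br I J \<and> (\<forall>\<gamma>\<in>\<Gamma>. \<i> * \<gamma> (cext J (E (- \<gamma>))) = 1) \<longrightarrow>
            (\<forall>\<gamma>\<in>\<Gamma>.
               cext J (Wvec br h \<gamma>) = - Xvec E \<gamma> \<and>
               cext J (Zvec br h I \<gamma>) = Yvec E \<gamma> \<and>
               (\<forall>\<alpha>\<in>Phi_plus P \<gamma>.
                  cext J (Xvec E \<alpha>) = csc (- of_int (N \<gamma> (- (\<gamma> - \<alpha>)))) (Yvec E (\<gamma> - \<alpha>)))))"
proof -
  obtain ip :: "'u \<Rightarrow> 'u \<Rightarrow> real" where ip: "bilinear ip" "\<And>x y. ip x y = ip y x"
    "\<And>x. x \<noteq> 0 \<Longrightarrow> ip x x > 0" "\<And>x y z. ip (br x y) z = - ip y (br x z)"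
    using assms(1) unfolding compact_lie_algebra_def by blast
  interpret b_structure br ip h P E N \<Gamma> I
  proof
    show "lie_bracket br" "\<exists>B::'u set. finite B \<and> span B = UNIV"
      using assms(1) unfolding compact_lie_algebra_def by simp_all
  qed (fact ip assms)+
  obtain K where K: "matches br I K" using assms(9) by (auto simp: admissible_def)
  show ?thesis
  proof (intro conjI allI impI ballI)
    fix J \<gamma> assume "matches br I J" and g: "\<gamma> \<in> \<Gamma>"
    then interpret J: matching br ip h P E N \<Gamma> I J by (intro matchingI)
    show "cext J (E (- \<gamma>)) \<in> h" by (rule J.stem_J_uminus_stem[OF g])
    show "cmod (\<i> * \<gamma> (cext J (E (- \<gamma>)))) = 1"
      using J.cmod_cc[OF g] by (simp add: J.stem_J_uminus_stem[OF g] norm_mult)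
  next
    fix \<rho> :: "('u cpx \<Rightarrow> complex) \<Rightarrow> complex"
    assume "\<forall>\<gamma>\<in>\<Gamma>. cmod (\<rho> \<gamma>) = 1"
    then have "\<exists>J. matches br I J \<and> (\<forall>\<gamma>\<in>\<Gamma>. \<i> * \<gamma> (cext J (E (- \<gamma>))) = \<rho> \<gamma>)"
      using matching_exists[OF K assms(7), of \<rho>] by blast
    moreover have "J1 = J2"
      if J1: "matches br I J1 \<and> (\<forall>\<gamma>\<in>\<Gamma>. \<i> * \<gamma> (cext J1 (E (- \<gamma>))) = \<rho> \<gamma>)"
        and J2: "matches br I J2 \<and> (\<forall>\<gamma>\<in>\<Gamma>. \<i> * \<gamma> (cext J2 (E (- \<gamma>))) = \<rho> \<gamma>)" for J1 J2
    proof (rule matching_unique[OF conjunct1[OF J1] conjunct1[OF J2] assms(7)])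
      fix \<gamma> assume "\<gamma> \<in> \<Gamma>"
      then have "\<i> * \<gamma> (cext J1 (E (- \<gamma>))) = \<i> * \<gamma> (cext J2 (E (- \<gamma>)))" using J1 J2 by simp
      then show "\<gamma> (cext J1 (E (- \<gamma>))) = \<gamma> (cext J2 (E (- \<gamma>)))" by simp
    qed
    ultimately show "\<exists>!J. matches br I J \<and> (\<forall>\<gamma>\<in>\<Gamma>. \<i> * \<gamma> (cext J (E (- \<gamma>))) = \<rho> \<gamma>)"
      by (intro ex_ex1I)
  next
    fix J \<gamma>
    assume J: "matches br I J \<and> (\<forall>\<gamma>\<in>\<Gamma>. \<i> * \<gamma> (cext J (E (- \<gamma>))) = 1)" and g: "\<gamma> \<in> \<Gamma>"
    interpret J: matching br ip h P E N \<Gamma> I J using J by (intro matchingI) simp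
    have one: "\<i> * \<gamma> (cext J (E (- \<gamma>))) = 1" using J g by blast
    show "cext J (Wvec br h \<gamma>) = - Xvec E \<gamma>" by (rule J.J_Wvec_Zvec_Xvec(1)[OF one g])
    show "cext J (Zvec br h I \<gamma>) = Yvec E \<gamma>" by (rule J.J_Wvec_Zvec_Xvec(2)[OF one g])
    fix \<alpha> assume "\<alpha> \<in> Phi_plus P \<gamma>"
    then show "cext J (Xvec E \<alpha>) = csc (- of_int (N \<gamma> (- (\<gamma> - \<alpha>)))) (Yvec E (\<gamma> - \<alpha>))"
      by (rule J.J_Wvec_Zvec_Xvec(3)[OF one g])
  qed
qed

end
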